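(* Let $\mathbb X$ be $\mathbb S^d$, $\mathbb R^d$, or $\mathbb H^d$, and let $\{S_{W_1\dots W_n}\}_{n\ge1}$ be a random sequence of polarizations on $\mathbb X$ defined by independent random variables $W_i$ that are identically distributed according to a probability measure $\mu$ on $\Omega$ with $\mu(\{R=0\})=0$. Let $\operatorname{support}\mu$ be the smallest closed set of full $\mu$-measure in $\Omega$, and set $$G=\{u\in\mathbb S^{d-1}:(0,u)\in\operatorname{support}\mu\}.$$ If the orbit $\mathcal O_{G,x}$ is dense in $\mathbb S^{d-1}$ for each $x\in\mathbb S^{d-1}$, then $$P\left(\lim_{n\to\infty}\|S_{W_1\dots W_n}f-f^*\|_\infty=0\quad \forall f\in \mathcal C_c^+(\mathbb X)\right)=1 .$$
   Context: $\mathbb X$ is the sphere $\mathbb S^d$, Euclidean space $\mathbb R^d$, or standard hyperbolic space $\mathbb H^d$, with its uniform Riemannian distance $d(x,y)$, Riemannian volume $m$, and a distinguished point $o\in\mathbb X$ (the origin). $\mathcal C_c^+(\mathbb X)$ is the space of nonnegative continuous compactly supported functions on $\mathbb X$. For $A\subset\mathbb X$ of finite volume, $A^*$ is the open ball centered at $o$ with $m(A^* )=m(A)$ (if $\mathbb X=\mathbb S^d$ and $m(A)=m(\mathbb S^d)$, take $A^*=\mathbb S^d$). For nonnegative measurable $f$ whose level sets $\{f>t\}$, $t>0$, have finite volume, the symmetric decreasing rearrangement is $f^*(x)=\int_0^\infty \mathbf 1_{\{f>t\}^*}(x)\,dt$. A reflection of $\mathbb X$ is an isometry $\sigma$ with $\sigma^2=I$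 exchanging two complementary half-spaces such that $d(x,\sigma y)\ge d(x,y)$ whenever $x,y$ lie in the same half-space. For distinct $x,y$ there is a unique reflection mapping $x$ to $y$. Fix normal (geodesic polar) coordinates $x=(r,u)$ centered at $o$, with $r=d(x,o)$ and $u\in\mathbb S^{d-1}$, and let $\Omega=[0,\infty)\times\mathbb S^{d-1}$. For $\omega=(r,u)\in\Omega$ with $r>0$ (and $r\le\pi$ if $\mathbb X=\mathbb S^d$), $\sigma_\omega$ is the reflection mapping $o$ to the point with normal coordinates $(r,u)$. Writing $\bar x=\sigma_\omega x$, $H^+=\{x:d(x,o)\le d(\bar x,o)\}$, $H^-=\{x:d(x,o)\ge d(\bar x,o)\}$, the polarization $S_\omega f$ is $S_\omega f(x)=\max\{f(x),f(\bar x)\}$ for $x\in H^+$ and $S_\omega f(x)=\min\{f(x),f(\bar x)\}$ for $x\in H^-$. Set $S_{\omega_1\dots\omega_n}=S_{\omega_n}\circ\dots\circ S_{\omega_1}$. A random variable $W=(R,U)$ on $\Omega$ used to define a random polarization has as distribution a Borel probability measure $\mu$ on $\Omega$ with $\mu(R=0)=0$, and, if $\mathbb X=\mathbb S^d$, also $\mu(R>\pi)=0$. For a sequence of independent $W_i$, $P$ is the product measure on $\Omega^{\mathbb N}$. The points $(0,u)$ and $(0,-u)$ are not identified in $\Omega$. Folding maps: for $u\in\mathbb S^{d-1}$, $\tau_u$ fixes the half-space $H_u^+$ through $o$ having $u$ as exterior normal at $o$, and reflects the complementary half-space $H_u^-$ across their common boundary. On $\mathbb S^{d-1}$ (directions at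 $o$) this is $\tau_u x=x$ if $\langle x,u\rangle\le 0$ and $\tau_u x=x-2\langle x,u\rangle u$ if $\langle x,u\rangle>0$. For $G\subset\mathbb S^{d-1}$, the orbit of $x$ under $G$ is $\mathcal O_{G,x}=\{\tau_{u_n}\cdots\tau_{u_1}x:\ n\ge0,\ u_1,\dots,u_n\in G\}$. *)

theory Defs
  imports "HOL-Probability.Probability"
begin

text \<open>
  The dimension is \<open>d = DIM('a)\<close>; \<open>'a\<close> plays the role of the tangent space at the origin, so that
  \<open>\<S>^(d-1)\<close> is \<open>sphere (0::'a) 1\<close>. The sphere \<open>\<S>^d\<close> and the hyperboloid model of \<open>\<H>^d\<close> live in
  \<open>'a \<times> real\<close>, both with origin \<open>(0, 1)\<close>.
\<close>

record ('p, 'a) space_form =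
  pts :: "'p set"
  dst :: "'p \<Rightarrow> 'p \<Rightarrow> real"
  vol :: "'p set \<Rightarrow> ennreal"
  orig :: 'p
  polar :: "real \<Rightarrow> 'a \<Rightarrow> 'p"

definition euclidean_form :: "('a::euclidean_space, 'a) space_form" where
  "euclidean_form =
    \<lparr> pts = UNIV, dst = dist, vol = emeasure lborel, orig = 0, polar = (\<lambda>r u. r *\<^sub>R u) \<rparr>"

text \<open>
  Riemannian volume of Borel subsets of \<open>\<S>^d\<close> and \<open>\<H>^d\<close>. For the sphere, polar coordinates
  \<open>z = t x\<close> (\<open>t > 0\<close>, \<open>x \<in> \<S>^d\<close>) split Lebesgue measure on \<open>'a \<times> real\<close> as \<open>t^d dt dm(x)\<close>. The same holds
  for \<open>x \<in> \<H>^d\<close> inside the open future light cone: Lebesgue measure is the volume of the Minkowski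
  metric, which in these coordinates is \<open>-dt^2 + t^2 g\<close> with \<open>g\<close> the metric of \<open>\<H>^d\<close>.
  Hence in both cases \<open>m(A) = (d+1) \<lambda>{t x | 0 < t \<le> 1, x \<in> A}\<close>.
\<close>

definition cone_vol :: "('a::euclidean_space \<times> real) set \<Rightarrow> ennreal" where
  "cone_vol A =
    ennreal (real (DIM('a) + 1)) * emeasure lborel {t *\<^sub>R x | t x. 0 < t \<and> t \<le> 1 \<and> x \<in> A}"

definition spherical_form :: "('a::euclidean_space \<times> real, 'a) space_form" where
  "spherical_form =
    \<lparr> pts = sphere 0 1,
      dst = (\<lambda>x y. arccos (x \<bullet> y)),
      vol = cone_vol,
      orig = (0, 1),
      polar = (\<lambda>r u. (sin r *\<^sub>R u, cos r)) \<rparr>"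

definition hyperbolic_form :: "('a::euclidean_space \<times> real, 'a) space_form" where
  "hyperbolic_form =
    \<lparr> pts = {(v, s). 0 < s \<and> s\<^sup>2 - v \<bullet> v = 1},
      dst = (\<lambda>x y. arcosh (snd x * snd y - fst x \<bullet> fst y)),
      vol = cone_vol,
      orig = (0, 1),
      polar = (\<lambda>r u. (sinh r *\<^sub>R u, cosh r)) \<rparr>"

definition Omega :: "(real \<times> 'a::euclidean_space) set" where
  "Omega = {0..} \<times> sphere 0 1"

text \<open>
  In these three spaces the closed half-spaces are exactly the sets of points at least as close to
  \<open>p\<close> as to \<open>q\<close>, for distinct \<open>p\<close> and \<open>q\<close>; exchanging \<open>p\<close> and \<open>q\<close> gives the complementary half-space.
\<close>

definition half_space :: "('p, 'a) space_form \<Rightarrow> 'p \<Rightarrow> 'p \<Rightarrow> 'p set" where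
  "half_space X p q = {x \<in> pts X. dst X x p \<le> dst X x q}"

text \<open>
  Maps are normalised by extensionality outside \<open>pts X\<close>, so that the reflection taking one given
  point to another is unique as a function.
\<close>

definition is_reflection :: "('p, 'a) space_form \<Rightarrow> ('p \<Rightarrow> 'p) \<Rightarrow> bool" where
  "is_reflection X \<sigma> \<longleftrightarrow>
    \<sigma> \<in> extensional (pts X) \<and>
    bij_betw \<sigma> (pts X) (pts X) \<and>
    (\<forall>x\<in>pts X. \<forall>y\<in>pts X. dst X (\<sigma> x) (\<sigma> y) = dst X x y) \<and>
    (\<forall>x\<in>pts X. \<sigma> (\<sigma> x) = x) \<and>
    (\<exists>p\<in>pts X. \<exists>q\<in>pts X. p \<noteq> q \<and>
      \<sigma> ` half_space X p q = half_space X q p \<and>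
      \<sigma> ` half_space X q p = half_space X p q \<and>
      (\<forall>H\<in>{half_space X p q, half_space X q p}.
        \<forall>x\<in>H. \<forall>y\<in>H. dst X x (\<sigma> y) \<ge> dst X x y))"

text \<open>Only meaningful for \<open>r > 0\<close>, and \<open>r \<le> pi\<close> on the sphere.\<close>

definition reflection :: "('p, 'a) space_form \<Rightarrow> real \<times> 'a \<Rightarrow> 'p \<Rightarrow> 'p" where
  "reflection X \<omega> = (THE \<sigma>. is_reflection X \<sigma> \<and> \<sigma> (orig X) = polar X (fst \<omega>) (snd \<omega>))"

text \<open>
  On the common boundary of the two half-spaces the reflection fixes \<open>x\<close>, so both branches agree.
\<close>

definition polarization ::
    "('p, 'a) space_form \<Rightarrow> real \<times> 'a \<Rightarrow> ('p \<Rightarrow> real) \<Rightarrow> 'p \<Rightarrow> real" where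
  "polarization X \<omega> f x =
    (if dst X x (orig X) \<le> dst X (reflection X \<omega> x) (orig X)
     then max (f x) (f (reflection X \<omega> x))
     else min (f x) (f (reflection X \<omega> x)))"

text \<open>The first polarization in the list is applied first.\<close>

definition polarizations ::
    "('p, 'a) space_form \<Rightarrow> (real \<times> 'a) list \<Rightarrow> ('p \<Rightarrow> real) \<Rightarrow> 'p \<Rightarrow> real" where
  "polarizations X \<omega>s f = fold (polarization X) \<omega>s f"

definition orig_ball :: "('p, 'a) space_form \<Rightarrow> real \<Rightarrow> 'p set" where
  "orig_ball X \<rho> = {x \<in> pts X. dst X x (orig X) < \<rho>}"

text \<open>
  Only used for sets of finite volume; then the first case can only occur on the sphere. The ball
  of radius \<open>0\<close> is empty.
\<close>

definition set_rearr :: "('p, 'a) space_form \<Rightarrow> 'p set \<Rightarrow> 'p set" where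
  "set_rearr X A =
    (if vol X A = vol X (pts X) then pts X
     else THE B. (\<exists>\<rho>\<ge>0. B = orig_ball X \<rho>) \<and> vol X B = vol X A)"

definition sym_decr_rearr :: "('p, 'a) space_form \<Rightarrow> ('p \<Rightarrow> real) \<Rightarrow> 'p \<Rightarrow> real" where
  "sym_decr_rearr X f x = (LINT t:{0<..}|lborel. indicator (set_rearr X {y \<in> pts X. f y > t}) x)"

definition Cc_plus :: "('p::topological_space, 'a) space_form \<Rightarrow> ('p \<Rightarrow> real) set" where
  "Cc_plus X = {f. continuous_on (pts X) f \<and> (\<forall>x\<in>pts X. 0 \<le> f x) \<and>
    (\<exists>K. compact K \<and> K \<subseteq> pts X \<and> (\<forall>x\<in>pts X - K. f x = 0))}"

definition sup_norm :: "('p, 'a) space_form \<Rightarrow> ('p \<Rightarrow> real) \<Rightarrow> ennreal" where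
  "sup_norm X g = (SUP x\<in>pts X. ennreal \<bar>g x\<bar>)"

definition measure_support :: "(real \<times> 'a::euclidean_space) measure \<Rightarrow> (real \<times> 'a) set" where
  "measure_support \<mu> =
    \<Inter>{C. closedin (top_of_set Omega) C \<and> emeasure \<mu> C = emeasure \<mu> (space \<mu>)}"

definition folding :: "'a::euclidean_space \<Rightarrow> 'a \<Rightarrow> 'a" where
  "folding u x = (if x \<bullet> u \<le> 0 then x else x - (2 * (x \<bullet> u)) *\<^sub>R u)"

definition folding_orbit :: "'a::euclidean_space set \<Rightarrow> 'a \<Rightarrow> 'a set" where
  "folding_orbit G x = {fold folding us x | us. set us \<subseteq> G}"

end

theory Submission
  imports Defs "HOL-Complex_Analysis.Great_Picard"
begin

text \<open>
  Weight functions by a strictly decreasing function of the distance to the origin. The weighted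
  integral never decreases under a polarization, and it stays the same only if the
  polarization fixes the function. By independence, the expected gains of the successive steps add up to
  a bounded quantity, so almost surely the mean gain of \<open>F_n = S_{W_1 ... W_n} f\<close> under one further random
  polarization tends to \<open>0\<close>. Polarizations preserve the modulus of continuity, so by
  Arzela-Ascoli the \<open>F_n\<close> have uniform limit points, and every limit point \<open>g\<close> is fixed by
  \<open>S_\<omega>\<close> for all \<open>\<omega>\<close> in the support of \<open>\<mu>\<close>. At the points \<open>(0, u)\<close> of the support this says that folding
  along \<open>u\<close> does not decrease \<open>g\<close>, so \<open>g\<close> is radial by density of the orbits. The
  points of the support with small \<open>r > 0\<close> then make \<open>g\<close> decreasing in the distance to the origin. Since
  \<open>g\<close> is equimeasurable with \<open>f\<close>, it equals \<open>f^*\<close>. A countable dense family of functions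
  \<open>f\<close> suffices because polarizations contract the supremum norm.
\<close>

section \<open>Linear involutions preserve Lebesgue measure\<close>

text \<open>The mirrors behind \<open>G\<close> pass through the origin and, since \<mu> gives R = 0
  no mass, almost surely none of them is ever applied. They act only through a closure argument: the
  parameters that leave a given continuous \<open>g\<close> unchanged form a closed subset of
  \<open>Omega\<close>, and if almost every parameter belongs to it, so does the whole support,
  including its points with r = 0. Hence polarization is extended to r = 0 by an explicit formula,
  and foldings are used on limit points only, never along the sequence. A limit point depends on the
  random sequence, so no null set may be chosen after it. For each \<open>f\<close> one null set is
  discarded, outside of which the mean gain of the iterates tends to 0; the gain is Lipschitz in the
  supremum norm, so the mean gain of every limit point is 0. A folding yields only an inequality
  between two directions. Density extends it to all ordered pairs of directions, and exchanging the
  two gives equality.\<close>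

text \<open>Both sides are the double integral of \<open>indicator A x * indicator B (x + y)\<close>.\<close>

lemma emeasure_translation_invariant_proportional:
  fixes M :: "'a::euclidean_space measure"
  assumes sets: "sets M = sets borel" and sf: "sigma_finite_measure M"
    and trans: "\<And>z. distr M borel ((+) z) = M"
    and A[measurable]: "A \<in> sets borel" and B[measurable]: "B \<in> sets borel"
  shows "emeasure lborel A * emeasure M B = emeasure lborel B * emeasure M (uminus -` A)"
proof -
  note [measurable_cong] = sets
  interpret M: sigma_finite_measure M by fact
  interpret L: sigma_finite_measure "lborel :: 'a measure" by (rule sigma_finite_lborel)
  interpret P: pair_sigma_finite M "lborel :: 'a measure" ..
  have "emeasure lborel A * emeasure M B = (\<integral>\<^sup>+x. indicator A x * emeasure M B \<partial>lborel)"
    by (simp add: nn_integral_multc)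
  also have "\<dots> = (\<integral>\<^sup>+x. (\<integral>\<^sup>+y. indicator A x * indicator B (x + y) \<partial>M) \<partial>lborel)"
  proof (rule nn_integral_cong)
    fix x :: 'a
    have "emeasure M B = emeasure (distr M borel ((+) x)) B" by (simp add: trans)
    also have "\<dots> = (\<integral>\<^sup>+y. indicator B y \<partial>distr M borel ((+) x))" by simp
    also have "\<dots> = (\<integral>\<^sup>+y. indicator B (x + y) \<partial>M)"
      by (subst nn_integral_distr) auto
    finally show "indicator A x * emeasure M B = (\<integral>\<^sup>+y. indicator A x * indicator B (x + y) \<partial>M)"
      by (simp add: nn_integral_cmult)
  qed
  also have "\<dots> = (\<integral>\<^sup>+y. (\<integral>\<^sup>+x. indicator A x * indicator B (x + y) \<partial>lborel) \<partial>M)"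
    by (subst P.Fubini') auto
  also have "\<dots> = (\<integral>\<^sup>+y. (\<integral>\<^sup>+x. indicator A (x - y) * indicator B x \<partial>lborel) \<partial>M)"
  proof (rule nn_integral_cong)
    fix y :: 'a
    have "(\<integral>\<^sup>+x. indicator A (x - y) * indicator B x \<partial>lborel)
        = (\<integral>\<^sup>+x. indicator A (x - y) * indicator B x \<partial>distr lborel borel ((+) y))"
      using lborel_distr_plus[of y] by simp
    also have "\<dots> = (\<integral>\<^sup>+x. indicator A x * indicator B (x + y) \<partial>lborel)"
      by (subst nn_integral_distr) (auto simp: add.commute)
    finally show "(\<integral>\<^sup>+x. indicator A x * indicator B (x + y) \<partial>lborel)
       = (\<integral>\<^sup>+x. indicator A (x - y) * indicator B x \<partial>lborel)" by simp
  qed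
  also have "\<dots> = (\<integral>\<^sup>+x. (\<integral>\<^sup>+y. indicator A (x - y) * indicator B x \<partial>M) \<partial>lborel)"
    by (subst P.Fubini') auto
  also have "\<dots> = (\<integral>\<^sup>+x. emeasure M (uminus -` A) * indicator B x \<partial>lborel)"
  proof (rule nn_integral_cong)
    fix x :: 'a
    have [measurable]: "uminus -` A \<in> sets borel"
      using measurable_sets[of uminus borel borel A] by simp
    have "emeasure M (uminus -` A) = emeasure (distr M borel ((+) (- x))) (uminus -` A)"
      by (simp add: trans)
    also have "\<dots> = (\<integral>\<^sup>+y. indicator (uminus -` A) y \<partial>distr M borel ((+) (- x)))" by simp
    also have "\<dots> = (\<integral>\<^sup>+y. indicator (uminus -` A) (- x + y) \<partial>M)"
      by (subst nn_integral_distr) auto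
    also have "\<dots> = (\<integral>\<^sup>+y. indicator A (x - y) \<partial>M)"
      by (intro nn_integral_cong) (simp add: indicator_def)
    finally show "(\<integral>\<^sup>+y. indicator A (x - y) * indicator B x \<partial>M)
        = emeasure M (uminus -` A) * indicator B x"
      by (simp add: nn_integral_multc)
  qed
  also have "\<dots> = emeasure lborel B * emeasure M (uminus -` A)"
    by (simp add: nn_integral_multc mult.commute[of _ "emeasure M _"] nn_integral_cmult)
  finally show ?thesis .
qed

text \<open>The image measure is again translation invariant, hence a multiple \<open>c\<close> of
  Lebesgue measure; applying \<open>f\<close> twice gives \<open>c * c = 1\<close>. One lemma thus
  serves orthogonal and Lorentz reflections alike.\<close>

lemma lborel_distr_linear_involution:
  fixes f :: "'a::euclidean_space \<Rightarrow> 'a"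
  assumes lin: "linear f" and inv: "\<And>x. f (f x) = x"
  shows "distr lborel borel f = lborel"
proof -
  define M where "M = distr lborel borel f"
  have cont: "continuous_on UNIV f" using lin by (simp add: linear_continuous_on linear_conv_bounded_linear)
  have f[measurable]: "f \<in> borel_measurable borel"
    using cont by (rule borel_measurable_continuous_onI)
  have sets[measurable_cong]: "sets M = sets borel" by (simp add: M_def)
  have bij: "bij f" using inv by (metis bijI')
  have vim: "f -` A = f ` A" for A by (auto simp: image_iff inv) (metis inv)
  have trans: "distr M borel ((+) z) = M" for z
  proof -
    have "distr M borel ((+) z) = distr lborel borel ((+) z \<circ> f)"
      unfolding M_def by (subst distr_distr) (auto simp: comp_def)
    also have "(+) z \<circ> f = f \<circ> (+) (f z)"
      using lin by (auto simp: linear_add inv)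
    also have "distr lborel borel (f \<circ> (+) (f z)) = distr (distr lborel borel ((+) (f z))) borel f"
      by (subst distr_distr) (auto simp: comp_def)
    also have "\<dots> = M"
      by (simp add: lborel_distr_plus M_def)
    finally show ?thesis .
  qed
  have emM: "emeasure M A = emeasure lborel (f ` A)" if "A \<in> sets borel" for A
    using that unfolding M_def by (subst emeasure_distr) (auto simp: vim)
  have fin: "emeasure M (cbox a b) < \<infinity>" for a b
  proof -
    have "bounded (f ` cbox a b)"
      using lin by (simp add: bounded_linear_image linear_conv_bounded_linear)
    then show ?thesis
      using emM[of "cbox a b"] emeasure_bounded_finite[of "f ` cbox a b"] by simp
  qed
  have sf: "sigma_finite_measure M"
  proof
    show "\<exists>A. countable A \<and> A \<subseteq> sets M \<and> \<Union> A = space M \<and> (\<forall>a\<in>A. emeasure M a \<noteq> \<infinity>)"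
    proof (intro exI[of _ "range (\<lambda>n::nat. cball (0::'a) (real n))"] conjI ballI)
      show "\<Union> (range (\<lambda>n::nat. cball (0::'a) (real n))) = space M"
        by (auto simp: M_def intro: real_arch_simple)
    next
      fix a assume "a \<in> range (\<lambda>n::nat. cball (0::'a) (real n))"
      then obtain n where a: "a = cball 0 (real n)" by auto
      have "bounded (f ` a)" unfolding a
        using lin by (simp add: bounded_linear_image linear_conv_bounded_linear)
      then show "emeasure M a \<noteq> \<infinity>"
        using emM[of a] emeasure_bounded_finite[of "f ` a"] by (auto simp: a)
    qed (auto simp: sets)
  qed
  define B :: "'a set" where "B = cbox 0 One"
  have B: "emeasure lborel B = 1" unfolding B_def by (simp add: emeasure_lborel_cbox_eq)
  have Bm[measurable]: "B \<in> sets borel" unfolding B_def by simp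
  define c where "c = emeasure M B"
  have cfin: "c < \<infinity>" unfolding c_def B_def by (rule fin)
  have scale: "emeasure M A = c * emeasure lborel A" if "A \<in> sets borel" for A
  proof -
    note A[measurable] = that
    \<comment> \<open>The proportionality lemma returns the reflected set, so it is applied to the
      reflection of \<open>A\<close>, which has the same Lebesgue measure.\<close>
    have A': "uminus -` A \<in> sets borel" using measurable_sets[of uminus borel borel A] by simp
    have A'': "uminus -` (uminus -` A) = A" by auto
    have "emeasure lborel (uminus -` A) = emeasure (distr lborel borel uminus) A"
      by (subst emeasure_distr) auto
    also have "\<dots> = emeasure lborel A" using lborel_affine[of "-1" "0::'a"] by (simp add: density_1)
    finally show ?thesis
      using emeasure_translation_invariant_proportional[OF sets sf trans A' Bm] A'' B
      by (simp add: c_def mult.commute)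
  qed
  have "1 = emeasure lborel B" by (simp add: B)
  also have "\<dots> = emeasure lborel (f ` (f ` B))" by (simp add: image_image inv)
  also have "\<dots> = emeasure M (f ` B)" using emM[of "f ` B"] vim[of B] measurable_sets[OF f Bm] by simp
  also have "\<dots> = c * c"
    using scale[of "f ` B"] emM[OF Bm] vim[of B] measurable_sets[OF f Bm] by (simp add: c_def)
  finally have cc: "c * c = 1" by simp
  have "c = 1"
  proof -
    obtain r where r: "c = ennreal r" "r \<ge> 0" using cfin by (cases c) auto
    then have "ennreal (r * r) = ennreal 1" using cc by (simp add: ennreal_mult)
    then have "r * r = 1" using r by (metis ennreal_inj mult_nonneg_nonneg zero_le_one)
    then have "r = 1" using r by (metis abs_of_nonneg abs_square_eq_1 power2_eq_square)
    with r show ?thesis by simp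
  qed
  show ?thesis
  proof (rule measure_eqI)
    fix A assume "A \<in> sets (distr lborel borel f)"
    then show "emeasure (distr lborel borel f) A = emeasure lborel A"
      using scale[of A] \<open>c = 1\<close> by (simp add: M_def)
  qed simp
qed

section \<open>A common model of the three spaces\<close>

text \<open>
  \<open>b\<close> is the inner product for \<open>\<real>^d\<close> and \<open>\<S>^d\<close> and the Minkowski form for \<open>\<H>^d\<close>. In each
  case the distance is an increasing function of \<open>b (x - y) (x - y)\<close>, and the reflection \<open>\<sigma>_\<omega>\<close> is
  \<open>x - 2 (b x (N \<omega>) - c \<omega>) N \<omega>\<close>. This formula is continuous up to \<open>r = 0\<close>, where it gives the reflection
  behind the folding map \<open>\<tau>_u\<close>. \<open>D\<close> is the range of the polar radius, and \<open>m\<close> is the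
  Riemannian volume extended by zero to all Borel sets of \<open>'p\<close>.
\<close>

locale polar_model =
  fixes X :: "('p::euclidean_space, 'a::euclidean_space) space_form"
    and b :: "'p \<Rightarrow> 'p \<Rightarrow> real"
    and N :: "real \<times> 'a \<Rightarrow> 'p"
    and c :: "real \<times> 'a \<Rightarrow> real"
    and D :: "real set"
    and m :: "'p measure"
  assumes bil: "bounded_bilinear b"
    and sym: "b x y = b y x"
    and closed_pts: "closed (pts X)"
    and orig_pts: "orig X \<in> pts X"
    and dst_le: "\<lbrakk>x \<in> pts X; y \<in> pts X; x' \<in> pts X; y' \<in> pts X\<rbrakk> \<Longrightarrow>
        dst X x y \<le> dst X x' y' \<longleftrightarrow> b (x - y) (x - y) \<le> b (x' - y') (x' - y')"
    and gauge_nonneg: "\<lbrakk>x \<in> pts X; y \<in> pts X\<rbrakk> \<Longrightarrow> 0 \<le> b (x - y) (x - y)"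
    and gauge_zero: "\<lbrakk>x \<in> pts X; y \<in> pts X; b (x - y) (x - y) = 0\<rbrakk> \<Longrightarrow> x = y"
    and gauge_coercive: "\<exists>R'. \<forall>x\<in>pts X. \<forall>y\<in>pts X. b (x - orig X) (x - orig X) \<le> R \<longrightarrow>
        b (x - y) (x - y) \<le> 1 \<longrightarrow> b (y - orig X) (y - orig X) \<le> R'"
    and bounded_gauge: "bounded {x \<in> pts X. b (x - orig X) (x - orig X) \<le> R}"
    and cont_N: "continuous_on UNIV N"
    and cont_c: "continuous_on UNIV c"
    and N_unit: "\<omega> \<in> Omega \<Longrightarrow> b (N \<omega>) (N \<omega>) = 1"
    and mirror_pts: "\<lbrakk>\<omega> \<in> Omega; x \<in> pts X\<rbrakk> \<Longrightarrow> x - (2 * (b x (N \<omega>) - c \<omega>)) *\<^sub>R N \<omega> \<in> pts X"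
    and height_orig: "\<lbrakk>\<omega> \<in> Omega; 0 < fst \<omega>; fst \<omega> \<in> D\<rbrakk> \<Longrightarrow> b (orig X) (N \<omega>) < c \<omega>"
    and mirror_orig: "\<lbrakk>\<omega> \<in> Omega; 0 < fst \<omega>; fst \<omega> \<in> D\<rbrakk> \<Longrightarrow>
        orig X - (2 * (b (orig X) (N \<omega>) - c \<omega>)) *\<^sub>R N \<omega> = polar X (fst \<omega>) (snd \<omega>)"
    and wall_closure: "\<lbrakk>\<omega> \<in> Omega; 0 < fst \<omega>; fst \<omega> \<in> D; x \<in> pts X; b x (N \<omega>) = c \<omega>\<rbrakk> \<Longrightarrow>
        x \<in> closure {y \<in> pts X. b y (N \<omega>) < c \<omega>}"
    and wall_separates: "\<lbrakk>\<omega> \<in> Omega; 0 < fst \<omega>; fst \<omega> \<in> D; x \<in> pts X; y \<in> pts X;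
        b x (N \<omega>) < c \<omega>; b y (N \<omega>) < c \<omega>;
        \<And>p. \<lbrakk>p \<in> pts X; b p (N \<omega>) = c \<omega>\<rbrakk> \<Longrightarrow> b (p - x) (p - x) = b (p - y) (p - y)\<rbrakk> \<Longrightarrow> x = y"
    and D_nonneg: "r \<in> D \<Longrightarrow> 0 \<le> r"
    and D_down: "\<lbrakk>0 \<le> r; r \<le> s; s \<in> D\<rbrakk> \<Longrightarrow> r \<in> D"
    and polar_pts: "\<lbrakk>r \<in> D; u \<in> sphere 0 1\<rbrakk> \<Longrightarrow> polar X r u \<in> pts X"
    and polar_surj: "x \<in> pts X \<Longrightarrow> \<exists>r\<in>D. \<exists>u\<in>sphere 0 1. x = polar X r u"
    and polar_dst: "\<lbrakk>r \<in> D; u \<in> sphere 0 1\<rbrakk> \<Longrightarrow> dst X (polar X r u) (orig X) = r"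
    and polar_cont: "continuous_on UNIV (\<lambda>(r, u). polar X r u)"
    and polar_fold: "\<lbrakk>r \<in> D; u \<in> sphere 0 1; v \<in> sphere 0 1; 0 < v \<bullet> u\<rbrakk> \<Longrightarrow>
        c (0, u) \<le> b (polar X r v) (N (0, u)) \<and>
        polar X r v - (2 * (b (polar X r v) (N (0, u)) - c (0, u))) *\<^sub>R N (0, u)
          = polar X r (v - (2 * (v \<bullet> u)) *\<^sub>R u)"
    and polar_shift: "\<lbrakk>0 \<le> t; 0 < r; t + r \<in> D; u \<in> sphere 0 1\<rbrakk> \<Longrightarrow>
        b (polar X t (- u)) (N (r, u)) \<le> c (r, u) \<and>
        polar X t (- u) - (2 * (b (polar X t (- u)) (N (r, u)) - c (r, u))) *\<^sub>R N (r, u)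
          = polar X (t + r) u"
    and sets_m: "sets m = sets borel"
    and m_compl: "emeasure m (- pts X) = 0"
    and m_vol: "\<lbrakk>A \<in> sets borel; A \<subseteq> pts X\<rbrakk> \<Longrightarrow> vol X A = emeasure m A"
    and m_inv: "\<omega> \<in> Omega \<Longrightarrow> distr m borel (\<lambda>x. x - (2 * (b x (N \<omega>) - c \<omega>)) *\<^sub>R N \<omega>) = m"
    and m_pos: "\<lbrakk>open U; U \<inter> pts X \<noteq> {}\<rbrakk> \<Longrightarrow> emeasure m U \<noteq> 0"
    and m_fin: "emeasure m {x \<in> pts X. b (x - orig X) (x - orig X) \<le> R} < \<infinity>"
    and balls: "\<lbrakk>0 \<le> s; s < t; orig_ball X s \<noteq> orig_ball X t\<rbrakk> \<Longrightarrow>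
        (\<exists>r\<in>D. s < r \<and> r < t) \<or> emeasure m (orig_ball X s) = emeasure m (pts X)"
begin

sublocale bounded_bilinear b by (rule bil)

text \<open>An affine equation of the mirror. For \<open>\<omega> \<in> valid\<close> the origin has
  negative height, so \<open>height \<omega> x \<le> 0\<close> describes the half-space H+.\<close>

definition height :: "real \<times> 'a \<Rightarrow> 'p \<Rightarrow> real" where
  "height \<omega> x = b x (N \<omega>) - c \<omega>"

definition mirror :: "real \<times> 'a \<Rightarrow> 'p \<Rightarrow> 'p" where
  "mirror \<omega> x = x - (2 * height \<omega> x) *\<^sub>R N \<omega>"

text \<open>Squared distance in Euclidean space, \<open>2 - 2 cos d\<close> on the sphere,
  \<open>2 cosh d - 2\<close> on the hyperboloid. Unlike the distance it is quadratic, so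
  reflections act on it by algebra.\<close>

definition gauge :: "'p \<Rightarrow> 'p \<Rightarrow> real" where
  "gauge x y = b (x - y) (x - y)"

definition valid :: "(real \<times> 'a) set" where
  "valid = {\<omega> \<in> Omega. 0 < fst \<omega> \<and> fst \<omega> \<in> D}"

text \<open>The side is decided by the sign of the height and not by comparing distances to the
  origin: a mirror through the origin preserves these distances, so at r = 0 the comparison would no
  longer tell the sides apart.\<close>

definition two_point :: "real \<times> 'a \<Rightarrow> ('p \<Rightarrow> real) \<Rightarrow> 'p \<Rightarrow> real" where
  "two_point \<omega> f x = (if height \<omega> x \<le> 0 then max (f x) (f (mirror \<omega> x)) else min (f x) (f (mirror \<omega> x)))"

section \<open>Algebra of mirrors and gauge\<close>

lemma valid_Omega: "\<omega> \<in> valid \<Longrightarrow> \<omega> \<in> Omega"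
  by (simp add: valid_def)

lemma mirror_in_pts: "\<omega> \<in> Omega \<Longrightarrow> x \<in> pts X \<Longrightarrow> mirror \<omega> x \<in> pts X"
  unfolding mirror_def height_def by (rule mirror_pts)

lemma height_mirror: "\<omega> \<in> Omega \<Longrightarrow> height \<omega> (mirror \<omega> x) = - height \<omega> x"
  by (simp add: mirror_def height_def diff_left scaleR_left N_unit)

lemma mirror_mirror: "\<omega> \<in> Omega \<Longrightarrow> mirror \<omega> (mirror \<omega> x) = x"
  by (subst mirror_def) (simp add: height_mirror, simp add: mirror_def)

lemma mirror_in_pts_iff: "\<omega> \<in> Omega \<Longrightarrow> mirror \<omega> x \<in> pts X \<longleftrightarrow> x \<in> pts X"
  by (metis mirror_in_pts mirror_mirror)

lemma mirror_wall: "height \<omega> x = 0 \<Longrightarrow> mirror \<omega> x = x"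
  by (simp add: mirror_def)

lemma gauge_commute: "gauge x y = gauge y x"
  unfolding gauge_def by (metis minus_diff_eq minus_left minus_right minus_minus)

text \<open>The mixed term is the source of all sign arguments. It is nonnegative for two points on
  one side, which is the two-point inequality, and with \<open>orig X\<close> as one of the points
  it tells which of a point and its mirror image is farther from the origin.\<close>

lemma gauge_mirror_right:
  assumes "\<omega> \<in> Omega"
  shows "gauge x (mirror \<omega> y) = gauge x y + 4 * height \<omega> x * height \<omega> y"
proof -
  define k where "k = 2 * height \<omega> y"
  have x: "b x (N \<omega>) = height \<omega> x + c \<omega>" and y: "b y (N \<omega>) = height \<omega> y + c \<omega>"
    by (simp_all add: height_def)
  have "gauge x (mirror \<omega> y) = b ((x - y) + k *\<^sub>R N \<omega>) ((x - y) + k *\<^sub>R N \<omega>)"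
    by (simp add: gauge_def mirror_def k_def diff_diff_eq2 diff_add_eq)
  also have "\<dots> = gauge x y + 2 * k * b (x - y) (N \<omega>) + k\<^sup>2"
    using sym[of "N \<omega>" "x - y"] N_unit[OF assms]
    by (simp add: gauge_def add_left add_right scaleR_left scaleR_right power2_eq_square distrib_left)
  also have "b (x - y) (N \<omega>) = height \<omega> x - height \<omega> y"
    by (simp add: diff_left x y)
  finally show ?thesis by (simp add: k_def power2_eq_square algebra_simps)
qed

lemma gauge_mirror_left:
  "\<omega> \<in> Omega \<Longrightarrow> gauge (mirror \<omega> x) y = gauge x y + 4 * height \<omega> x * height \<omega> y"
  using gauge_mirror_right[of \<omega> y x] by (simp add: gauge_commute mult_ac)

lemma gauge_mirror: "\<omega> \<in> Omega \<Longrightarrow> gauge (mirror \<omega> x) (mirror \<omega> y) = gauge x y"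
  by (simp add: gauge_mirror_right gauge_mirror_left height_mirror)

lemma dst_le_gauge:
  "\<lbrakk>x \<in> pts X; y \<in> pts X; x' \<in> pts X; y' \<in> pts X\<rbrakk> \<Longrightarrow> dst X x y \<le> dst X x' y' \<longleftrightarrow> gauge x y \<le> gauge x' y'"
  by (simp add: dst_le gauge_def)

lemma dst_eq_gauge:
  "\<lbrakk>x \<in> pts X; y \<in> pts X; x' \<in> pts X; y' \<in> pts X\<rbrakk> \<Longrightarrow> dst X x y = dst X x' y' \<longleftrightarrow> gauge x y = gauge x' y'"
  by (simp add: order_eq_iff dst_le_gauge)

lemma gauge_ge_0: "\<lbrakk>x \<in> pts X; y \<in> pts X\<rbrakk> \<Longrightarrow> 0 \<le> gauge x y"
  by (simp add: gauge_def gauge_nonneg)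

lemma gauge_eq_0: "\<lbrakk>x \<in> pts X; y \<in> pts X\<rbrakk> \<Longrightarrow> gauge x y = 0 \<longleftrightarrow> x = y"
  using gauge_zero by (auto simp: gauge_def zero_left)

lemma height_orig_neg: "\<omega> \<in> valid \<Longrightarrow> height \<omega> (orig X) < 0"
  by (auto simp: valid_def height_def height_orig)

lemma mirror_orig_polar: "\<omega> \<in> valid \<Longrightarrow> mirror \<omega> (orig X) = polar X (fst \<omega>) (snd \<omega>)"
  unfolding valid_def height_def mirror_def using mirror_orig by blast

lemma continuous_height: "continuous_on UNIV (\<lambda>(\<omega>, x). height \<omega> x)"
  unfolding height_def split_def
  by (intro continuous_intros continuous_on bounded_bilinear.continuous_on[OF bil]
      continuous_on_compose2[OF cont_N] continuous_on_compose2[OF cont_c]) auto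

lemma continuous_mirror: "continuous_on UNIV (\<lambda>(\<omega>, x). mirror \<omega> x)"
  unfolding mirror_def split_def
  by (intro continuous_intros continuous_on_compose2[OF cont_N]
      continuous_height[unfolded split_def]) auto

lemma continuous_gauge: "continuous_on UNIV (\<lambda>(x, y). gauge x y)"
  unfolding gauge_def split_def
  by (intro bounded_bilinear.continuous_on[OF bil] continuous_intros)

lemma continuous_height_right: "continuous_on S (height \<omega>)"
  using continuous_on_compose2[OF continuous_height, of S "\<lambda>x. (\<omega>, x)"]
  by (simp add: continuous_on_Pair continuous_on_const continuous_on_id)

lemma continuous_mirror_right: "continuous_on S (mirror \<omega>)"
  using continuous_on_compose2[OF continuous_mirror, of S "\<lambda>x. (\<omega>, x)"]
  by (simp add: continuous_on_Pair continuous_on_const continuous_on_id)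

text \<open>The two gauges differ by
  \<open>4 * height \<omega> x * height \<omega> (orig X)\<close>, whose second height is
  negative.\<close>

lemma half_space_orig:
  assumes "\<omega> \<in> valid"
  shows "half_space X (orig X) (mirror \<omega> (orig X)) = {x \<in> pts X. height \<omega> x \<le> 0}"
    and "half_space X (mirror \<omega> (orig X)) (orig X) = {x \<in> pts X. height \<omega> x \<ge> 0}"
proof -
  have O: "\<omega> \<in> Omega" using assms by (rule valid_Omega)
  have z: "mirror \<omega> (orig X) \<in> pts X" using O orig_pts by (rule mirror_in_pts)
  have "dst X x (orig X) \<le> dst X x (mirror \<omega> (orig X)) \<longleftrightarrow> height \<omega> x \<le> 0"
       "dst X x (mirror \<omega> (orig X)) \<le> dst X x (orig X) \<longleftrightarrow> height \<omega> x \<ge> 0" if "x \<in> pts X" for x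
    using that z orig_pts height_orig_neg[OF assms]
    by (auto simp: dst_le_gauge gauge_mirror_right[OF O] zero_le_mult_iff mult_le_0_iff)
  then show "half_space X (orig X) (mirror \<omega> (orig X)) = {x \<in> pts X. height \<omega> x \<le> 0}"
    and "half_space X (mirror \<omega> (orig X)) (orig X) = {x \<in> pts X. height \<omega> x \<ge> 0}"
    by (auto simp: half_space_def)
qed

lemma is_reflection_mirror:
  assumes "\<omega> \<in> valid"
  shows "is_reflection X (restrict (mirror \<omega>) (pts X))"
proof -
  let ?s = "restrict (mirror \<omega>) (pts X)"
  have O: "\<omega> \<in> Omega" using assms by (rule valid_Omega)
  have z: "mirror \<omega> (orig X) \<in> pts X" using O orig_pts by (rule mirror_in_pts)
  have ne: "orig X \<noteq> mirror \<omega> (orig X)"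
    using height_orig_neg[OF assms] height_mirror[OF O, of "orig X"] by auto
  have img: "?s ` {x \<in> pts X. height \<omega> x \<le> 0} = {x \<in> pts X. height \<omega> x \<ge> 0}" (is "_ ` ?A = ?B")
    and img': "?s ` {x \<in> pts X. height \<omega> x \<ge> 0} = {x \<in> pts X. height \<omega> x \<le> 0}"
  proof -
    have AB: "mirror \<omega> x \<in> ?B" if "x \<in> ?A" for x
      using that by (simp add: mirror_in_pts[OF O] height_mirror[OF O])
    have BA: "mirror \<omega> x \<in> ?A" if "x \<in> ?B" for x
      using that by (simp add: mirror_in_pts[OF O] height_mirror[OF O])
    have "x \<in> mirror \<omega> ` ?A" if "x \<in> ?B" for x
      using BA[OF that] mirror_mirror[OF O, of x, symmetric] by (rule rev_image_eqI)
    moreover have "x \<in> mirror \<omega> ` ?B" if "x \<in> ?A" for x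
      using AB[OF that] mirror_mirror[OF O, of x, symmetric] by (rule rev_image_eqI)
    ultimately have "mirror \<omega> ` ?A = ?B" "mirror \<omega> ` ?B = ?A"
      using AB BA by blast+
    moreover have "?s ` ?A = mirror \<omega> ` ?A" "?s ` ?B = mirror \<omega> ` ?B"
      by (intro image_cong; simp)+
    ultimately show "?s ` ?A = ?B" "?s ` ?B = ?A" by simp_all
  qed
  have bij: "bij_betw ?s (pts X) (pts X)"
    by (rule bij_betw_byWitness[where f' = "?s"]) (auto simp: mirror_in_pts[OF O] mirror_mirror[OF O])
  have iso: "\<forall>x\<in>pts X. \<forall>y\<in>pts X. dst X (?s x) (?s y) = dst X x y"
    by (simp add: dst_eq_gauge mirror_in_pts[OF O] gauge_mirror[OF O])
  have two: "dst X x y \<le> dst X x (?s y)" if "x \<in> pts X" "y \<in> pts X" "0 \<le> height \<omega> x * height \<omega> y" for x y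
    using that by (simp add: dst_le_gauge mirror_in_pts[OF O] gauge_mirror_right[OF O])
  show ?thesis
    unfolding is_reflection_def
  proof (intro conjI bij iso)
    show "\<exists>p\<in>pts X. \<exists>q\<in>pts X. p \<noteq> q \<and>
      ?s ` half_space X p q = half_space X q p \<and> ?s ` half_space X q p = half_space X p q \<and>
      (\<forall>H\<in>{half_space X p q, half_space X q p}. \<forall>x\<in>H. \<forall>y\<in>H. dst X x y \<le> dst X x (?s y))"
    proof (rule bexI[OF _ orig_pts], rule bexI[OF _ z], intro conjI)
      show "\<forall>H\<in>{half_space X (orig X) (mirror \<omega> (orig X)), half_space X (mirror \<omega> (orig X)) (orig X)}.
          \<forall>x\<in>H. \<forall>y\<in>H. dst X x y \<le> dst X x (?s y)"
        unfolding half_space_orig[OF assms] using two mult_nonpos_nonpos mult_nonneg_nonneg by blast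
    qed (simp_all only: half_space_orig[OF assms] img img' ne not_False_eq_True)
  qed (auto simp: mirror_mirror[OF O] mirror_in_pts[OF O])
qed

text \<open>
  The two-point inequality forces a reflection to fix the boundary of its half-spaces, and these
  half-spaces are then the ones that compare the distances to \<open>orig X\<close> and to its image.
\<close>

lemma is_reflection_unique:
  assumes "\<omega> \<in> valid" and \<sigma>: "is_reflection X \<sigma>" and z: "\<sigma> (orig X) = mirror \<omega> (orig X)"
  shows "\<sigma> = restrict (mirror \<omega>) (pts X)"
proof -
  have O: "\<omega> \<in> Omega" using assms(1) by (rule valid_Omega)
  have neg: "height \<omega> (orig X) < 0" using assms(1) by (rule height_orig_neg)
  note parts = \<sigma>[unfolded is_reflection_def]
  have \<sigma>pts: "\<sigma> x \<in> pts X" if "x \<in> pts X" for x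
    using parts[THEN conjunct2, THEN conjunct1] that by (rule bij_betwE[THEN bspec])
  have iso: "dst X (\<sigma> x) (\<sigma> y) = dst X x y" if "x \<in> pts X" "y \<in> pts X" for x y
    using parts[THEN conjunct2, THEN conjunct2, THEN conjunct1] that by blast
  have giso: "gauge (\<sigma> x) (\<sigma> y) = gauge x y" if "x \<in> pts X" "y \<in> pts X" for x y
    using iso[OF that] that \<sigma>pts by (simp add: dst_eq_gauge)
  have inv: "\<sigma> (\<sigma> x) = x" if "x \<in> pts X" for x
    using parts[THEN conjunct2, THEN conjunct2, THEN conjunct2, THEN conjunct1] that by blast
  obtain p0 q0 where pq0: "p0 \<in> pts X" "q0 \<in> pts X"
    "\<sigma> ` half_space X p0 q0 = half_space X q0 p0"
    "\<sigma> ` half_space X q0 p0 = half_space X p0 q0"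
    "\<forall>H\<in>{half_space X p0 q0, half_space X q0 p0}. \<forall>x\<in>H. \<forall>y\<in>H. dst X x (\<sigma> y) \<ge> dst X x y"
    using parts[THEN conjunct2, THEN conjunct2, THEN conjunct2, THEN conjunct2] by (elim bexE conjE) (rule that)
  \<comment> \<open>The two half-spaces enter the definition symmetrically, so \<open>p\<close> and
    \<open>q\<close> can be named such that the origin lies in the half-space of
    \<open>p\<close>.\<close>
  have "orig X \<in> half_space X p0 q0 \<or> orig X \<in> half_space X q0 p0"
    using orig_pts by (auto simp: half_space_def)
  then obtain p q where pq: "p \<in> pts X" "q \<in> pts X"
    "\<sigma> ` half_space X p q = half_space X q p"
    "\<sigma> ` half_space X q p = half_space X p q"
    "\<And>x y. x \<in> half_space X p q \<Longrightarrow> y \<in> half_space X p q \<Longrightarrow> dst X x (\<sigma> y) \<ge> dst X x y"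
    "\<And>x y. x \<in> half_space X q p \<Longrightarrow> y \<in> half_space X q p \<Longrightarrow> dst X x (\<sigma> y) \<ge> dst X x y"
    "orig X \<in> half_space X p q"
    using pq0 by blast
  let ?H = "half_space X p q" and ?H' = "half_space X q p"
  define L where "L x = gauge x p - gauge x q" for x
  have H: "?H = {x \<in> pts X. L x \<le> 0}" "?H' = {x \<in> pts X. L x \<ge> 0}"
    using pq(1,2) by (auto simp: half_space_def L_def dst_le_gauge)
  have contL: "continuous_on UNIV L"
  proof -
    have "continuous_on UNIV (\<lambda>x. gauge x y)" for y
      using continuous_on_compose2[OF continuous_gauge, of UNIV "\<lambda>x. (x, y)"]
      by (simp add: continuous_on_Pair continuous_on_const continuous_on_id)
    then show ?thesis unfolding L_def[abs_def] by (intro continuous_intros)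
  qed
  have fix_wall: "\<sigma> x = x" if "x \<in> ?H" "x \<in> ?H'" for x
  proof -
    have x: "x \<in> pts X" using that by (simp add: H)
    have "\<sigma> x \<in> ?H" using that pq(4) by blast
    then have "dst X (\<sigma> x) x \<le> dst X (\<sigma> x) (\<sigma> x)" using that pq(5) by blast
    then have "gauge (\<sigma> x) x \<le> gauge (\<sigma> x) (\<sigma> x)" using x \<sigma>pts by (simp add: dst_le_gauge)
    then have "gauge (\<sigma> x) x = 0"
      using gauge_ge_0[OF \<sigma>pts[OF x] x] gauge_eq_0[OF \<sigma>pts[OF x] \<sigma>pts[OF x]] by simp
    then show ?thesis using gauge_eq_0[OF \<sigma>pts[OF x] x] by simp
  qed
  have neg_if: "height \<omega> x \<le> 0" if "x \<in> ?H" for x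
  proof -
    have x: "x \<in> pts X" using that by (simp add: H)
    have "dst X x (orig X) \<le> dst X x (\<sigma> (orig X))" using that pq by blast
    then have "x \<in> half_space X (orig X) (mirror \<omega> (orig X))" using x z by (simp add: half_space_def)
    then show ?thesis using half_space_orig[OF assms(1)] by simp
  qed
  have pos_if: "height \<omega> x \<ge> 0" if "x \<in> ?H'" for x
  proof -
    have x: "x \<in> pts X" using that by (simp add: H)
    have "\<sigma> x \<in> ?H" using that pq(4) by blast
    then have "dst X (\<sigma> x) (orig X) \<le> dst X (\<sigma> x) (\<sigma> (orig X))" using pq by blast
    moreover have "dst X (\<sigma> x) (orig X) = dst X x (\<sigma> (orig X))"
      using iso[OF x \<sigma>pts[OF orig_pts]] inv[OF orig_pts] by simp
    ultimately have "x \<in> half_space X (mirror \<omega> (orig X)) (orig X)"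
      using x z iso[OF x orig_pts] by (simp add: half_space_def)
    then show ?thesis using half_space_orig[OF assms(1)] by simp
  qed
  \<comment> \<open>\<open>neg_if\<close> and \<open>pos_if\<close> are inclusions between closed
    half-spaces; by contraposition a strict sign of the height forces the same strict sign of
    \<open>L\<close>. The wall needs a limit argument.\<close>
  have Lneg: "L x < 0" if "x \<in> pts X" "height \<omega> x < 0" for x
    using pos_if[of x] that by (force simp: H)
  have Lpos: "L x > 0" if "x \<in> pts X" "height \<omega> x > 0" for x
    using neg_if[of x] that by (force simp: H)
  \<comment> \<open>A wall point is a limit of points of negative height and, after applying the
    mirror, of points of positive height; continuity of \<open>L\<close> then gives both
    inequalities.\<close>
  have L0: "L x = 0" if x: "x \<in> pts X" "height \<omega> x = 0" for x
  proof -
    let ?S = "{y \<in> pts X. height \<omega> y < 0}"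
    have cl: "x \<in> closure ?S"
      using wall_closure[of \<omega> x] assms(1) that by (simp add: valid_def height_def)
    have "L ` closure ?S \<subseteq> {..0}"
      by (rule image_closure_subset) (use contL Lneg in \<open>auto intro: continuous_on_subset less_imp_le\<close>)
    then have le: "L x \<le> 0" using cl by auto
    have "continuous_on UNIV (\<lambda>x. L (mirror \<omega> x))"
      by (rule continuous_on_compose2[OF contL continuous_mirror_right]) auto
    then have "(\<lambda>x. L (mirror \<omega> x)) ` closure ?S \<subseteq> {0..}"
      by (intro image_closure_subset)
        (use Lpos in \<open>auto intro: continuous_on_subset less_imp_le simp: mirror_in_pts[OF O] height_mirror[OF O]\<close>)
    then have "0 \<le> L x" using cl mirror_wall[OF that(2)] by force
    with le show ?thesis by simp
  qed
  have fix0: "\<sigma> x = x" if "x \<in> pts X" "height \<omega> x = 0" for x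
    using L0[OF that] that(1) by (intro fix_wall) (auto simp: H)
  have neg_case: "\<sigma> x = mirror \<omega> x" if x: "x \<in> pts X" "height \<omega> x < 0" for x
  proof -
    have sx: "\<sigma> x \<in> pts X" using x \<sigma>pts by simp
    have xH: "x \<in> ?H" "x \<notin> ?H'" using Lneg[OF x] x by (auto simp: H)
    have "\<sigma> x \<notin> ?H"
    proof
      assume "\<sigma> x \<in> ?H"
      then have "\<sigma> (\<sigma> x) \<in> ?H'" using pq(3) by blast
      with xH x show False by (simp add: inv)
    qed
    then have "L (\<sigma> x) > 0" using sx by (auto simp: H)
    then have "height \<omega> (\<sigma> x) > 0"
      using pos_if[of "\<sigma> x"] L0[of "\<sigma> x"] sx by (cases "height \<omega> (\<sigma> x) = 0") (auto simp: H)
    then have hneg: "height \<omega> (mirror \<omega> (\<sigma> x)) < 0" by (simp add: height_mirror[OF O])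
    \<comment> \<open>Both points lie on the negative side, and since \<open>\<sigma>\<close> and
      the mirror fix the wall, they have the same gauge to each wall point.\<close>
    have "x = mirror \<omega> (\<sigma> x)"
    proof (rule wall_separates[of \<omega>])
      fix b' assume b': "b' \<in> pts X" "b b' (N \<omega>) = c \<omega>"
      then have hb: "height \<omega> b' = 0" by (simp add: height_def)
      have "gauge b' (mirror \<omega> (\<sigma> x)) = gauge (\<sigma> b') (\<sigma> x)"
        by (simp add: gauge_mirror_right[OF O] hb fix0[OF b'(1) hb])
      also have "\<dots> = gauge b' x" using giso b' x by simp
      finally show "b (b' - x) (b' - x) = b (b' - mirror \<omega> (\<sigma> x)) (b' - mirror \<omega> (\<sigma> x))"
        by (simp add: gauge_def)
    qed (use x sx hneg assms(1) mirror_in_pts[OF O sx] in \<open>auto simp: valid_def height_def\<close>)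
    then show ?thesis using mirror_mirror[OF O] by metis
  qed
  have "\<sigma> x = mirror \<omega> x" if x: "x \<in> pts X" for x
  proof (cases "height \<omega> x" "0::real" rule: linorder_cases)
    case less then show ?thesis using neg_case x by blast
  next
    case equal then show ?thesis using fix0[OF x] mirror_wall by simp
  next
    case greater
    then have "\<sigma> (mirror \<omega> x) = x"
      using neg_case[of "mirror \<omega> x"] x by (simp add: mirror_in_pts[OF O] height_mirror[OF O] mirror_mirror[OF O])
    then show ?thesis using inv[of "mirror \<omega> x"] x by (metis O mirror_in_pts)
  qed
  moreover have "\<sigma> \<in> extensional (pts X)" using \<sigma> by (simp add: is_reflection_def)
  ultimately show ?thesis by (auto simp: fun_eq_iff extensional_def restrict_def)
qed

lemma reflection_eq:
  assumes "\<omega> \<in> valid"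
  shows "reflection X \<omega> = restrict (mirror \<omega>) (pts X)"
  unfolding reflection_def
proof (rule the_equality)
  show "is_reflection X (restrict (mirror \<omega>) (pts X)) \<and>
      restrict (mirror \<omega>) (pts X) (orig X) = polar X (fst \<omega>) (snd \<omega>)"
    using is_reflection_mirror[OF assms] mirror_orig_polar[OF assms] orig_pts by simp
next
  fix \<sigma> assume "is_reflection X \<sigma> \<and> \<sigma> (orig X) = polar X (fst \<omega>) (snd \<omega>)"
  then show "\<sigma> = restrict (mirror \<omega>) (pts X)"
    using is_reflection_unique[OF assms, of \<sigma>] mirror_orig_polar[OF assms] by simp
qed

lemma polarization_eq:
  assumes "\<omega> \<in> valid" "x \<in> pts X"
  shows "polarization X \<omega> f x = two_point \<omega> f x"
proof -
  have O: "\<omega> \<in> Omega" using assms(1) by (rule valid_Omega)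
  have "dst X x (orig X) \<le> dst X (mirror \<omega> x) (orig X) \<longleftrightarrow> height \<omega> x \<le> 0"
    using assms(2) height_orig_neg[OF assms(1)] orig_pts
    by (simp add: dst_le_gauge mirror_in_pts[OF O] gauge_mirror_left[OF O] zero_le_mult_iff)
  then show ?thesis using assms by (simp add: polarization_def two_point_def reflection_eq)
qed

section \<open>Polarization of continuous functions\<close>

definition gball :: "real \<Rightarrow> 'p set" where
  "gball R = {x \<in> pts X. gauge x (orig X) \<le> R}"

text \<open>Measurability and vanishing are required on the whole ambient space because
  \<open>m\<close> is a measure there. The fixed \<open>R\<close> lets all iterates share one
  compact support.\<close>

definition test :: "real \<Rightarrow> ('p \<Rightarrow> real) \<Rightarrow> bool" where
  "test R f \<longleftrightarrow> f \<in> borel_measurable borel \<and> continuous_on (pts X) f \<and>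
     (\<forall>x. 0 \<le> f x) \<and> (\<forall>x. x \<notin> gball R \<longrightarrow> f x = 0)"

text \<open>Stated with the gauge because mirrors preserve it exactly; hyperbolic reflections are
  not isometries of the ambient norm.\<close>

definition gauge_modulus :: "real \<Rightarrow> real \<Rightarrow> ('p \<Rightarrow> real) \<Rightarrow> bool" where
  "gauge_modulus \<delta> \<eta> f \<longleftrightarrow> (\<forall>x\<in>pts X. \<forall>y\<in>pts X. gauge x y < \<delta> \<longrightarrow> \<bar>f x - f y\<bar> \<le> \<eta>)"

lemma testD:
  assumes "test R f"
  shows "f \<in> borel_measurable borel" "continuous_on (pts X) f" "0 \<le> f x" "x \<notin> gball R \<Longrightarrow> f x = 0"
  using assms by (auto simp: test_def)

lemma pts_borel[measurable]: "pts X \<in> sets borel"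
  using closed_pts by (rule borel_closed)

lemma continuous_gauge_left: "continuous_on S (\<lambda>x. gauge x y)"
  using continuous_on_compose2[OF continuous_gauge, of S "\<lambda>x. (x, y)"]
  by (simp add: continuous_on_Pair continuous_on_const continuous_on_id)

lemma closed_gball: "closed (gball R)"
proof -
  have "gball R = pts X \<inter> {x. gauge x (orig X) \<le> R}" by (auto simp: gball_def)
  then show ?thesis
    using closed_pts closed_Collect_le[OF continuous_gauge_left[of UNIV] continuous_on_const] by auto
qed

lemma compact_gball: "compact (gball R)"
  using closed_gball bounded_gauge[of R] by (simp add: compact_eq_bounded_closed gball_def gauge_def)

lemma gball_borel[measurable]: "gball R \<in> sets borel"
  using closed_gball by (rule borel_closed)

lemma emeasure_gball: "emeasure m (gball R) < \<infinity>"
  using m_fin[of R] by (simp add: gball_def gauge_def)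

lemma gball_pts: "gball R \<subseteq> pts X"
  by (auto simp: gball_def)

lemma test_bounded:
  assumes "test R f"
  obtains M where "0 \<le> M" "\<And>x. f x \<le> M"
proof -
  have "compact (f ` gball R)"
    by (rule compact_continuous_image)
      (use testD(2)[OF assms] gball_pts compact_gball in \<open>auto intro: continuous_on_subset\<close>)
  then obtain M where M: "\<And>y. y \<in> f ` gball R \<Longrightarrow> norm y \<le> M"
    using compact_imp_bounded bounded_iff by metis
  show ?thesis
  proof (rule that[of "max 0 M"])
    fix x show "f x \<le> max 0 M"
      using M[of "f x"] testD(4)[OF assms, of x] by (cases "x \<in> gball R") auto
  qed simp
qed

lemma two_point_contract:
  assumes "\<omega> \<in> Omega" "\<And>x. x \<in> pts X \<Longrightarrow> \<bar>f x - g x\<bar> \<le> \<epsilon>" "x \<in> pts X"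
  shows "\<bar>two_point \<omega> f x - two_point \<omega> g x\<bar> \<le> \<epsilon>"
  using assms(2)[of x] assms(2)[of "mirror \<omega> x"] assms(3) mirror_in_pts[OF assms(1,3)]
  by (auto simp: two_point_def)

lemma two_point_cong:
  assumes "\<omega> \<in> Omega" "\<And>x. x \<in> pts X \<Longrightarrow> f x = g x" "x \<in> pts X"
  shows "two_point \<omega> f x = two_point \<omega> g x"
  using two_point_contract[of \<omega> f g 0 x] assms by simp

text \<open>For points on the same side, values at the two points and values at their mirror images
  are compared with each other. For points on opposite sides, replacing one of them by its mirror
  image decreases the gauge, so all four cross differences are at most
  \<open>\<eta>\<close>.\<close>

lemma gauge_modulus_two_point:
  assumes O: "\<omega> \<in> Omega" and f: "gauge_modulus \<delta> \<eta> f"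
  shows "gauge_modulus \<delta> \<eta> (two_point \<omega> f)"
proof -
  have main: "\<bar>two_point \<omega> f x - two_point \<omega> f y\<bar> \<le> \<eta>"
    if xy: "x \<in> pts X" "y \<in> pts X" "gauge x y < \<delta>" and h: "height \<omega> x \<le> height \<omega> y" for x y
  proof -
    note pt = xy(1,2) mirror_in_pts[OF O xy(1)] mirror_in_pts[OF O xy(2)]
    have f': "\<bar>f u - f v\<bar> \<le> \<eta>" if "u \<in> pts X" "v \<in> pts X" "gauge u v < \<delta>" for u v
      using f that by (auto simp: gauge_modulus_def)
    have 1: "\<bar>f x - f y\<bar> \<le> \<eta>" "\<bar>f (mirror \<omega> x) - f (mirror \<omega> y)\<bar> \<le> \<eta>"
      using pt xy by (auto intro!: f' simp: gauge_mirror[OF O])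
    have 2: "\<bar>f x - f (mirror \<omega> y)\<bar> \<le> \<eta>" "\<bar>f (mirror \<omega> x) - f y\<bar> \<le> \<eta>"
      if "height \<omega> x \<le> 0" "0 < height \<omega> y"
    proof -
      have "height \<omega> x * height \<omega> y \<le> 0" using that by (simp add: mult_nonpos_nonneg)
      then have "gauge x y + 4 * height \<omega> x * height \<omega> y < \<delta>" using xy(3) by linarith
      then show "\<bar>f x - f (mirror \<omega> y)\<bar> \<le> \<eta>" "\<bar>f (mirror \<omega> x) - f y\<bar> \<le> \<eta>"
        using pt by (auto intro!: f' simp: gauge_mirror_left[OF O] gauge_mirror_right[OF O])
    qed
    show ?thesis
    proof (cases "height \<omega> x \<le> 0 \<and> 0 < height \<omega> y")
      case True
      with 1 2 show ?thesis by (auto simp: two_point_def max_def min_def)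
    next
      case False
      with h have "(height \<omega> x \<le> 0) = (height \<omega> y \<le> 0)" by auto
      with 1 show ?thesis by (auto simp: two_point_def)
    qed
  qed
  show ?thesis
    unfolding gauge_modulus_def
  proof (intro ballI impI)
    fix x y assume "x \<in> pts X" "y \<in> pts X" "gauge x y < \<delta>"
    then show "\<bar>two_point \<omega> f x - two_point \<omega> f y\<bar> \<le> \<eta>"
      using main[of x y] main[of y x] by (cases "height \<omega> x \<le> height \<omega> y") (auto simp: gauge_commute abs_minus_commute)
  qed
qed

text \<open>The gauge is at most \<open>B\<close> times the squared ambient distance, so a modulus
  in the gauge gives the ordinary equicontinuity that Arzela-Ascoli asks for.\<close>

lemma gauge_modulus_dist:
  assumes "0 < \<delta>" "gauge_modulus \<delta> \<eta> f" "0 < B" "\<And>x y. norm (b x y) \<le> norm x * norm y * B"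
    and xy: "x \<in> pts X" "y \<in> pts X" "dist x y < sqrt (\<delta> / B)"
  shows "\<bar>f x - f y\<bar> \<le> \<eta>"
proof -
  have "gauge x y \<le> norm (x - y) * norm (x - y) * B"
    using assms(4)[of "x - y" "x - y"] by (simp add: gauge_def)
  also have "(norm (x - y))\<^sup>2 < (sqrt (\<delta> / B))\<^sup>2"
    using xy by (intro power_strict_mono) (auto simp: dist_norm)
  then have "norm (x - y) * norm (x - y) * B < \<delta>"
    using assms(1,3) by (simp add: power2_eq_square field_simps)
  finally show ?thesis using assms(2) xy by (auto simp: gauge_modulus_def)
qed

text \<open>The pairs on which \<open>f\<close> differs by at least \<open>\<eta>\<close> form a
  compact set \<open>K\<close> off the diagonal, where the gauge has a positive minimum. By
  \<open>gauge_coercive\<close>, pairs of gauge below 1 that meet the support stay in one compact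
  set.\<close>

lemma test_modulus:
  assumes f: "test R f" and \<eta>: "0 < \<eta>"
  obtains \<delta> where "0 < \<delta>" "gauge_modulus \<delta> \<eta> f"
proof -
  obtain R' where R': "\<And>x y. x \<in> gball R \<Longrightarrow> y \<in> pts X \<Longrightarrow> gauge x y \<le> 1 \<Longrightarrow> y \<in> gball R'"
    using gauge_coercive[of R] by (auto simp: gball_def gauge_def)
  define C where "C = gball (max R R')"
  have C: "compact C" "C \<subseteq> pts X" using compact_gball gball_pts by (auto simp: C_def)
  have contf: "continuous_on C f" using testD(2)[OF f] C(2) by (rule continuous_on_subset)
  define K where "K = {p \<in> C \<times> C. \<eta> \<le> \<bar>f (fst p) - f (snd p)\<bar>}"
  have "closed K"
  proof -
    have c: "continuous_on (C \<times> C) (\<lambda>p. \<bar>f (fst p) - f (snd p)\<bar>)"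
      by (intro continuous_intros continuous_on_compose2[OF contf]) auto
    have "closed (C \<times> C)" using C(1) by (simp add: closed_Times compact_imp_closed)
    from continuous_closed_preimage[OF c this, of "{\<eta>..}"]
    show ?thesis by (auto simp: K_def vimage_def Int_def)
  qed
  moreover have "K = K \<inter> (C \<times> C)" by (auto simp: K_def)
  ultimately have K: "compact K"
    using closed_Int_compact[OF _ compact_Times[OF C(1) C(1)], of K] by simp
  have outside: "\<bar>f x - f y\<bar> \<le> \<eta>"
    if xy: "x \<in> pts X" "y \<in> pts X" "gauge x y < 1" "(x, y) \<notin> K" for x y
  proof (cases "x \<in> gball R \<or> y \<in> gball R")
    case True
    then have "x \<in> C \<and> y \<in> C"
      using R'[of x y] R'[of y x] xy by (auto simp: C_def gball_def gauge_commute)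
    then show ?thesis using xy by (auto simp: K_def)
  next
    case False
    then show ?thesis using testD(4)[OF f] \<eta> by simp
  qed
  show ?thesis
  proof (cases "K = {}")
    case True
    show ?thesis by (rule that[of 1]) (use outside True in \<open>auto simp: gauge_modulus_def\<close>)
  next
    case False
    obtain p where p: "p \<in> K" "\<And>q. q \<in> K \<Longrightarrow> (case p of (x, y) \<Rightarrow> gauge x y) \<le> (case q of (x, y) \<Rightarrow> gauge x y)"
      using continuous_attains_inf[OF K False continuous_on_subset[OF continuous_gauge]] by blast
    define \<delta> where "\<delta> = gauge (fst p) (snd p)"
    have "fst p \<in> pts X" "snd p \<in> pts X" "fst p \<noteq> snd p"
      using p(1) C(2) \<eta> by (auto simp: K_def)
    then have \<delta>: "0 < \<delta>" using gauge_ge_0[of "fst p" "snd p"] gauge_eq_0[of "fst p" "snd p"]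
      by (auto simp: \<delta>_def less_le)
    show ?thesis
    proof (rule that[of "min 1 \<delta>"])
      show "gauge_modulus (min 1 \<delta>) \<eta> f"
        unfolding gauge_modulus_def
      proof (intro ballI impI)
        fix x y assume xy: "x \<in> pts X" "y \<in> pts X" "gauge x y < min 1 \<delta>"
        then have "(x, y) \<notin> K" using p(2)[of "(x, y)"] by (auto simp: \<delta>_def split_def not_less)
        then show "\<bar>f x - f y\<bar> \<le> \<eta>" using outside xy by simp
      qed
    qed (use \<delta> in simp)
  qed
qed

section \<open>Measurability and continuity in the parameter\<close>

lemma measurable_height: "(\<lambda>(\<omega>, x). height \<omega> x) \<in> borel_measurable (borel \<Otimes>\<^sub>M borel)"
  using borel_measurable_continuous_onI[OF continuous_height] by (simp add: borel_prod)

lemma measurable_mirror: "(\<lambda>(\<omega>, x). mirror \<omega> x) \<in> borel_measurable (borel \<Otimes>\<^sub>M borel)"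
  using borel_measurable_continuous_onI[OF continuous_mirror] by (simp add: borel_prod)

text \<open>Function and parameter both depend on \<open>w\<close>, so that the lemma can be
  iterated along a random sequence.\<close>

lemma measurable_two_point_Pair:
  assumes f[measurable]: "(\<lambda>(w, x). f w x) \<in> borel_measurable (S \<Otimes>\<^sub>M borel)"
    and \<omega>[measurable]: "\<omega> \<in> borel_measurable S"
  shows "(\<lambda>(w, x). two_point (\<omega> w) (f w) x) \<in> borel_measurable (S \<Otimes>\<^sub>M borel)"
proof -
  have [measurable]: "(\<lambda>p. height (\<omega> (fst p)) (snd p)) \<in> borel_measurable (S \<Otimes>\<^sub>M borel)"
    using measurable_compose[OF _ measurable_height, of "\<lambda>p. (\<omega> (fst p), snd p)" "S \<Otimes>\<^sub>M borel"] by simp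
  have [measurable]: "(\<lambda>p. mirror (\<omega> (fst p)) (snd p)) \<in> borel_measurable (S \<Otimes>\<^sub>M borel)"
    using measurable_compose[OF _ measurable_mirror, of "\<lambda>p. (\<omega> (fst p), snd p)" "S \<Otimes>\<^sub>M borel"] by simp
  have [measurable]: "(\<lambda>p. f (fst p) (mirror (\<omega> (fst p)) (snd p))) \<in> borel_measurable (S \<Otimes>\<^sub>M borel)"
    using measurable_compose[OF _ f, of "\<lambda>p. (fst p, mirror (\<omega> (fst p)) (snd p))" "S \<Otimes>\<^sub>M borel"] by simp
  show ?thesis unfolding two_point_def split_def by measurable
qed

lemma height_borel[measurable]: "height \<omega> \<in> borel_measurable borel"
  by (rule borel_measurable_continuous_onI[OF continuous_height_right])

lemma mirror_borel[measurable]: "mirror \<omega> \<in> borel_measurable borel"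
  by (rule borel_measurable_continuous_onI[OF continuous_mirror_right])

lemma gauge_borel[measurable]: "(\<lambda>x. gauge x y) \<in> borel_measurable borel"
  by (rule borel_measurable_continuous_onI[OF continuous_gauge_left])

lemma two_point_borel[measurable]:
  assumes [measurable]: "f \<in> borel_measurable borel"
  shows "two_point \<omega> f \<in> borel_measurable borel"
  unfolding two_point_def[abs_def] by measurable

lemma continuous_two_point:
  assumes f: "continuous_on (pts X) f" and O: "\<omega> \<in> Omega"
  shows "continuous_on (pts X) (two_point \<omega> f)"
proof -
  have c: "continuous_on (pts X) (\<lambda>x. f (mirror \<omega> x))"
    by (rule continuous_on_compose2[OF f continuous_mirror_right]) (auto simp: mirror_in_pts[OF O])
  show ?thesis
    unfolding two_point_def[abs_def]
    by (rule continuous_on_cases_le)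
      (use f c in \<open>auto intro!: continuous_intros continuous_height_right simp: mirror_wall elim: continuous_on_subset\<close>)
qed

text \<open>This holds on all of \<open>Omega\<close>, also at r = 0: the two branches meet where
  the height vanishes, and there \<open>x\<close> is its own mirror image.\<close>

lemma continuous_two_point_left:
  assumes f: "continuous_on (pts X) f" and x: "x \<in> pts X"
  shows "continuous_on Omega (\<lambda>\<omega>. two_point \<omega> f x)"
proof -
  have m: "continuous_on Omega (\<lambda>\<omega>. mirror \<omega> x)" and h: "continuous_on Omega (\<lambda>\<omega>. height \<omega> x)"
    using continuous_on_compose2[OF continuous_mirror, of Omega "\<lambda>\<omega>. (\<omega>, x)"]
      continuous_on_compose2[OF continuous_height, of Omega "\<lambda>\<omega>. (\<omega>, x)"]
    by (simp_all add: continuous_on_Pair continuous_on_const continuous_on_id)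
  have c: "continuous_on Omega (\<lambda>\<omega>. f (mirror \<omega> x))"
    by (rule continuous_on_compose2[OF f m]) (auto simp: mirror_in_pts x)
  show ?thesis
    unfolding two_point_def
    by (rule continuous_on_cases_le)
      (use h c in \<open>auto intro!: continuous_intros simp: mirror_wall elim: continuous_on_subset\<close>)
qed

text \<open>The support radius is kept: for a point outside the ball on the side of the origin, the
  mirror image is even farther away; on the other side the minimum with \<open>f x = 0\<close>
  vanishes.\<close>

lemma test_two_point:
  assumes \<omega>: "\<omega> \<in> valid" and f: "test R f"
  shows "test R (two_point \<omega> f)"
proof -
  have O: "\<omega> \<in> Omega" using \<omega> by (rule valid_Omega)
  have 0: "two_point \<omega> f x = 0" if x: "x \<notin> gball R" for x
  proof (cases "height \<omega> x \<le> 0")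
    case True
    then have "0 \<le> height \<omega> x * height \<omega> (orig X)"
      using height_orig_neg[OF \<omega>] by (simp add: mult_nonpos_nonpos)
    then have "mirror \<omega> x \<notin> gball R"
      using x by (auto simp: gball_def mirror_in_pts_iff[OF O] gauge_mirror_left[OF O])
    with True x show ?thesis using testD(4)[OF f] by (simp add: two_point_def)
  next
    case False
    with x show ?thesis using testD(3,4)[OF f] by (simp add: two_point_def)
  qed
  have "0 \<le> two_point \<omega> f x" for x
    using testD(3)[OF f, of x] testD(3)[OF f, of "mirror \<omega> x"] by (auto simp: two_point_def le_max_iff_disj)
  with 0 show ?thesis
    unfolding test_def
    using two_point_borel[OF testD(1)[OF f], of \<omega>] continuous_two_point[OF testD(2)[OF f] O] by blast
qed

section \<open>Equimeasurability\<close>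

lemma emeasure_mirror:
  assumes "\<omega> \<in> Omega" and [measurable]: "A \<in> sets borel"
  shows "emeasure m (mirror \<omega> -` A) = emeasure m A"
proof -
  note [measurable_cong] = sets_m
  have "space m = UNIV" using sets_eq_imp_space_eq[OF sets_m] by simp
  moreover have "emeasure m A = emeasure (distr m borel (mirror \<omega>)) A"
    using m_inv[OF assms(1)] by (simp add: mirror_def[abs_def] height_def)
  ultimately show ?thesis by (simp add: emeasure_distr)
qed

text \<open>With \<open>A\<close> the superlevel set of \<open>f\<close> and \<open>B\<close> its
  mirror image, the new superlevel set is the union on H+ and the intersection on H-. What H+ gains
  is the mirror image of what H- loses.\<close>

lemma emeasure_two_point:
  assumes O: "\<omega> \<in> Omega" and [measurable]: "f \<in> borel_measurable borel"
  shows "emeasure m {x \<in> pts X. t < two_point \<omega> f x} = emeasure m {x \<in> pts X. t < f x}"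
proof -
  note [measurable_cong] = sets_m
  define A where "A = {x \<in> pts X. t < f x}"
  define B where "B = mirror \<omega> -` A"
  define P where "P = {x. height \<omega> x \<le> 0}"
  have A[measurable]: "A \<in> sets borel" unfolding A_def by measurable
  have B[measurable]: "B \<in> sets borel" unfolding B_def using measurable_sets[OF mirror_borel A] by simp
  have P[measurable]: "P \<in> sets borel" unfolding P_def by measurable
  have Bx: "x \<in> B \<longleftrightarrow> x \<in> pts X \<and> t < f (mirror \<omega> x)" for x
    by (auto simp: B_def A_def mirror_in_pts_iff[OF O])
  have lhs: "{x \<in> pts X. t < two_point \<omega> f x} = A \<inter> P \<union> (B - A) \<inter> P \<union> A \<inter> B \<inter> - P"
    by (auto simp: Bx A_def P_def two_point_def)
  have sym: "emeasure m ((B - A) \<inter> P) = emeasure m ((A - B) \<inter> - P)"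
  proof -
    have "mirror \<omega> -` ((B - A) \<inter> P) = (A - B) \<inter> - P"
    proof -
      have "mirror \<omega> x \<in> B \<longleftrightarrow> x \<in> A" "mirror \<omega> x \<in> A \<longleftrightarrow> x \<in> B" for x
        by (auto simp: B_def mirror_mirror[OF O])
      moreover have "x \<in> A \<longleftrightarrow> x \<in> B" if "height \<omega> x = 0" for x
        using mirror_wall[OF that] by (simp add: B_def)
      ultimately show ?thesis by (force simp: P_def height_mirror[OF O])
    qed
    then show ?thesis using emeasure_mirror[OF O, of "(B - A) \<inter> P"] by simp
  qed
  have add3: "emeasure m (E \<union> F \<union> H) = emeasure m E + emeasure m F + emeasure m H"
    if "E \<in> sets borel" "F \<in> sets borel" "H \<in> sets borel" "E \<inter> F = {}" "(E \<union> F) \<inter> H = {}" for E F H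
    using that plus_emeasure[of E m F] plus_emeasure[of "E \<union> F" m H] by (simp add: sets_m)
  have "emeasure m {x \<in> pts X. t < two_point \<omega> f x}
      = emeasure m (A \<inter> P) + emeasure m ((B - A) \<inter> P) + emeasure m (A \<inter> B \<inter> - P)"
    unfolding lhs by (rule add3) auto
  also have "\<dots> = emeasure m (A \<inter> P) + emeasure m ((A - B) \<inter> - P) + emeasure m (A \<inter> B \<inter> - P)"
    by (simp only: sym)
  also have "\<dots> = emeasure m (A \<inter> P \<union> (A - B) \<inter> - P \<union> A \<inter> B \<inter> - P)"
    by (rule add3[symmetric]) auto
  also have "A \<inter> P \<union> (A - B) \<inter> - P \<union> A \<inter> B \<inter> - P = A" by auto
  finally show ?thesis by (simp add: A_def)
qed

lemma space_m: "space m = UNIV"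
  using sets_eq_imp_space_eq[OF sets_m] by simp

text \<open>Full support of \<open>m\<close> on \<open>pts X\<close>: it upgrades almost-everywhere
  statements about continuous functions to pointwise ones.\<close>

lemma openin_null_imp_empty:
  assumes V: "openin (top_of_set (pts X)) V" and null: "emeasure m V = 0"
  shows "V = {}"
proof (rule ccontr)
  assume ne: "V \<noteq> {}"
  obtain U where U: "open U" "V = pts X \<inter> U" using V by (auto simp: openin_open)
  have [measurable]: "U \<in> sets borel" using U by simp
  have "emeasure m U \<le> emeasure m (V \<union> - pts X)"
    using U by (intro emeasure_mono) (auto simp: sets_m)
  also have "\<dots> \<le> emeasure m V + emeasure m (- pts X)"
    using U by (intro emeasure_subadditive) (auto simp: sets_m)
  also have "\<dots> = 0" by (simp add: null m_compl)
  finally show False using m_pos[OF U(1)] U(2) ne by auto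
qed

lemma openin_superlevel: "continuous_on (pts X) (g :: _ \<Rightarrow> real) \<Longrightarrow> openin (top_of_set (pts X)) {x \<in> pts X. t < g x}"
  using continuous_openin_preimage_gen[of "pts X" g "{t<..}"] by (simp add: vimage_def Int_def open_greaterThan)

lemma openin_sublevel: "continuous_on (pts X) (g :: _ \<Rightarrow> real) \<Longrightarrow> openin (top_of_set (pts X)) {x \<in> pts X. g x < t}"
  using continuous_openin_preimage_gen[of "pts X" g "{..<t}"] by (simp add: vimage_def Int_def open_lessThan)

lemma openin_pts_borel: "openin (top_of_set (pts X)) V \<Longrightarrow> V \<in> sets borel"
  by (auto simp: openin_open)

lemma continuous_AE_zero:
  assumes d: "continuous_on (pts X) d" and ae: "AE x in m. d x = (0::real)" and x: "x \<in> pts X"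
  shows "d x = 0"
proof -
  let ?V = "{x \<in> pts X. 0 < \<bar>d x\<bar>}"
  have o: "openin (top_of_set (pts X)) ?V"
    by (intro openin_superlevel continuous_intros d)
  have "AE x in m. x \<notin> ?V" using ae by eventually_elim auto
  then have "emeasure m ?V = 0"
    using openin_pts_borel[OF o] by (subst (asm) AE_iff_measurable[OF _ refl]) (auto simp: sets_m space_m)
  from openin_null_imp_empty[OF o this] show ?thesis using x by auto
qed

section \<open>The energy functional\<close>

text \<open>The exponential is positive everywhere and at most 1 on \<open>pts X\<close>, so a
  bounded support and a bounded function suffice for integrability.\<close>

definition weight :: "'p \<Rightarrow> real" where
  "weight x = exp (- gauge x (orig X))"

definition gain :: "real \<times> 'a \<Rightarrow> ('p \<Rightarrow> real) \<Rightarrow> real" where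
  "gain \<omega> f = (\<integral>x. (two_point \<omega> f x - f x) * weight x \<partial>m)"

definition energy :: "('p \<Rightarrow> real) \<Rightarrow> real" where
  "energy f = (\<integral>x. f x * weight x \<partial>m)"

lemma weight_borel[measurable]: "weight \<in> borel_measurable borel"
  unfolding weight_def[abs_def] by measurable

lemma weight_le_1: "x \<in> pts X \<Longrightarrow> weight x \<le> 1" and weight_pos: "0 < weight x"
  using gauge_ge_0[OF _ orig_pts] by (auto simp: weight_def)

lemma integrable_weight:
  assumes [measurable]: "f \<in> borel_measurable borel" and "\<And>x. \<bar>f x\<bar> \<le> M" "\<And>x. x \<notin> gball R \<Longrightarrow> f x = 0"
  shows "integrable m (\<lambda>x. f x * weight x)"
proof (rule integrableI_bounded_set[of "gball R" _ _ M])
  note [measurable_cong] = sets_m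
  show "(\<lambda>x. f x * weight x) \<in> borel_measurable m" by measurable
  show "AE x\<in>gball R in m. norm (f x * weight x) \<le> M"
  proof (intro AE_I2 impI)
    fix x assume "x \<in> gball R"
    then have "x \<in> pts X" using gball_pts by auto
    then have "\<bar>f x\<bar> * weight x \<le> M * 1"
      using assms(2)[of x] weight_le_1[of x] weight_pos[of x] by (intro mult_mono) auto
    then show "norm (f x * weight x) \<le> M" using weight_pos[of x] by (simp add: abs_mult)
  qed
qed (use assms emeasure_gball in \<open>auto simp: sets_m\<close>)

lemma integrable_test:
  assumes f: "test R f"
  shows "integrable m (\<lambda>x. f x * weight x)"
proof -
  obtain M where M: "0 \<le> M" "\<And>x. f x \<le> M" using test_bounded[OF f] by blast
  show ?thesis
    by (rule integrable_weight[of _ M R]) (use f M testD[OF f] in auto)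
qed

lemma integrable_gain:
  assumes "\<omega> \<in> valid" "test R f"
  shows "integrable m (\<lambda>x. (two_point \<omega> f x - f x) * weight x)"
  using integrable_test[OF assms(2)] integrable_test[OF test_two_point[OF assms]]
  by (simp add: left_diff_distrib)

lemma gain_energy: "\<omega> \<in> valid \<Longrightarrow> test R f \<Longrightarrow> gain \<omega> f = energy (two_point \<omega> f) - energy f"
  unfolding gain_def energy_def
  using integrable_test integrable_test[OF test_two_point] by (simp add: left_diff_distrib)

text \<open>A polarization either exchanges the values at \<open>x\<close> and its mirror image or
  keeps both, so their sum is preserved.\<close>

lemma two_point_diff_mirror:
  assumes "\<omega> \<in> Omega"
  shows "two_point \<omega> f (mirror \<omega> x) - f (mirror \<omega> x) = - (two_point \<omega> f x - f x)"
  using mirror_wall[of \<omega> x]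
  by (cases "height \<omega> x" "0::real" rule: linorder_cases)
    (auto simp: two_point_def height_mirror[OF assms] mirror_mirror[OF assms] max_def min_def)

text \<open>
  Pairing \<open>x\<close> with its mirror image turns the gain into the integral of a nonnegative function.
\<close>

lemma gain_symmetrized:
  assumes \<omega>: "\<omega> \<in> valid" and f: "test R f"
  shows "integrable m (\<lambda>x. (two_point \<omega> f x - f x) * (weight x - weight (mirror \<omega> x)))" (is ?int)
    and "2 * gain \<omega> f = (\<integral>x. (two_point \<omega> f x - f x) * (weight x - weight (mirror \<omega> x)) \<partial>m)" (is ?eq)
proof -
  note [measurable_cong] = sets_m
  have O: "\<omega> \<in> Omega" using \<omega> by (rule valid_Omega)
  have [measurable]: "f \<in> borel_measurable borel" using f by (rule testD)
  let ?d = "\<lambda>x. two_point \<omega> f x - f x"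
  have inv: "distr m borel (mirror \<omega>) = m"
    using m_inv[OF O] by (simp add: mirror_def[abs_def] height_def)
  have i: "integrable m (\<lambda>x. ?d x * weight x)" using \<omega> f by (rule integrable_gain)
  then have "integrable (distr m borel (mirror \<omega>)) (\<lambda>x. ?d x * weight x)" by (simp only: inv)
  then have "integrable m (\<lambda>x. ?d (mirror \<omega> x) * weight (mirror \<omega> x))"
    by (subst (asm) integrable_distr_eq) (auto simp: sets_m)
  then have i': "integrable m (\<lambda>x. - (?d x * weight (mirror \<omega> x)))"
    by (simp only: two_point_diff_mirror[OF O] mult_minus_left)
  have "gain \<omega> f = (\<integral>x. ?d x * weight x \<partial>distr m borel (mirror \<omega>))"
    by (simp only: inv gain_def)
  also have "\<dots> = (\<integral>x. ?d (mirror \<omega> x) * weight (mirror \<omega> x) \<partial>m)"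
    by (subst integral_distr) (auto simp: sets_m)
  also have "\<dots> = (\<integral>x. - (?d x * weight (mirror \<omega> x)) \<partial>m)"
    by (simp only: two_point_diff_mirror[OF O] mult_minus_left)
  finally have g: "gain \<omega> f = (\<integral>x. - (?d x * weight (mirror \<omega> x)) \<partial>m)" .
  have eq: "(\<lambda>x. ?d x * (weight x - weight (mirror \<omega> x))) = (\<lambda>x. ?d x * weight x + - (?d x * weight (mirror \<omega> x)))"
    by (auto simp: right_diff_distrib)
  show ?int unfolding eq using i i' by (rule Bochner_Integration.integrable_add)
  show ?eq unfolding eq
    by (subst Bochner_Integration.integral_add[OF i i']) (simp only: g[symmetric] gain_def[symmetric] mult_2)
qed

lemma weight_mirror_less:
  assumes \<omega>: "\<omega> \<in> valid"
  shows "height \<omega> x < 0 \<Longrightarrow> weight (mirror \<omega> x) < weight x"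
    and "0 < height \<omega> x \<Longrightarrow> weight x < weight (mirror \<omega> x)"
  using height_orig_neg[OF \<omega>]
  by (auto simp: weight_def gauge_mirror_left[OF valid_Omega[OF \<omega>]] mult_neg_neg mult_pos_neg)

text \<open>On H+ the value can only rise and the weight exceeds that of the mirror image; on H-
  both signs are reversed.\<close>

lemma gain_integrand_nonneg:
  assumes \<omega>: "\<omega> \<in> valid"
  shows "0 \<le> (two_point \<omega> f x - f x) * (weight x - weight (mirror \<omega> x))"
  using weight_mirror_less[OF \<omega>, of x] mirror_wall[of \<omega> x]
  by (cases "height \<omega> x" "0::real" rule: linorder_cases)
    (auto simp: two_point_def intro!: mult_nonneg_nonneg mult_nonpos_nonpos)

lemma gain_nonneg: "\<omega> \<in> valid \<Longrightarrow> test R f \<Longrightarrow> 0 \<le> gain \<omega> f"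
proof -
  assume "\<omega> \<in> valid" "test R f"
  then have "0 \<le> 2 * gain \<omega> f"
    unfolding gain_symmetrized(2)[OF \<open>\<omega> \<in> valid\<close> \<open>test R f\<close>]
    by (intro integral_nonneg_AE AE_I2 gain_integrand_nonneg)
  then show ?thesis by simp
qed

text \<open>A nonnegative integrand with zero integral vanishes almost everywhere. Its weight factor
  is zero only on the wall, where polarization changes nothing anyway, and continuity removes the
  exceptional set.\<close>

lemma gain_eq_0:
  assumes \<omega>: "\<omega> \<in> valid" and f: "test R f" and 0: "gain \<omega> f = 0" and x: "x \<in> pts X"
  shows "two_point \<omega> f x = f x"
proof -
  have "AE x in m. (two_point \<omega> f x - f x) * (weight x - weight (mirror \<omega> x)) = 0"
    using integral_nonneg_eq_0_iff_AE[OF gain_symmetrized(1)[OF \<omega> f]] gain_integrand_nonneg[OF \<omega>]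
      gain_symmetrized(2)[OF \<omega> f] 0 by simp
  then have "AE x in m. two_point \<omega> f x - f x = 0"
  proof eventually_elim
    case (elim x)
    then show ?case
      using weight_mirror_less[OF \<omega>, of x] mirror_wall[of \<omega> x]
      by (cases "height \<omega> x" "0::real" rule: linorder_cases) (auto simp: two_point_def)
  qed
  from continuous_AE_zero[OF _ this x] show ?thesis
    using continuous_two_point[OF testD(2)[OF f] valid_Omega[OF \<omega>]] testD(2)[OF f]
    by (auto intro: continuous_intros)
qed

lemma energy_diff:
  assumes f: "test R f" and g: "test R g" and fg: "\<And>x. x \<in> pts X \<Longrightarrow> \<bar>f x - g x\<bar> \<le> \<epsilon>"
  shows "\<bar>energy f - energy g\<bar> \<le> \<epsilon> * measure m (gball R)"
proof -
  note [measurable_cong] = sets_m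
  have e: "energy f - energy g = (\<integral>x. f x * weight x - g x * weight x \<partial>m)"
    unfolding energy_def using integrable_test[OF f] integrable_test[OF g] by simp
  have "norm (\<integral>x. f x * weight x - g x * weight x \<partial>m) \<le> (\<integral>x. \<epsilon> * indicator (gball R) x \<partial>m)"
  proof (rule Bochner_Integration.integral_norm_bound_integral)
    show "integrable m (\<lambda>x. f x * weight x - g x * weight x)"
      using integrable_test[OF f] integrable_test[OF g] by simp
    show "integrable m (\<lambda>x. \<epsilon> * indicator (gball R) x)"
      using emeasure_gball by (simp add: sets_m)
    fix x
    show "norm (f x * weight x - g x * weight x) \<le> \<epsilon> * indicator (gball R) x"
    proof (cases "x \<in> gball R")
      case True
      then have x: "x \<in> pts X" using gball_pts by auto
      have "\<bar>f x - g x\<bar> * weight x \<le> \<epsilon> * 1"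
        using fg[OF x] weight_le_1[OF x] weight_pos[of x] by (intro mult_mono) auto
      then show ?thesis using True weight_pos[of x]
        by (simp add: left_diff_distrib[symmetric] abs_mult)
    qed (use testD(4)[OF f] testD(4)[OF g] in simp)
  qed
  also have "\<dots> = \<epsilon> * measure m (gball R)" by (simp add: sets_m space_m)
  finally show ?thesis using e by simp
qed

text \<open>The factor 2 arises because the gain is a difference of two energies; the polarized
  functions are no farther apart than the original ones.\<close>

lemma gain_diff:
  assumes \<omega>: "\<omega> \<in> valid" and f: "test R f" and g: "test R g" and fg: "\<And>x. x \<in> pts X \<Longrightarrow> \<bar>f x - g x\<bar> \<le> \<epsilon>"
  shows "\<bar>gain \<omega> f - gain \<omega> g\<bar> \<le> 2 * \<epsilon> * measure m (gball R)"
proof -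
  have "\<bar>energy (two_point \<omega> f) - energy (two_point \<omega> g)\<bar> \<le> \<epsilon> * measure m (gball R)"
    by (rule energy_diff[OF test_two_point[OF \<omega> f] test_two_point[OF \<omega> g]])
      (rule two_point_contract[OF valid_Omega[OF \<omega>] fg])
  with energy_diff[OF f g fg] show ?thesis
    by (simp add: gain_energy[OF \<omega> f] gain_energy[OF \<omega> g])
qed

lemma energy_bound:
  assumes f: "test R f" and M: "\<And>x. f x \<le> M"
  shows "0 \<le> energy f" "energy f \<le> M * measure m (gball R)"
proof -
  show "0 \<le> energy f" unfolding energy_def
    using testD(3)[OF f] weight_pos by (intro integral_nonneg_AE AE_I2) (simp add: less_imp_le)
  have "test R (\<lambda>x. 0)" by (simp add: test_def)
  from energy_diff[OF f this, of M] M testD(3)[OF f]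
  show "energy f \<le> M * measure m (gball R)" by (simp add: energy_def)
qed

section \<open>Functions fixed by all polarizations in the support\<close>

definition radial_decreasing :: "('p \<Rightarrow> real) \<Rightarrow> bool" where
  "radial_decreasing g \<longleftrightarrow> (\<forall>x\<in>pts X. \<forall>y\<in>pts X. gauge y (orig X) \<le> gauge x (orig X) \<longrightarrow> g x \<le> g y)"

text \<open>Taken inside \<open>Omega\<close> rather than \<open>valid\<close>, so that it is closed
  there and may contain points with r = 0.\<close>

definition fixing :: "('p \<Rightarrow> real) \<Rightarrow> (real \<times> 'a) set" where
  "fixing g = {\<omega> \<in> Omega. \<forall>x\<in>pts X. two_point \<omega> g x = g x}"

lemma norm_folding:
  assumes u: "u \<in> sphere 0 1" and v: "v \<in> sphere 0 1"
  shows "folding u v \<in> sphere 0 1"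
proof -
  have "(norm (v - (2 * (v \<bullet> u)) *\<^sub>R u))\<^sup>2 = 1"
    using u v by (simp add: power2_norm_eq_inner inner_diff inner_commute[of u v] norm_eq_1 algebra_simps)
  then have "norm (v - (2 * (v \<bullet> u)) *\<^sub>R u) = 1"
    by (metis abs_norm_cancel abs_square_eq_1)
  then show ?thesis using v by (simp add: folding_def)
qed

text \<open>At r = 0 a direction with \<open>0 < v \<bullet> u\<close> lies on the H- side, and its
  mirror image is the folded direction at the same radius. Being fixed means that \<open>g\<close>
  equals the minimum of both values.\<close>

lemma fixing_fold:
  assumes u: "(0, u) \<in> fixing g" and r: "r \<in> D" and v: "v \<in> sphere 0 1"
  shows "g (polar X r v) \<le> g (polar X r (folding u v))"
proof (cases "v \<bullet> u \<le> 0")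
  case False
  have us: "u \<in> sphere 0 1" using u by (auto simp: fixing_def Omega_def)
  let ?x = "polar X r v"
  have "two_point (0, u) g ?x = g ?x" using u polar_pts[OF r v] by (auto simp: fixing_def)
  moreover have "0 \<le> height (0, u) ?x" "mirror (0, u) ?x = polar X r (folding u v)"
    using polar_fold[OF r us v] False by (auto simp: height_def mirror_def folding_def)
  ultimately show ?thesis
    \<comment> \<open>Height 0 occurs at the origin and at its antipode on the sphere; there the
      maximum is taken, but of two equal values.\<close>
    using mirror_wall[of "(0, u)" ?x] by (cases "height (0, u) ?x = 0") (auto simp: two_point_def)
qed (simp add: folding_def)

lemma fixing_fold_orbit:
  assumes G: "\<And>u. u \<in> G \<Longrightarrow> (0, u) \<in> fixing g" and r: "r \<in> D" and v: "v \<in> sphere 0 1"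
    and y: "y \<in> folding_orbit G v"
  shows "y \<in> sphere 0 1 \<and> g (polar X r v) \<le> g (polar X r y)"
proof -
  have "fold folding us v \<in> sphere 0 1 \<and> g (polar X r v) \<le> g (polar X r (fold folding us v))"
    if "set us \<subseteq> G" for us
    using that v
  proof (induction us arbitrary: v)
    case (Cons u us)
    have u: "(0, u) \<in> fixing g" using Cons.prems G by simp
    then have "u \<in> sphere 0 1" by (auto simp: fixing_def Omega_def)
    with Cons.prems have "folding u v \<in> sphere 0 1" by (intro norm_folding)
    with Cons.IH[of "folding u v"] Cons.prems fixing_fold[OF u r, of v] show ?case by force
  qed simp
  with y show ?thesis by (auto simp: folding_orbit_def)
qed

lemma continuous_polar_left: "continuous_on S (\<lambda>r. polar X r u)"
  and continuous_polar_right: "continuous_on T (polar X r)"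
  using continuous_on_compose2[OF polar_cont, of S "\<lambda>r. (r, u)"] continuous_on_compose2[OF polar_cont, of T "\<lambda>u. (r, u)"]
  by (simp_all add: continuous_on_Pair continuous_on_const continuous_on_id)

text \<open>The directions in which \<open>g\<close> is at least its value in direction
  \<open>v\<close> form a closed set that contains the orbit of \<open>v\<close>. Exchanging
  \<open>v\<close> and \<open>w\<close> later gives equality.\<close>

lemma fixing_radial:
  assumes g: "continuous_on (pts X) g" and G: "\<And>u. u \<in> G \<Longrightarrow> (0, u) \<in> fixing g"
    and dense: "sphere 0 1 \<subseteq> closure (folding_orbit G v)"
    and r: "r \<in> D" and v: "v \<in> sphere 0 1" and w: "w \<in> sphere 0 1"
  shows "g (polar X r v) \<le> g (polar X r w)"
proof -
  let ?C = "{y \<in> sphere 0 1. g (polar X r v) \<le> g (polar X r y)}"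
  have c: "continuous_on (sphere 0 1) (\<lambda>y. g (polar X r y))"
    by (rule continuous_on_compose2[OF g continuous_polar_right]) (use polar_pts[OF r] in auto)
  have "closed (sphere 0 1 \<inter> (\<lambda>y. g (polar X r y)) -` {g (polar X r v)..})"
    by (rule continuous_closed_preimage[OF c]) auto
  then have "closed ?C" by (simp add: vimage_def Int_def)
  moreover have "folding_orbit G v \<subseteq> ?C"
    using fixing_fold_orbit[OF G r v] by auto
  ultimately show ?thesis using dense w closure_minimal by blast
qed

text \<open>The mirror carries the point at distance \<open>t\<close> opposite to \<open>u\<close>
  across the origin to distance \<open>t + r\<close> along \<open>u\<close>. The first point is on
  the H+ side, so a fixed \<open>g\<close> takes the larger value there.\<close>

lemma fixing_shift:
  assumes \<omega>: "(r, u) \<in> fixing g" and t: "0 \<le> t" "0 < r" "t + r \<in> D"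
  shows "g (polar X (t + r) u) \<le> g (polar X t (- u))"
proof -
  have u: "u \<in> sphere 0 1" using \<omega> by (auto simp: fixing_def Omega_def)
  have tD: "t \<in> D" using D_down[of t "t + r"] t by simp
  let ?x = "polar X t (- u)"
  have "two_point (r, u) g ?x = g ?x" using \<omega> polar_pts[OF tD, of "- u"] u by (auto simp: fixing_def)
  moreover have "height (r, u) ?x \<le> 0" "mirror (r, u) ?x = polar X (t + r) u"
    using polar_shift[OF t u] by (auto simp: height_def mirror_def)
  ultimately show ?thesis by (simp add: two_point_def)
qed

text \<open>For a radial function the shift inequality reads
  \<open>\<phi> (t + r) \<le> \<phi> t\<close> for the radii \<open>r\<close> occurring in
  \<open>fixing g\<close>. These are arbitrarily small, so iterated steps and continuity compare any
  two radii.\<close>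

lemma fixing_imp_radial_decreasing:
  assumes g: "continuous_on (pts X) g" and G: "\<And>u. u \<in> G \<Longrightarrow> (0, u) \<in> fixing g"
    and dense: "\<And>v. v \<in> sphere 0 1 \<Longrightarrow> sphere 0 1 \<subseteq> closure (folding_orbit G v)"
    and small: "\<And>\<epsilon>. 0 < \<epsilon> \<Longrightarrow> \<exists>\<omega>\<in>fixing g. 0 < fst \<omega> \<and> fst \<omega> < \<epsilon>"
  shows "radial_decreasing g"
proof -
  obtain e :: 'a where "e \<in> Basis" using nonempty_Basis by blast
  then have e: "e \<in> sphere 0 1" by simp
  define \<phi> where "\<phi> r = g (polar X r e)" for r
  have rad: "g (polar X r v) = \<phi> r" if "r \<in> D" "v \<in> sphere 0 1" for r v
    unfolding \<phi>_def using fixing_radial[OF g G dense] that e by (intro antisym) auto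
  have shift: "\<phi> (t + real k * r) \<le> \<phi> t"
    if "(r, u) \<in> fixing g" "0 \<le> t" "0 < r" "t + real k * r \<in> D" for r u t k
    using that(4)
  proof (induction k)
    case (Suc k)
    have u: "u \<in> sphere 0 1" using that by (auto simp: fixing_def Omega_def)
    have s: "(t + real k * r) + r = t + real (Suc k) * r" by (simp add: algebra_simps)
    have 0: "0 \<le> t + real k * r" using that by simp
    have d: "t + real k * r \<in> D" using D_down[OF 0 _ Suc.prems] that by (simp add: algebra_simps)
    \<comment> \<open>The shift reverses the direction, which is invisible to the radial
      \<open>g\<close>.\<close>
    have "\<phi> ((t + real k * r) + r) \<le> \<phi> (t + real k * r)"
      using fixing_shift[OF that(1) 0 that(3)] Suc.prems d u by (simp add: rad s)
    with Suc.IH[OF d] have "\<phi> ((t + real k * r) + r) \<le> \<phi> t" by (rule order_trans[rotated])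
    then show ?case by (simp only: s)
  qed simp
  have mono: "\<phi> t \<le> \<phi> s" if st: "s < t" "s \<in> D" "t \<in> D" for s t
  proof (rule ccontr)
    assume "\<not> \<phi> t \<le> \<phi> s"
    then have pos: "0 < \<phi> t - \<phi> s" by simp
    have "continuous_on D \<phi>" unfolding \<phi>_def
      by (rule continuous_on_compose2[OF g continuous_polar_left]) (use polar_pts e in auto)
    then obtain \<delta> where \<delta>: "0 < \<delta>" "\<And>s'. s' \<in> D \<Longrightarrow> dist s' s < \<delta> \<Longrightarrow> dist (\<phi> s') (\<phi> s) < \<phi> t - \<phi> s"
      using st pos unfolding continuous_on_iff by blast
    obtain r u where \<omega>: "(r, u) \<in> fixing g" "0 < r" "r < \<delta>" using small[OF \<delta>(1)] by force
    \<comment> \<open>The largest number of steps of length \<open>r\<close> that fit between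
      \<open>s\<close> and \<open>t\<close>; stepping back from \<open>t\<close> ends less than
      \<open>r\<close> above \<open>s\<close>, within reach of continuity at
      \<open>s\<close>.\<close>
    define k where "k = nat \<lfloor>(t - s) / r\<rfloor>"
    have "0 \<le> (t - s) / r" using st \<omega> by simp
    then have k: "real k \<le> (t - s) / r" "(t - s) / r < real k + 1"
      unfolding k_def by linarith+
    define s' where "s' = t - real k * r"
    have s': "s \<le> s'" "s' < s + r"
      using k \<omega>(2) by (auto simp: s'_def field_simps)
    have 0: "0 \<le> s" using D_nonneg st by simp
    have s'D: "s' \<in> D" using D_down[of s' t] st s' 0 \<omega>(2) by (simp add: s'_def)
    have "\<phi> t \<le> \<phi> s'" using shift[OF \<omega>(1) _ \<omega>(2), of s' k] s' 0 st by (simp add: s'_def)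
    moreover have "dist (\<phi> s') (\<phi> s) < \<phi> t - \<phi> s"
      using s' \<omega> by (intro \<delta>(2) s'D) (simp add: dist_real_def)
    ultimately show False by (simp add: dist_real_def)
  qed
  show ?thesis
    unfolding radial_decreasing_def
  proof (intro ballI impI)
    fix x y assume xy: "x \<in> pts X" "y \<in> pts X" "gauge y (orig X) \<le> gauge x (orig X)"
    obtain r u where x: "r \<in> D" "u \<in> sphere 0 1" "x = polar X r u" using polar_surj[OF xy(1)] by blast
    obtain s v where y: "s \<in> D" "v \<in> sphere 0 1" "y = polar X s v" using polar_surj[OF xy(2)] by blast
    have "dst X y (orig X) \<le> dst X x (orig X)" using xy orig_pts by (simp add: dst_le_gauge)
    then have "s \<le> r" using x y by (simp add: polar_dst)
    then show "g x \<le> g y" using mono[of s r] x y by (cases "s = r") (auto simp: rad)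
  qed
qed

text \<open>Compactness is available on \<open>gball R\<close> only. Outside it all
  \<open>F n\<close> vanish, so convergence there is trivial.\<close>

lemma Arzela_test:
  assumes F: "\<And>n. test R (F n)" and M: "\<And>n x. F n x \<le> M"
    and equi: "\<And>\<eta>. 0 < \<eta> \<Longrightarrow> \<exists>\<delta>>0. \<forall>n. gauge_modulus \<delta> \<eta> (F n)"
  obtains g k where "strict_mono (k :: nat \<Rightarrow> nat)" "test R g"
    "\<And>\<eta>. 0 < \<eta> \<Longrightarrow> \<exists>n0. \<forall>n\<ge>n0. \<forall>x\<in>pts X. \<bar>F (k n) x - g x\<bar> < \<eta>"
proof -
  have equicont: "\<exists>d>0. \<forall>n y. y \<in> gball R \<and> norm (x - y) < d \<longrightarrow> norm (F n x - F n y) < e"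
    if x: "x \<in> gball R" and e: "0 < e" for x and e :: real
  proof -
    obtain \<delta> where \<delta>: "0 < \<delta>" "\<And>n. gauge_modulus \<delta> (e / 2) (F n)"
      using equi[of "e / 2"] e by auto
    obtain B where B: "0 < B" "\<And>x y. norm (b x y) \<le> norm x * norm y * B"
      using pos_bounded by blast
    show ?thesis
    proof (intro exI[of _ "sqrt (\<delta> / B)"] conjI allI impI)
      show "0 < sqrt (\<delta> / B)" using \<delta>(1) B(1) by simp
      fix n y assume y: "y \<in> gball R \<and> norm (x - y) < sqrt (\<delta> / B)"
      then have "\<bar>F n x - F n y\<bar> \<le> e / 2"
        using x gball_pts by (intro gauge_modulus_dist[OF \<delta> B]) (auto simp: dist_norm)
      then show "norm (F n x - F n y) < e" using e by simp
    qed
  qed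
  have bound: "norm (F n x) \<le> M" for n x using M[of n x] testD(3)[OF F, of n x] by simp
  obtain g0 k where g0: "continuous_on (gball R) g0" "strict_mono (k :: nat \<Rightarrow> nat)"
    "\<And>e. 0 < e \<Longrightarrow> \<exists>N. \<forall>n x. n \<ge> N \<and> x \<in> gball R \<longrightarrow> norm (F (k n) x - g0 x) < e"
    using Arzela_Ascoli[OF compact_gball bound equicont] by blast
  \<comment> \<open>Arzela-Ascoli leaves \<open>g0\<close> undetermined off the ball. Continuity of
    the extension by zero across the boundary comes from uniform convergence on
    \<open>pts X\<close>.\<close>
  define g where "g x = (if x \<in> gball R then g0 x else 0)" for x
  have conv: "\<exists>n0. \<forall>n\<ge>n0. \<forall>x. \<bar>F (k n) x - g x\<bar> < \<eta>" if \<eta>: "0 < \<eta>" for \<eta>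
  proof -
    obtain n0 where n0: "\<forall>n x. n \<ge> n0 \<and> x \<in> gball R \<longrightarrow> norm (F (k n) x - g0 x) < \<eta>"
      using g0(3)[OF \<eta>] by blast
    have "\<bar>F (k n) x - g x\<bar> < \<eta>" if "n \<ge> n0" for n x
      using n0 that testD(4)[OF F, of x "k n"] \<open>0 < \<eta>\<close> by (auto simp: g_def)
    then show ?thesis by blast
  qed
  have "uniform_limit (pts X) (\<lambda>n. F (k n)) g sequentially"
    unfolding uniform_limit_sequentially_iff dist_real_def using conv by meson
  then have cont: "continuous_on (pts X) g"
    by (rule uniform_limit_theorem[rotated]) (use testD(2)[OF F] in auto)
  have lim: "(\<lambda>n. F (k n) x) \<longlonglongrightarrow> g x" for x
    unfolding LIMSEQ_iff real_norm_def using conv by meson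
  have "0 \<le> g x" for x
    using LIMSEQ_le_const[OF lim, of 0] testD(3)[OF F] by auto
  moreover have "g \<in> borel_measurable borel"
  proof -
    have "(\<lambda>x. indicator (pts X) x *\<^sub>R g x) \<in> borel_measurable borel"
      using borel_measurable_continuous_on_indicator[OF pts_borel cont] by simp
    moreover have "(\<lambda>x. indicator (pts X) x *\<^sub>R g x) = g"
      using gball_pts[of R] by (auto simp: g_def fun_eq_iff split: split_indicator)
    ultimately show ?thesis by simp
  qed
  ultimately have "test R g" using cont by (auto simp: test_def g_def)
  with g0(2) conv that show thesis by meson
qed

text \<open>Functions at distance \<open>\<eta>\<close> can be compared only between the levels
  \<open>t\<close> and \<open>t + \<eta>\<close>. Continuity of the measure along the levels
  \<open>t + 1 / (n + 1)\<close> removes the shift.\<close>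

lemma emeasure_superlevel_limit:
  assumes f[measurable]: "f \<in> borel_measurable borel" and g[measurable]: "g \<in> borel_measurable borel"
    and approx: "\<And>\<eta>. 0 < \<eta> \<Longrightarrow> \<exists>h. (\<forall>t. emeasure m {x \<in> pts X. t < h x} = emeasure m {x \<in> pts X. t < f x})
        \<and> h \<in> borel_measurable borel \<and> (\<forall>x\<in>pts X. \<bar>h x - g x\<bar> < \<eta>)"
  shows "emeasure m {x \<in> pts X. t < f x} = emeasure m {x \<in> pts X. t < (g x :: real)}"
proof -
  have sup: "emeasure m {x \<in> pts X. t < h x} = (SUP n. emeasure m {x \<in> pts X. t + 1 / real (Suc n) < h x})"
    if [measurable]: "h \<in> borel_measurable borel" for h :: "'p \<Rightarrow> real"
  proof -
    have "(SUP n. emeasure m {x \<in> pts X. t + 1 / real (Suc n) < h x})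
        = emeasure m (\<Union>n. {x \<in> pts X. t + 1 / real (Suc n) < h x})"
    proof (rule SUP_emeasure_incseq)
      show "incseq (\<lambda>n. {x \<in> pts X. t + 1 / real (Suc n) < h x})"
      proof (rule incseq_SucI, rule subsetI)
        fix n x assume "x \<in> {x \<in> pts X. t + 1 / real (Suc n) < h x}"
        moreover have "1 / real (Suc (Suc n)) \<le> 1 / real (Suc n)" by (simp add: frac_le)
        ultimately show "x \<in> {x \<in> pts X. t + 1 / real (Suc (Suc n)) < h x}" by simp
      qed
    qed (auto simp: sets_m)
    also have "(\<Union>n. {x \<in> pts X. t + 1 / real (Suc n) < h x}) = {x \<in> pts X. t < h x}"
    proof (intro set_eqI iffI)
      fix x assume "x \<in> {x \<in> pts X. t < h x}"
      then have "x \<in> pts X" "0 < h x - t" by auto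
      then obtain n where "1 / real (Suc n) < h x - t" using nat_approx_posE by blast
      then show "x \<in> (\<Union>n. {x \<in> pts X. t + 1 / real (Suc n) < h x})"
        using \<open>x \<in> pts X\<close> by (auto intro!: exI[of _ n])
    next
      fix x assume "x \<in> (\<Union>n. {x \<in> pts X. t + 1 / real (Suc n) < h x})"
      then obtain n where "x \<in> pts X" "t + 1 / real (Suc n) < h x" by auto
      moreover have "0 < 1 / real (Suc n)" by simp
      ultimately have "t < h x" by linarith
      with \<open>x \<in> pts X\<close> show "x \<in> {x \<in> pts X. t < h x}" by simp
    qed
    finally show ?thesis by simp
  qed
  have 1: "emeasure m {x \<in> pts X. t + \<eta> < g x} \<le> emeasure m {x \<in> pts X. t < f x}"
    and 2: "emeasure m {x \<in> pts X. t + \<eta> < f x} \<le> emeasure m {x \<in> pts X. t < g x}" if \<eta>: "0 < \<eta>" for \<eta>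
  proof -
    obtain h where h: "\<And>t. emeasure m {x \<in> pts X. t < h x} = emeasure m {x \<in> pts X. t < f x}"
      "h \<in> borel_measurable borel" "\<And>x. x \<in> pts X \<Longrightarrow> \<bar>h x - g x\<bar> < \<eta>" using approx[OF \<eta>] by blast
    note [measurable] = h(2)
    have "emeasure m {x \<in> pts X. t + \<eta> < g x} \<le> emeasure m {x \<in> pts X. t < h x}"
      by (rule emeasure_mono) (use h(3) in \<open>force simp: sets_m\<close>)+
    then show "emeasure m {x \<in> pts X. t + \<eta> < g x} \<le> emeasure m {x \<in> pts X. t < f x}" by (simp add: h)
    have "emeasure m {x \<in> pts X. t + \<eta> < h x} \<le> emeasure m {x \<in> pts X. t < g x}"
      by (rule emeasure_mono) (use h(3) in \<open>force simp: sets_m\<close>)+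
    then show "emeasure m {x \<in> pts X. t + \<eta> < f x} \<le> emeasure m {x \<in> pts X. t < g x}" by (simp add: h)
  qed
  show ?thesis
  proof (rule antisym)
    show "emeasure m {x \<in> pts X. t < f x} \<le> emeasure m {x \<in> pts X. t < g x}"
      unfolding sup[OF f] by (rule SUP_least) (rule 2, simp)
    show "emeasure m {x \<in> pts X. t < g x} \<le> emeasure m {x \<in> pts X. t < f x}"
      unfolding sup[OF g] by (rule SUP_least) (rule 1, simp)
  qed
qed

section \<open>Identification with the symmetric decreasing rearrangement\<close>

lemma dst_orig_in_D: "x \<in> pts X \<Longrightarrow> dst X x (orig X) \<in> D"
  using polar_surj[of x] polar_dst by fastforce

lemma dst_orig_nonneg: "x \<in> pts X \<Longrightarrow> 0 \<le> dst X x (orig X)"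
  using dst_orig_in_D D_nonneg by blast

lemma ex_unit: obtains e :: 'a where "e \<in> sphere 0 1"
  using nonempty_Basis by (metis all_not_in_conv mem_sphere_0 norm_Basis)

text \<open>The locale contains no continuity of \<open>dst\<close>. For a radius in
  \<open>D\<close>, distances are compared through the continuous gauge with a point at that
  distance; for a larger radius the ball is the whole space.\<close>

lemma openin_orig_ball:
  assumes "0 \<le> s"
  shows "openin (top_of_set (pts X)) (orig_ball X s)"
    and "openin (top_of_set (pts X)) {x \<in> pts X. s < dst X x (orig X)}"
proof -
  obtain e :: 'a where e: "e \<in> sphere 0 1" by (rule ex_unit)
  have "openin (top_of_set (pts X)) (orig_ball X s) \<and>
      openin (top_of_set (pts X)) {x \<in> pts X. s < dst X x (orig X)}"
  proof (cases "s \<in> D")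
    case True
    define x0 where "x0 = polar X s e"
    have x0: "x0 \<in> pts X" "dst X x0 (orig X) = s" using True e by (auto simp: x0_def polar_pts polar_dst)
    have lt: "dst X x (orig X) < s \<longleftrightarrow> gauge x (orig X) < gauge x0 (orig X)"
      and gt: "s < dst X x (orig X) \<longleftrightarrow> gauge x0 (orig X) < gauge x (orig X)" if "x \<in> pts X" for x
      using dst_le_gauge[OF x0(1) orig_pts that orig_pts] dst_le_gauge[OF that orig_pts x0(1) orig_pts] x0(2)
      by (auto simp: not_le[symmetric])
    have "orig_ball X s = {x \<in> pts X. gauge x (orig X) < gauge x0 (orig X)}"
      "{x \<in> pts X. s < dst X x (orig X)} = {x \<in> pts X. gauge x0 (orig X) < gauge x (orig X)}"
      using lt gt by (auto simp: orig_ball_def)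
    then show ?thesis
      using openin_superlevel[OF continuous_gauge_left] openin_sublevel[OF continuous_gauge_left] by simp
  next
    case False
    have "dst X x (orig X) < s" if "x \<in> pts X" for x
      using D_down[OF assms _ dst_orig_in_D[OF that]] False by (meson not_le)
    then have "orig_ball X s = pts X" "{x \<in> pts X. s < dst X x (orig X)} = {}"
      by (force simp: orig_ball_def)+
    then show ?thesis by (simp only: openin_subtopology_self openin_empty simp_thms openin_topspace)
  qed
  then show "openin (top_of_set (pts X)) (orig_ball X s)"
    and "openin (top_of_set (pts X)) {x \<in> pts X. s < dst X x (orig X)}" by auto
qed

lemma orig_ball_borel: "0 \<le> s \<Longrightarrow> orig_ball X s \<in> sets borel"
  using openin_orig_ball(1) openin_pts_borel by blast

lemma orig_ball_mono: "s \<le> t \<Longrightarrow> orig_ball X s \<subseteq> orig_ball X t"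
  by (auto simp: orig_ball_def)

text \<open>For two balls of equal finite measure the open annulus between them is null, hence
  empty. The assumption \<open>balls\<close> supplies a point in it unless the smaller ball already
  has full measure, as on the sphere for radii from pi on.\<close>

lemma orig_ball_unique:
  assumes st: "0 \<le> s" "0 \<le> t" and eq: "emeasure m (orig_ball X s) = emeasure m (orig_ball X t)"
    and fin: "emeasure m (orig_ball X s) < \<infinity>" and ne: "emeasure m (orig_ball X s) \<noteq> emeasure m (pts X)"
  shows "orig_ball X s = orig_ball X t"
proof -
  have main: "orig_ball X s = orig_ball X t"
    if st: "0 \<le> s" "s < t" and eq: "emeasure m (orig_ball X s) = emeasure m (orig_ball X t)"
      and fin: "emeasure m (orig_ball X s) < \<infinity>" and ne: "emeasure m (orig_ball X s) \<noteq> emeasure m (pts X)"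
    for s t
  proof (rule ccontr)
    assume "orig_ball X s \<noteq> orig_ball X t"
    with balls[OF st this] ne obtain r where r: "r \<in> D" "s < r" "r < t" by blast
    obtain e :: 'a where e: "e \<in> sphere 0 1" by (rule ex_unit)
    let ?V = "orig_ball X t \<inter> {x \<in> pts X. s < dst X x (orig X)}"
    have o: "openin (top_of_set (pts X)) ?V"
      using openin_orig_ball(1)[of t] openin_orig_ball(2)[of s] st by (intro openin_Int) auto
    have V: "?V \<in> sets borel" "orig_ball X s \<in> sets borel" "orig_ball X t \<in> sets borel"
      using openin_pts_borel[OF o] orig_ball_borel st by auto
    have "emeasure m (orig_ball X s) + emeasure m ?V = emeasure m (orig_ball X s \<union> ?V)"
      by (rule plus_emeasure) (use V in \<open>auto simp: sets_m orig_ball_def\<close>)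
    also have "\<dots> \<le> emeasure m (orig_ball X t)"
      by (rule emeasure_mono) (use V orig_ball_mono[of s t] st in \<open>auto simp: sets_m\<close>)
    finally have "emeasure m (orig_ball X s) + emeasure m ?V \<le> emeasure m (orig_ball X s) + 0"
      by (simp add: eq)
    then have "emeasure m ?V = 0"
      using fin ennreal_add_left_cancel_le[of "emeasure m (orig_ball X s)" "emeasure m ?V" 0] by auto
    from openin_null_imp_empty[OF o this] show False
      using r e polar_pts[OF r(1) e] polar_dst[OF r(1) e] by (auto simp: orig_ball_def)
  qed
  show ?thesis
  proof (cases s t rule: linorder_cases)
    case less then show ?thesis using main[of s t] assms by simp
  next
    case greater then show ?thesis using main[of t s] assms by simp
  qed simp
qed

text \<open>The radius is the smallest one at which the profile is at most \<open>t\<close>. It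
  exists because \<open>x0\<close> provides such a radius and the profile is continuous on a compact
  interval.\<close>

lemma radial_superlevel_ball:
  assumes g: "continuous_on (pts X) g" and rd: "radial_decreasing g" and x0: "x0 \<in> pts X" "g x0 \<le> t"
  obtains s where "0 \<le> s" "{x \<in> pts X. t < g x} = orig_ball X s"
proof -
  obtain e :: 'a where e: "e \<in> sphere 0 1" by (rule ex_unit)
  define \<phi> where "\<phi> r = g (polar X r e)" for r
  have dec: "g x \<le> g y" if "x \<in> pts X" "y \<in> pts X" "dst X y (orig X) \<le> dst X x (orig X)" for x y
    using rd that orig_pts by (simp add: radial_decreasing_def dst_le_gauge)
  have \<phi>: "g x = \<phi> (dst X x (orig X))" if "x \<in> pts X" for x
    using dst_orig_in_D[OF that] e that unfolding \<phi>_def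
    by (intro antisym dec) (auto simp: polar_pts polar_dst)
  define r1 where "r1 = dst X x0 (orig X)"
  have r1: "r1 \<in> D" "\<phi> r1 \<le> t" using x0 \<phi>[of x0] dst_orig_in_D by (auto simp: r1_def)
  have sub: "{0..r1} \<subseteq> D" using D_down r1 by auto
  have c: "continuous_on {0..r1} \<phi>" unfolding \<phi>_def
    by (rule continuous_on_compose2[OF g continuous_polar_left]) (use sub polar_pts e in auto)
  let ?E = "{0..r1} \<inter> \<phi> -` {..t}"
  have "compact ?E"
    using continuous_closed_preimage[OF c, of "{..t}"] by (metis closed_atLeastAtMost closed_atMost compact_Icc closed_Int_compact inf.absorb1 inf_commute inf_le1)
  moreover have "?E \<noteq> {}" using r1 D_nonneg[OF r1(1)] by auto
  ultimately obtain s where s: "s \<in> ?E" "\<And>r. r \<in> ?E \<Longrightarrow> s \<le> r"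
    using compact_attains_inf by metis
  have sD: "s \<in> D" using s sub by auto
  have "t < g x \<longleftrightarrow> dst X x (orig X) < s" if x: "x \<in> pts X" for x
  proof
    assume "t < g x"
    show "dst X x (orig X) < s"
    proof (rule ccontr)
      assume "\<not> dst X x (orig X) < s"
      then have "g x \<le> g (polar X s e)" using x sD e by (intro dec) (auto simp: polar_pts polar_dst)
      then show False using s(1) \<open>t < g x\<close> by (simp add: \<phi>_def)
    qed
  next
    assume lt: "dst X x (orig X) < s"
    show "t < g x"
    proof (rule ccontr)
      assume "\<not> t < g x"
      then have "dst X x (orig X) \<in> ?E" using \<phi>[OF x] lt s(1) dst_orig_nonneg[OF x] by auto
      with s(2) lt show False by fastforce
    qed
  qed
  then show ?thesis using s(1) by (intro that[of s]) (auto simp: orig_ball_def)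
qed

text \<open>Layer-cake argument: \<open>x\<close> belongs to the rearranged level set for
  \<open>t < g x\<close> and not for \<open>t > g x\<close>, so the integral over the levels is
  \<open>g x\<close>.\<close>

lemma sym_decr_rearr_eq:
  assumes f: "continuous_on (pts X) f" and g: "continuous_on (pts X) g"
    and pos: "\<And>x. x \<in> pts X \<Longrightarrow> 0 \<le> g x" and rd: "radial_decreasing g"
    and eq: "\<And>t. 0 < t \<Longrightarrow> emeasure m {x \<in> pts X. t < f x} = emeasure m {x \<in> pts X. t < g x}"
    and fin: "\<And>t. 0 < t \<Longrightarrow> emeasure m {x \<in> pts X. t < f x} < \<infinity>"
    and x: "x \<in> pts X"
  shows "sym_decr_rearr X f x = g x"
proof -
  have fm: "{x \<in> pts X. t < f x} \<in> sets borel" and gm: "{x \<in> pts X. t < g x} \<in> sets borel" for t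
    using openin_pts_borel openin_superlevel f g by blast+
  let ?S = "\<lambda>t. set_rearr X {x \<in> pts X. t < f x}"
  have key: "(t < g x \<longrightarrow> x \<in> ?S t) \<and> (x \<in> ?S t \<longrightarrow> t \<le> g x)" if t: "0 < t" for t
  proof (cases "emeasure m {x \<in> pts X. t < f x} = emeasure m (pts X)")
    case True
    then have "?S t = pts X" using fm by (simp add: set_rearr_def m_vol)
    \<comment> \<open>Full measure does not force \<open>t < g\<close> everywhere, but the open set
      where \<open>g < t\<close> is null, hence empty.\<close>
    moreover have "{x \<in> pts X. g x < t} = {}"
    proof (rule openin_null_imp_empty[OF openin_sublevel[OF g]])
      have s: "{x \<in> pts X. g x < t} \<in> sets borel" using openin_pts_borel openin_sublevel g by blast
      have "emeasure m {x \<in> pts X. t < g x} + emeasure m {x \<in> pts X. g x < t}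
          = emeasure m ({x \<in> pts X. t < g x} \<union> {x \<in> pts X. g x < t})"
        by (rule plus_emeasure) (use s gm in \<open>auto simp: sets_m\<close>)
      also have "\<dots> \<le> emeasure m (pts X)"
        by (rule emeasure_mono) (auto simp: sets_m)
      finally have "emeasure m (pts X) + emeasure m {x \<in> pts X. g x < t} \<le> emeasure m (pts X) + 0"
        using True eq[OF t] by simp
      then show "emeasure m {x \<in> pts X. g x < t} = 0"
        using fin[OF t] True
          ennreal_add_left_cancel_le[of "emeasure m (pts X)" "emeasure m {x \<in> pts X. g x < t}" 0] by auto
    qed
    ultimately show ?thesis using x by force
  next
    case False
    then have "{x \<in> pts X. t < g x} \<noteq> pts X" using eq[OF t] by metis
    then obtain x0 where "x0 \<in> pts X" "g x0 \<le> t" by force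
    then obtain s where s: "0 \<le> s" "{x \<in> pts X. t < g x} = orig_ball X s"
      using radial_superlevel_ball[OF g rd] by blast
    have em: "emeasure m (orig_ball X s) = emeasure m {x \<in> pts X. t < f x}"
      using eq[OF t] s by simp
    have "?S t = (THE B. (\<exists>\<rho>\<ge>0. B = orig_ball X \<rho>) \<and> vol X B = vol X {x \<in> pts X. t < f x})"
      using False fm by (simp add: set_rearr_def m_vol)
    also have "\<dots> = orig_ball X s"
    proof (rule the_equality)
      have ball: "vol X (orig_ball X \<rho>) = emeasure m (orig_ball X \<rho>)" if "0 \<le> \<rho>" for \<rho>
        using orig_ball_borel[OF that] by (intro m_vol) (auto simp: orig_ball_def)
      have vf: "vol X {x \<in> pts X. t < f x} = emeasure m (orig_ball X s)"
        using em fm by (subst m_vol) auto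
      show "(\<exists>\<rho>\<ge>0. orig_ball X s = orig_ball X \<rho>) \<and> vol X (orig_ball X s) = vol X {x \<in> pts X. t < f x}"
        using s(1) vf ball by auto
      fix B assume "(\<exists>\<rho>\<ge>0. B = orig_ball X \<rho>) \<and> vol X B = vol X {x \<in> pts X. t < f x}"
      then obtain \<rho> where \<rho>: "0 \<le> \<rho>" "B = orig_ball X \<rho>" "emeasure m (orig_ball X s) = emeasure m (orig_ball X \<rho>)"
        using vf ball by metis
      show "B = orig_ball X s"
        using orig_ball_unique[OF s(1) \<rho>(1,3)] fin[OF t] False em \<rho>(2) by simp
    qed
    finally have "x \<in> ?S t \<longleftrightarrow> t < g x" using s(2) x by blast
    then show ?thesis by auto
  qed
  \<comment> \<open>Only the level \<open>t = g x\<close> remains undecided, and a single level does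
    not affect the integral.\<close>
  define Q where "Q = {t. 0 < t \<and> x \<in> ?S t}"
  have "{0<..<g x} \<subseteq> Q" "Q \<subseteq> {0<..g x}" using key by (auto simp: Q_def)
  moreover have "{0<..g x} - {g x} = {0<..<g x}" by auto
  ultimately have "Q = {0<..<g x} \<or> Q = {0<..g x}" by blast
  then have "measure lborel Q = g x" "Q \<in> sets lborel" using pos[OF x] by auto
  moreover have "sym_decr_rearr X f x = (\<integral>t. indicator Q t \<partial>lborel)"
    unfolding sym_decr_rearr_def set_lebesgue_integral_def
    by (intro Bochner_Integration.integral_cong) (auto simp: Q_def indicator_def)
  ultimately show ?thesis by simp
qed

end

section \<open>A countable dense family of test functions\<close>

text \<open>A finite maximum of 0 and downward metric cones of slope \<open>L + 1\<close>. Rational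
  apex heights and apices taken from a countable set make the family countable.\<close>

fun tent :: "(rat \<times> 'p::metric_space) list \<Rightarrow> nat \<Rightarrow> 'p \<Rightarrow> real" where
  "tent [] L x = 0"
| "tent ((a, q) # ps) L x = max (of_rat a - real (Suc L) * dist x q) (tent ps L x)"

lemma tent_nonneg: "0 \<le> tent ps L x"
  by (induction ps) (auto simp: le_max_iff_disj)

lemma tent_ge: "(a, q) \<in> set ps \<Longrightarrow> of_rat a - real (Suc L) * dist x q \<le> tent ps L x"
  by (induction ps) (auto simp: le_max_iff_disj simp del: of_nat_Suc)

lemma tent_le:
  "0 \<le> B \<Longrightarrow> (\<And>a q. (a, q) \<in> set ps \<Longrightarrow> of_rat a - real (Suc L) * dist x q \<le> B) \<Longrightarrow> tent ps L x \<le> B"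
  by (induction ps) (auto simp del: of_nat_Suc)

lemma continuous_tent: "continuous_on S (tent ps L)"
proof (induction ps)
  case (Cons p ps)
  obtain a q where "p = (a, q)" by (cases p)
  with Cons show ?case by (auto intro!: continuous_intros)
qed simp

lemma tent_support: "\<exists>r. \<forall>x. r < dist (z::'p::metric_space) x \<longrightarrow> tent ps L x = 0"
proof (induction ps)
  case (Cons p ps)
  obtain a q where p: "p = (a, q)" by (cases p)
  obtain r where r: "\<And>x. r < dist z x \<Longrightarrow> tent ps L x = 0" using Cons by blast
  have "tent (p # ps) L x = 0" if x: "max r (dist z q + \<bar>of_rat a\<bar>) < dist z x" for x
  proof -
    have "dist z x \<le> dist z q + dist x q" by (metis dist_commute dist_triangle)
    then have "\<bar>of_rat a\<bar> \<le> dist x q" using x by simp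
    also have "\<dots> \<le> real (Suc L) * dist x q"
      using mult_right_mono[of 1 "real (Suc L)" "dist x q"] by simp
    finally have "of_rat a - real (Suc L) * dist x q \<le> 0" by linarith
    then show ?thesis using r[of x] x p by (simp del: of_nat_Suc)
  qed
  then show ?case by blast
qed simp

context polar_model
begin

lemma test_mono: "test R f \<Longrightarrow> R \<le> R' \<Longrightarrow> test R' f"
  by (force simp: test_def gball_def)

text \<open>\<open>K\<close> is merely bounded, so that an ambient ball can serve as the support of
  a tent function.\<close>

lemma test_of_bounded_support:
  assumes f: "continuous_on (pts X) f" and pos: "\<And>x. x \<in> pts X \<Longrightarrow> 0 \<le> f x"
    and K: "bounded K" "\<And>x. x \<in> pts X \<Longrightarrow> x \<notin> K \<Longrightarrow> f x = 0"
  obtains R where "test R (\<lambda>x. indicator (pts X) x * f x)"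
proof -
  have "compact ((\<lambda>x. gauge x (orig X)) ` closure K)"
    by (rule compact_continuous_image) (use K(1) continuous_gauge_left in auto)
  then obtain R where R: "\<And>x. x \<in> closure K \<Longrightarrow> gauge x (orig X) \<le> R"
    using compact_imp_bounded bounded_iff by (metis abs_le_D1 imageI real_norm_def)
  have "indicator (pts X) x * f x = 0" if "x \<notin> gball R" for x
    using that K(2)[of x] R[of x] closure_subset[of K] by (auto simp: gball_def indicator_def)
  moreover have "continuous_on (pts X) (\<lambda>x. indicator (pts X) x * f x)"
    by (rule continuous_on_eq[OF f]) simp
  moreover have "(\<lambda>x. indicator (pts X) x * f x) \<in> borel_measurable borel"
    using borel_measurable_continuous_on_indicator[OF pts_borel f] by simp
  ultimately show thesis
    using pos by (intro that[of R]) (auto simp: test_def indicator_def)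
qed

text \<open>Cones with apex just above the graph of \<open>f\<close>, over a fine net of the
  support: a steep slope keeps distant cones below the graph, and near a net point the cone has
  hardly dropped.\<close>

lemma countable_dense_tests:
  obtains \<D> :: "('p \<Rightarrow> real) set" where "countable \<D>" "\<And>h. h \<in> \<D> \<Longrightarrow> \<exists>R. test R h"
    "\<And>R f \<epsilon>. test R f \<Longrightarrow> 0 < \<epsilon> \<Longrightarrow> \<exists>h\<in>\<D>. \<forall>x\<in>pts X. \<bar>f x - h x\<bar> \<le> \<epsilon>"
proof -
  obtain Q where Q: "countable Q" "Q \<subseteq> pts X" "pts X \<subseteq> closure Q" using separable by blast
  define H where "H p x = indicator (pts X) x * tent (fst p) (snd p) x" for p and x :: 'p
  define \<D> where "\<D> = H ` (lists (UNIV \<times> Q) \<times> UNIV)"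
  show thesis
  proof (rule that[of \<D>])
    show "countable \<D>"
      unfolding \<D>_def using Q(1) by (intro countable_image countable_SIGMA countable_lists) auto
  next
    fix h assume "h \<in> \<D>"
    then obtain ps L where h: "h = (\<lambda>x. indicator (pts X) x * tent ps L x)"
      by (auto simp: \<D>_def H_def[abs_def])
    obtain r where r: "\<And>x. r < dist (orig X) x \<Longrightarrow> tent ps L x = 0" using tent_support[of "orig X"] by blast
    show "\<exists>R. test R h"
      unfolding h
      by (rule test_of_bounded_support[of "tent ps L" "cball (orig X) r"])
        (use r continuous_tent tent_nonneg in auto)
  next
    fix R f \<epsilon>' assume f: "test R f" and \<epsilon>': "0 < (\<epsilon>' :: real)"
    \<comment> \<open>Both the upper and the lower estimate below lose
      \<open>2 * \<epsilon>\<close>.\<close>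
    define \<epsilon> where "\<epsilon> = \<epsilon>' / 2"
    have \<epsilon>: "0 < \<epsilon>" using \<epsilon>' by (simp add: \<epsilon>_def)
    obtain M where M: "0 \<le> M" "\<And>x. f x \<le> M" using test_bounded[OF f] by blast
    obtain \<delta>0 where "0 < \<delta>0" "gauge_modulus \<delta>0 \<epsilon> f" using test_modulus[OF f \<epsilon>] by blast
    note \<delta>0 = this
    obtain B where B: "0 < B" "\<And>x y. norm (b x y) \<le> norm x * norm y * B"
      using pos_bounded by blast
    define \<delta> where "\<delta> = sqrt (\<delta>0 / B)"
    have \<delta>: "0 < \<delta>" "\<And>x y. x \<in> pts X \<Longrightarrow> y \<in> pts X \<Longrightarrow> dist x y < \<delta> \<Longrightarrow> \<bar>f x - f y\<bar> \<le> \<epsilon>"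
      using \<delta>0(1) B(1) gauge_modulus_dist[OF \<delta>0 B] by (simp_all add: \<delta>_def)
    \<comment> \<open>The apices lie below height \<open>M + \<epsilon>\<close>; this slope makes
      every cone nonpositive beyond distance \<open>\<delta>\<close>.\<close>
    obtain L where L: "(M + \<epsilon>) / \<delta> < real L" using reals_Archimedean2 by blast
    have L': "M + \<epsilon> \<le> real (Suc L) * \<delta>"
    proof -
      have "M + \<epsilon> < real L * \<delta>" using L \<delta>(1) by (simp add: field_simps)
      also have "\<dots> \<le> real (Suc L) * \<delta>" using \<delta>(1) by (intro mult_right_mono) auto
      finally show ?thesis by simp
    qed
    \<comment> \<open>Within this distance of an apex, \<open>f\<close> varies by at most
      \<open>\<epsilon>\<close> and the cone drops by at most \<open>\<epsilon>\<close>.\<close>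
    define \<eta> where "\<eta> = min \<delta> (\<epsilon> / real (Suc L))"
    have \<eta>: "0 < \<eta>" using \<delta> \<epsilon> by (simp add: \<eta>_def)
    have "gball R \<subseteq> (\<Union>q\<in>Q. ball q \<eta>)"
    proof
      fix x assume "x \<in> gball R"
      then have "x \<in> closure Q" using Q(3) gball_pts by blast
      then obtain q where "q \<in> Q" "dist q x < \<eta>" using \<eta> closure_approachable by blast
      then show "x \<in> (\<Union>q\<in>Q. ball q \<eta>)" by auto
    qed
    then obtain Q0 where Q0: "Q0 \<subseteq> Q" "finite Q0" "gball R \<subseteq> (\<Union>q\<in>Q0. ball q \<eta>)"
      using compactE_image[OF compact_gball, of Q "\<lambda>q. ball q \<eta>" R] by auto
    have "\<exists>r. f q < of_rat r \<and> of_rat r < f q + \<epsilon>" for q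
      using of_rat_dense[of "f q" "f q + \<epsilon>"] \<epsilon> by simp
    then obtain a where a: "\<And>q. f q < of_rat (a q) \<and> of_rat (a q) < f q + \<epsilon>" by metis
    obtain ql where ql: "set ql = Q0" using finite_list[OF Q0(2)] by blast
    define ps where "ps = map (\<lambda>q. (a q, q)) ql"
    have ps: "(r, q) \<in> set ps \<longleftrightarrow> q \<in> Q0 \<and> r = a q" for r q by (auto simp: ps_def ql)
    show "\<exists>h\<in>\<D>. \<forall>x\<in>pts X. \<bar>f x - h x\<bar> \<le> \<epsilon>'"
    proof (intro bexI[of _ "H (ps, L)"] ballI)
      show "H (ps, L) \<in> \<D>"
        unfolding \<D>_def by (rule imageI) (use Q0(1) ql in \<open>auto simp: ps_def\<close>)
      fix x assume x: "x \<in> pts X"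
      have "tent ps L x \<le> f x + 2 * \<epsilon>"
      proof (rule tent_le)
        show "0 \<le> f x + 2 * \<epsilon>" using testD(3)[OF f, of x] \<epsilon> by simp
        fix r q assume "(r, q) \<in> set ps"
        then have q: "q \<in> Q0" "r = a q" "q \<in> pts X" using ps Q0(1) Q(2) by auto
        show "of_rat r - real (Suc L) * dist x q \<le> f x + 2 * \<epsilon>"
        proof (cases "dist x q < \<delta>")
          case True
          then have "f q \<le> f x + \<epsilon>" using \<delta>(2)[OF x q(3)] by auto
          moreover have "0 \<le> real (Suc L) * dist x q" by (intro mult_nonneg_nonneg) auto
          ultimately show ?thesis using a[of q] unfolding q(2) by linarith
        next
          case False
          then have "real (Suc L) * \<delta> \<le> real (Suc L) * dist x q" by (intro mult_left_mono) auto
          then show ?thesis using a[of q] L' M(2)[of q] testD(3)[OF f, of x] \<epsilon> unfolding q(2) by linarith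
        qed
      qed
      moreover have "f x - 2 * \<epsilon> \<le> tent ps L x"
      proof (cases "x \<in> gball R")
        case True
        then obtain q where q: "q \<in> Q0" "dist q x < \<eta>" using Q0(3) by auto
        have "dist x q < \<delta>" "dist x q < \<epsilon> / real (Suc L)"
          using q(2) by (auto simp: \<eta>_def dist_commute simp del: of_nat_Suc)
        then have "f x \<le> f q + \<epsilon>" "real (Suc L) * dist x q \<le> \<epsilon>"
          using \<delta>(2)[OF x, of q] q(1) Q0(1) Q(2)
          by (force, simp add: pos_less_divide_eq mult.commute del: of_nat_Suc)
        moreover have "of_rat (a q) - real (Suc L) * dist x q \<le> tent ps L x"
          using q(1) ps by (intro tent_ge) auto
        ultimately show ?thesis using a[of q] by linarith
      next
        case False
        then show ?thesis using testD(4)[OF f False] tent_nonneg[of ps L x] \<epsilon> by linarith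
      qed
      ultimately show "\<bar>f x - H (ps, L) x\<bar> \<le> \<epsilon>'" using x by (simp add: H_def \<epsilon>_def abs_le_iff)
    qed
  qed
qed

end

section \<open>Random sequences of polarizations\<close>

locale random_polarizations = polar_model X b N c D m
  for X :: "('p::euclidean_space, 'a::euclidean_space) space_form"
    and b N c D and m :: "'p measure" +
  fixes \<mu> :: "(real \<times> 'a) measure" and G :: "'a set"
  assumes prob_\<mu>: "prob_space \<mu>"
    and sets_\<mu>: "sets \<mu> = sets (restrict_space borel Omega)"
    and AE_valid: "AE \<omega> in \<mu>. \<omega> \<in> valid"
    and G_eq: "G = {u \<in> sphere 0 1. (0, u) \<in> measure_support \<mu>}"
    and dense: "\<And>x. x \<in> sphere 0 1 \<Longrightarrow> sphere 0 1 \<subseteq> closure (folding_orbit G x)"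
begin

sublocale seq: sequence_space \<mu>
proof -
  interpret prob_space \<mu> by (rule prob_\<mu>)
  show "sequence_space \<mu>"
    unfolding sequence_space_def product_prob_space_def product_prob_space_axioms_def product_sigma_finite_def
    using prob_\<mu> prob_space_imp_sigma_finite by blast
qed

abbreviation Seq :: "(nat \<Rightarrow> real \<times> 'a) measure" where
  "Seq \<equiv> \<Pi>\<^sub>M i\<in>(UNIV::nat set). \<mu>"

primrec iter :: "(nat \<Rightarrow> real \<times> 'a) \<Rightarrow> ('p \<Rightarrow> real) \<Rightarrow> nat \<Rightarrow> 'p \<Rightarrow> real" where
  "iter w f 0 = f"
| "iter w f (Suc n) = two_point (w n) (iter w f n)"

text \<open>The limit \<open>g\<close> may depend on \<open>w\<close>, so all subsequences and
  limits are quantified inside; the null set then depends on \<open>f\<close> alone.\<close>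

definition good :: "(nat \<Rightarrow> real \<times> 'a) \<Rightarrow> ('p \<Rightarrow> real) \<Rightarrow> bool" where
  "good w f \<longleftrightarrow> (\<forall>k g R. strict_mono (k :: nat \<Rightarrow> nat) \<longrightarrow> test R g \<longrightarrow>
     (\<forall>\<eta>>0. \<exists>n0. \<forall>n\<ge>n0. \<forall>x\<in>pts X. \<bar>iter w f (k n) x - g x\<bar> < \<eta>) \<longrightarrow> radial_decreasing g)"

lemma space_\<mu>: "space \<mu> = Omega"
  using sets_eq_imp_space_eq[OF sets_\<mu>] by (simp add: space_restrict_space)

lemma id_measurable_\<mu>: "(\<lambda>\<omega>. \<omega>) \<in> borel_measurable \<mu>"
  by (subst measurable_cong_sets[OF sets_\<mu> refl]) (rule measurable_restrict_space1, simp)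

lemma measurable_coord: "(\<lambda>w. w n) \<in> borel_measurable Seq"
  by (rule measurable_compose[OF measurable_component_singleton[of n UNIV "\<lambda>_. \<mu>"] id_measurable_\<mu>]) simp

lemma sigma_finite_m: "sigma_finite_measure m"
proof
  show "\<exists>A. countable A \<and> A \<subseteq> sets m \<and> \<Union> A = space m \<and> (\<forall>a\<in>A. emeasure m a \<noteq> \<infinity>)"
  proof (intro exI[of _ "insert (- pts X) (range (\<lambda>n::nat. gball (real n)))"] conjI ballI)
    show "\<Union> (insert (- pts X) (range (\<lambda>n::nat. gball (real n)))) = space m"
      using real_arch_simple by (auto simp: space_m gball_def)
    fix a assume "a \<in> insert (- pts X) (range (\<lambda>n::nat. gball (real n)))"
    then show "emeasure m a \<noteq> \<infinity>" using emeasure_gball m_compl by (auto simp: less_top)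
  qed (auto simp: sets_m)
qed

lemma measurable_iter:
  assumes f[measurable]: "f \<in> borel_measurable borel"
  shows "(\<lambda>(w, x). iter w f n x) \<in> borel_measurable (Seq \<Otimes>\<^sub>M borel)"
proof (induction n)
  case (Suc n)
  from measurable_two_point_Pair[OF Suc measurable_coord[of n]] show ?case by simp
qed simp

lemma measurable_gain:
  assumes F[measurable]: "(\<lambda>(w, x). F w x) \<in> borel_measurable (S \<Otimes>\<^sub>M borel)"
    and W[measurable]: "W \<in> borel_measurable S"
  shows "(\<lambda>w. gain (W w) (F w)) \<in> borel_measurable S"
proof -
  interpret sigma_finite_measure m by (rule sigma_finite_m)
  note [measurable_cong] = sets_m
  have [measurable]: "(\<lambda>(w, x). two_point (W w) (F w) x) \<in> borel_measurable (S \<Otimes>\<^sub>M borel)"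
    using measurable_two_point_Pair[OF F W] .
  show ?thesis unfolding gain_def
    by (rule borel_measurable_lebesgue_integral) measurable
qed

lemma measurable_gain_iter:
  assumes f: "f \<in> borel_measurable borel"
  shows "(\<lambda>(w, \<omega>). gain \<omega> (iter w f n)) \<in> borel_measurable (Seq \<Otimes>\<^sub>M \<mu>)"
proof -
  have "(\<lambda>(p, x). iter (fst p) f n x) \<in> borel_measurable ((Seq \<Otimes>\<^sub>M \<mu>) \<Otimes>\<^sub>M borel)"
    using measurable_compose[OF _ measurable_iter[OF f, of n], of "\<lambda>p. (fst (fst p), snd p)" "(Seq \<Otimes>\<^sub>M \<mu>) \<Otimes>\<^sub>M borel"]
    by (simp add: split_def)
  from measurable_gain[OF this measurable_compose[OF measurable_snd id_measurable_\<mu>]]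
  show ?thesis by (simp add: split_def)
qed

lemma iter_cong: "(\<And>i. i < n \<Longrightarrow> w i = w' i) \<Longrightarrow> iter w f n = iter w' f n"
  by (induction n) auto

lemma iter_test: "(\<And>i. w i \<in> valid) \<Longrightarrow> test R f \<Longrightarrow> test R (iter w f n)"
  by (induction n) (auto intro: test_two_point)

lemma iter_modulus: "(\<And>i. w i \<in> valid) \<Longrightarrow> gauge_modulus \<delta> \<eta> f \<Longrightarrow> gauge_modulus \<delta> \<eta> (iter w f n)"
  by (induction n) (auto intro: gauge_modulus_two_point valid_Omega)

lemma iter_le: "(\<And>x. f x \<le> M) \<Longrightarrow> iter w f n x \<le> M"
  by (induction n arbitrary: x) (auto simp: two_point_def min_le_iff_disj)

lemma iter_contract:
  "(\<And>i. w i \<in> valid) \<Longrightarrow> (\<And>x. x \<in> pts X \<Longrightarrow> \<bar>f x - h x\<bar> \<le> \<epsilon>) \<Longrightarrow> x \<in> pts X \<Longrightarrow>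
    \<bar>iter w f n x - iter w h n x\<bar> \<le> \<epsilon>"
  by (induction n arbitrary: x) (auto intro!: two_point_contract valid_Omega)

lemma iter_superlevel:
  assumes "\<And>i. w i \<in> valid" "test R f"
  shows "emeasure m {x \<in> pts X. t < iter w f n x} = emeasure m {x \<in> pts X. t < f x}"
  by (induction n) (simp_all add: emeasure_two_point valid_Omega assms(1) testD(1)[OF iter_test[OF assms]])

lemma AE_all_valid: "AE w in Seq. \<forall>i. w i \<in> valid"
  unfolding AE_all_countable
  by (intro allI AE_PiM_component[where P = "\<lambda>\<omega>. \<omega> \<in> valid"]) (auto simp: prob_\<mu> AE_valid)

text \<open>Independence of step \<open>n\<close> from its past: replacing the sequence from index
  \<open>n\<close> on by a fresh copy leaves its distribution unchanged.\<close>

lemma nn_integral_gain_split: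
  assumes f[measurable]: "f \<in> borel_measurable borel"
  shows "(\<integral>\<^sup>+w. (\<integral>\<^sup>+\<omega>. ennreal (gain \<omega> (iter w f n)) \<partial>\<mu>) \<partial>Seq)
       = (\<integral>\<^sup>+w. ennreal (gain (w n) (iter w f n)) \<partial>Seq)"
proof -
  interpret P: prob_space \<mu> by (rule prob_\<mu>)
  define q where "q w = ennreal (gain (w n) (iter w f n))" for w
  have q[measurable]: "q \<in> borel_measurable Seq"
    unfolding q_def[abs_def]
    using measurable_gain[OF measurable_iter[OF f, of n] measurable_coord[of n]] by measurable
  note g[measurable] = measurable_gain_iter[OF f, of n]
  have "(\<integral>\<^sup>+w. q w \<partial>Seq) = (\<integral>\<^sup>+w. q w \<partial>distr (Seq \<Otimes>\<^sub>M Seq) Seq (\<lambda>(w, w'). comb_seq n w w'))"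
    by (simp only: seq.PiM_comb_seq)
  also have "\<dots> = (\<integral>\<^sup>+p. q (case p of (w, w') \<Rightarrow> comb_seq n w w') \<partial>(Seq \<Otimes>\<^sub>M Seq))"
    by (rule nn_integral_distr) (rule measurable_comb_seq, simp)
  also have "\<dots> = (\<integral>\<^sup>+w. (\<integral>\<^sup>+w'. q (comb_seq n w w') \<partial>Seq) \<partial>Seq)"
    by (subst seq.P.nn_integral_fst[symmetric]) auto
  also have "\<dots> = (\<integral>\<^sup>+w. (\<integral>\<^sup>+\<omega>. ennreal (gain \<omega> (iter w f n)) \<partial>\<mu>) \<partial>Seq)"
  proof (rule nn_integral_cong)
    fix w assume w: "w \<in> space Seq"
    have [measurable]: "(\<lambda>\<omega>. gain \<omega> (iter w f n)) \<in> borel_measurable \<mu>"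
      using measurable_compose[OF measurable_Pair1'[OF w] g] by simp
    have "(\<integral>\<^sup>+w'. q (comb_seq n w w') \<partial>Seq) = (\<integral>\<^sup>+w'. ennreal (gain (w' 0) (iter w f n)) \<partial>Seq)"
    proof (rule nn_integral_cong)
      fix w'
      \<comment> \<open>The first \<open>n\<close> polarizations read only coordinates below
        \<open>n\<close>, all taken from \<open>w\<close>; coordinate \<open>n\<close> is already
        the first one of \<open>w'\<close>.\<close>
      have "iter (comb_seq n w w') f n = iter w f n" by (rule iter_cong) (simp add: comb_seq_less)
      then show "q (comb_seq n w w') = ennreal (gain (w' 0) (iter w f n))"
        using comb_seq_add[of n w w' 0] by (simp add: q_def)
    qed
    also have "\<dots> = (\<integral>\<^sup>+\<omega>. ennreal (gain \<omega> (iter w f n)) \<partial>distr Seq \<mu> (\<lambda>w'. w' 0))"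
      by (subst nn_integral_distr) (auto intro: measurable_component_singleton)
    also have "distr Seq \<mu> (\<lambda>w'. w' 0) = \<mu>"
      by (rule distr_PiM_component) (auto simp: prob_\<mu>)
    finally show "(\<integral>\<^sup>+w'. q (comb_seq n w w') \<partial>Seq) = (\<integral>\<^sup>+\<omega>. ennreal (gain \<omega> (iter w f n)) \<partial>\<mu>)" .
  qed
  finally show ?thesis by (simp add: q_def)
qed

lemma sum_gain: "(\<And>i. w i \<in> valid) \<Longrightarrow> test R f \<Longrightarrow> (\<Sum>n<K. gain (w n) (iter w f n)) = energy (iter w f K) - energy f"
  by (induction K) (auto simp: gain_energy[OF _ iter_test])

text \<open>The expected gains telescope into the bounded energy, so they are summable.\<close>

lemma AE_average_gain_tendsto_0:
  assumes f: "test R f"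
  shows "AE w in Seq. (\<lambda>n. \<integral>\<^sup>+\<omega>. ennreal (gain \<omega> (iter w f n)) \<partial>\<mu>) \<longlonglongrightarrow> 0"
proof -
  interpret P: prob_space \<mu> by (rule prob_\<mu>)
  have fm[measurable]: "f \<in> borel_measurable borel" using f by (rule testD)
  define Y where "Y n w = (\<integral>\<^sup>+\<omega>. ennreal (gain \<omega> (iter w f n)) \<partial>\<mu>)" for n w
  note [measurable] = measurable_gain_iter[OF fm]
  have Y[measurable]: "Y n \<in> borel_measurable Seq" for n
    unfolding Y_def[abs_def] by measurable
  have q[measurable]: "(\<lambda>w. gain (w n) (iter w f n)) \<in> borel_measurable Seq" for n
    by (rule measurable_gain[OF measurable_iter[OF fm] measurable_coord])
  obtain M where M: "0 \<le> M" "\<And>x. f x \<le> M" using test_bounded[OF f] by blast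
  let ?C = "M * measure m (gball R)"
  have "(\<integral>\<^sup>+w. (\<Sum>n. Y n w) \<partial>Seq) = (\<Sum>n. \<integral>\<^sup>+w. Y n w \<partial>Seq)"
    by (rule nn_integral_suminf) measurable
  \<comment> \<open>Only the gains of the steps actually taken telescope, so the mean gains are
    first traded for these in expectation.\<close>
  also have "\<dots> = (\<Sum>n. \<integral>\<^sup>+w. ennreal (gain (w n) (iter w f n)) \<partial>Seq)"
    unfolding Y_def by (simp add: nn_integral_gain_split[OF fm])
  also have "\<dots> = (\<integral>\<^sup>+w. (\<Sum>n. ennreal (gain (w n) (iter w f n))) \<partial>Seq)"
    by (rule nn_integral_suminf[symmetric]) measurable
  also have "\<dots> \<le> (\<integral>\<^sup>+w. ennreal ?C \<partial>Seq)"
  proof (rule nn_integral_mono_AE)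
    show "AE w in Seq. (\<Sum>n. ennreal (gain (w n) (iter w f n))) \<le> ennreal ?C"
      using AE_all_valid
    proof eventually_elim
      case (elim w)
      then have v: "\<And>i. w i \<in> valid" by blast
      have "(\<Sum>n<K. ennreal (gain (w n) (iter w f n))) \<le> ennreal ?C" for K
      proof -
        have "(\<Sum>n<K. ennreal (gain (w n) (iter w f n))) = ennreal (\<Sum>n<K. gain (w n) (iter w f n))"
          by (rule sum_ennreal) (rule gain_nonneg[OF v iter_test[OF v f]])
        also have "\<dots> = ennreal (energy (iter w f K) - energy f)" by (simp add: sum_gain[OF v f])
        also have "\<dots> \<le> ennreal ?C"
        proof (rule ennreal_leI)
          have t: "test R (iter w f K)" using v f by (rule iter_test)
          have le: "iter w f K x \<le> M" for x using M(2) by (rule iter_le)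
          show "energy (iter w f K) - energy f \<le> ?C"
            using energy_bound(2)[OF t le] energy_bound(1)[OF f M(2)] by simp
        qed
        finally show ?thesis .
      qed
      then show ?case by (intro suminf_le_const summableI)
    qed
  qed
  also have "\<dots> < \<infinity>" by (simp add: prob_space.emeasure_space_1[OF seq.P.prob_space_axioms])
  finally have "AE w in Seq. (\<Sum>n. Y n w) \<noteq> \<infinity>"
    by (intro nn_integral_PInf_AE) auto
  then show ?thesis
  proof eventually_elim
    case (elim w)
    then have fin: "Y n w < top" for n
      using ennreal_suminf_lessD[of "\<lambda>n. Y n w" top n] by (simp add: less_top)
    have "summable (\<lambda>n. enn2real (Y n w))"
      by (rule summable_suminf_not_top) (use elim fin in \<open>auto simp: \<close>)
    then have "(\<lambda>n. enn2real (Y n w)) \<longlonglongrightarrow> 0" by (rule summable_LIMSEQ_zero)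
    then have "(\<lambda>n. ennreal (enn2real (Y n w))) \<longlonglongrightarrow> ennreal 0" by (rule tendsto_ennrealI)
    then show ?case using fin by (simp add: Y_def)
  qed
qed

section \<open>Almost sure convergence\<close>

lemma closedin_sets_\<mu>: "closedin (top_of_set Omega) C \<Longrightarrow> C \<in> sets \<mu>"
proof -
  assume "closedin (top_of_set Omega) C"
  then obtain T where "closed T" "C = Omega \<inter> T" unfolding closedin_closed by blast
  then show ?thesis unfolding sets_\<mu> sets_restrict_space by (intro image_eqI[of _ _ T]) auto
qed

lemma support_subset:
  assumes C: "closedin (top_of_set Omega) C" and ae: "AE \<omega> in \<mu>. \<omega> \<in> C"
  shows "measure_support \<mu> \<subseteq> C"
proof -
  have "emeasure \<mu> C = emeasure \<mu> (space \<mu>)"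
    using ae closedin_sets_\<mu>[OF C] space_\<mu> closedin_subset[OF C]
    by (intro emeasure_eq_AE) (auto intro: closedin_sets_\<mu>)
  with C show ?thesis unfolding measure_support_def by blast
qed

text \<open>One closed condition for each \<open>x\<close>, by continuity in the parameter up to r =
  0. Closedness carries the property from almost every parameter to the points of the support that
  have measure zero.\<close>

lemma closedin_fixing:
  assumes g: "continuous_on (pts X) g"
  shows "closedin (top_of_set Omega) (fixing g)"
proof -
  have "closedin (top_of_set Omega) {\<omega> \<in> Omega. two_point \<omega> g x = g x}" if "x \<in> pts X" for x
    using continuous_closedin_preimage[OF continuous_two_point_left[OF g that], of "{g x}"]
    by (simp add: vimage_def Int_def)
  then have "closedin (top_of_set Omega) (\<Inter>x\<in>pts X. {\<omega> \<in> Omega. two_point \<omega> g x = g x})"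
    using orig_pts by (intro closedin_Inter) blast+
  also have "(\<Inter>x\<in>pts X. {\<omega> \<in> Omega. two_point \<omega> g x = g x}) = fixing g"
    unfolding fixing_def using orig_pts by blast
  finally show ?thesis .
qed

text \<open>With no foldings every orbit is a single point, while the sphere contains a vector and
  its negative.\<close>

lemma G_nonempty: "G \<noteq> {}"
proof
  assume G: "G = {}"
  obtain e :: 'a where e: "e \<in> sphere 0 1" by (rule ex_unit)
  have "folding_orbit G e = {e}" by (auto simp: folding_orbit_def G)
  then have "sphere 0 1 \<subseteq> {e}" using dense[OF e] by simp
  moreover have "- e \<in> sphere 0 1" using e by simp
  ultimately have "- e = e" by blast
  then have "- (e \<bullet> e) = e \<bullet> e" by (metis inner_minus_left)
  then show False using e by simp
qed

text \<open>If \<open>fixing g\<close> had no points with 0 < r < \<epsilon>, almost every parameter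
  would satisfy r \<ge> \<epsilon>. The support would then avoid r = 0, although \<open>G\<close> is
  nonempty.\<close>

lemma AE_fixing_imp_radial_decreasing:
  assumes g: "continuous_on (pts X) g" and ae: "AE \<omega> in \<mu>. \<omega> \<in> fixing g"
  shows "radial_decreasing g"
proof (rule fixing_imp_radial_decreasing[OF g _ dense])
  show "(0, u) \<in> fixing g" if "u \<in> G" for u
    using support_subset[OF closedin_fixing[OF g] ae] that by (auto simp: G_eq)
  fix \<epsilon> :: real assume \<epsilon>: "0 < \<epsilon>"
  show "\<exists>\<omega>\<in>fixing g. 0 < fst \<omega> \<and> fst \<omega> < \<epsilon>"
  proof (rule ccontr)
    assume none: "\<not> (\<exists>\<omega>\<in>fixing g. 0 < fst \<omega> \<and> fst \<omega> < \<epsilon>)"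
    let ?C = "{\<omega> \<in> Omega. \<epsilon> \<le> fst \<omega>}"
    have "closedin (top_of_set Omega) (Omega \<inter> fst -` {\<epsilon>..})"
      by (intro continuous_closedin_preimage continuous_intros)
    then have C: "closedin (top_of_set Omega) ?C" by (simp add: vimage_def Int_def)
    have "AE \<omega> in \<mu>. \<omega> \<in> ?C"
      using ae AE_valid by eventually_elim (use none in \<open>auto simp: valid_def not_less\<close>)
    from support_subset[OF C this] G_nonempty \<epsilon> show False by (auto simp: G_eq)
  qed
qed

text \<open>The mean gain of the limit exceeds that of a nearby iterate by at most
  \<open>2 * \<eta> * c\<close>. Letting first \<open>n\<close> and then \<open>\<eta>\<close> tend
  to its limit shows that it is zero, so almost every parameter fixes the limit.\<close>

lemma AE_good:
  assumes f: "test R f"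
  shows "AE w in Seq. good w f"
  using AE_all_valid AE_average_gain_tendsto_0[OF f]
proof eventually_elim
  case (elim w)
  then have v: "\<And>i. w i \<in> valid" by blast
  show ?case
    unfolding good_def
  proof (intro allI impI)
    fix k :: "nat \<Rightarrow> nat" and g R'
    assume k: "strict_mono k" and g: "test R' g"
      and conv: "\<forall>\<eta>>0. \<exists>n0. \<forall>n\<ge>n0. \<forall>x\<in>pts X. \<bar>iter w f (k n) x - g x\<bar> < \<eta>"
    define R'' where "R'' = max R R'"
    have g'': "test R'' g" using g by (rule test_mono) (simp add: R''_def)
    have f'': "test R'' f" using f by (rule test_mono) (simp add: R''_def)
    have F: "test R'' (iter w f n)" for n using v f'' by (rule iter_test)
    have gain_m: "(\<lambda>\<omega>. gain \<omega> h) \<in> borel_measurable \<mu>" if [measurable]: "h \<in> borel_measurable borel" for h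
      using measurable_gain[of "\<lambda>_. h" \<mu>, OF _ id_measurable_\<mu>] by simp
    note [measurable] = gain_m[OF testD(1)[OF g'']] gain_m[OF testD(1)[OF F]]
    define c where "c = measure m (gball R'')"
    have c: "0 \<le> c" by (simp add: c_def)
    have bound: "(\<integral>\<^sup>+\<omega>. ennreal (gain \<omega> g) \<partial>\<mu>) \<le> ennreal (2 * \<eta> * c)" if \<eta>: "0 < \<eta>" for \<eta>
    proof -
      obtain n0 where n0: "\<And>n x. n \<ge> n0 \<Longrightarrow> x \<in> pts X \<Longrightarrow> \<bar>iter w f (k n) x - g x\<bar> < \<eta>"
        using conv \<eta> by blast
      have le: "(\<integral>\<^sup>+\<omega>. ennreal (gain \<omega> g) \<partial>\<mu>)
          \<le> (\<integral>\<^sup>+\<omega>. ennreal (gain \<omega> (iter w f (k n))) \<partial>\<mu>) + ennreal (2 * \<eta> * c)" if n: "n \<ge> n0" for n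
      proof -
        have "(\<integral>\<^sup>+\<omega>. ennreal (gain \<omega> g) \<partial>\<mu>)
            \<le> (\<integral>\<^sup>+\<omega>. ennreal (gain \<omega> (iter w f (k n))) + ennreal (2 * \<eta> * c) \<partial>\<mu>)"
        proof (rule nn_integral_mono_AE)
          show "AE \<omega> in \<mu>. ennreal (gain \<omega> g) \<le> ennreal (gain \<omega> (iter w f (k n))) + ennreal (2 * \<eta> * c)"
            using AE_valid
          proof eventually_elim
            case (elim \<omega>)
            have "\<bar>gain \<omega> (iter w f (k n)) - gain \<omega> g\<bar> \<le> 2 * \<eta> * c"
              unfolding c_def by (rule gain_diff[OF elim F g'']) (use n0[OF n] in \<open>auto intro: less_imp_le\<close>)
            moreover have "0 \<le> gain \<omega> (iter w f (k n))" by (rule gain_nonneg[OF elim F])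
            ultimately have "ennreal (gain \<omega> g) \<le> ennreal (gain \<omega> (iter w f (k n)) + 2 * \<eta> * c)"
              by (intro ennreal_leI) linarith
            also have "\<dots> = ennreal (gain \<omega> (iter w f (k n))) + ennreal (2 * \<eta> * c)"
              using \<eta> c \<open>0 \<le> gain \<omega> (iter w f (k n))\<close> by (intro ennreal_plus) auto
            finally show ?case .
          qed
        qed
        also have "\<dots> = (\<integral>\<^sup>+\<omega>. ennreal (gain \<omega> (iter w f (k n))) \<partial>\<mu>) + ennreal (2 * \<eta> * c)"
          by (subst nn_integral_add) (auto simp: prob_space.emeasure_space_1[OF prob_\<mu>])
        finally show ?thesis .
      qed
      have "(\<lambda>n. \<integral>\<^sup>+\<omega>. ennreal (gain \<omega> (iter w f (k n))) \<partial>\<mu>) \<longlonglongrightarrow> 0"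
        using LIMSEQ_subseq_LIMSEQ[OF elim(2) k] by (simp add: comp_def)
      then have "(\<lambda>n. (\<integral>\<^sup>+\<omega>. ennreal (gain \<omega> (iter w f (k n))) \<partial>\<mu>) + ennreal (2 * \<eta> * c))
          \<longlonglongrightarrow> 0 + ennreal (2 * \<eta> * c)"
        by (intro tendsto_add tendsto_const)
      from LIMSEQ_le_const[OF this] le show ?thesis by auto
    qed
    have "(\<integral>\<^sup>+\<omega>. ennreal (gain \<omega> g) \<partial>\<mu>) \<le> 0"
    proof (rule ennreal_le_epsilon)
      \<comment> \<open>The choice \<open>\<eta> = e / (2 * c + 1)\<close> makes
        \<open>2 * \<eta> * c\<close> at most \<open>e\<close> and stays legitimate for
        \<open>c = 0\<close>.\<close>
      fix e :: real assume e: "0 < e"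
      have "(\<integral>\<^sup>+\<omega>. ennreal (gain \<omega> g) \<partial>\<mu>) \<le> ennreal (2 * (e / (2 * c + 1)) * c)"
        using e c by (intro bound) simp
      also have "\<dots> \<le> ennreal e" using e c by (intro ennreal_leI) (simp add: field_simps)
      finally show "(\<integral>\<^sup>+\<omega>. ennreal (gain \<omega> g) \<partial>\<mu>) \<le> 0 + ennreal e" by simp
    qed
    then have "AE \<omega> in \<mu>. ennreal (gain \<omega> g) = 0" by (simp add: nn_integral_0_iff_AE)
    then have "AE \<omega> in \<mu>. \<omega> \<in> fixing g"
      using AE_valid
    proof eventually_elim
      case (elim \<omega>)
      then have "gain \<omega> g = 0" using gain_nonneg[OF elim(2) g''] by (simp add: ennreal_eq_0_iff)
      then show ?case using gain_eq_0[OF elim(2) g''] valid_Omega[OF elim(2)] by (auto simp: fixing_def)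
    qed
    then show "radial_decreasing g" by (rule AE_fixing_imp_radial_decreasing[OF testD(2)[OF g]])
  qed
qed

lemma goodD:
  assumes "good w f" "strict_mono (k :: nat \<Rightarrow> nat)" "test R g"
    and "\<And>\<eta>. 0 < \<eta> \<Longrightarrow> \<exists>n0. \<forall>n\<ge>n0. \<forall>x\<in>pts X. \<bar>iter w f (k n) x - g x\<bar> < \<eta>"
  shows "radial_decreasing g"
  using assms unfolding good_def by blast

text \<open>All iterates inherit the support radius, the bound and the gauge modulus of
  \<open>f\<close>, so they are relatively compact along any index sequence
  \<open>k\<close>.\<close>

lemma iter_subsequence:
  assumes v: "\<And>i. w i \<in> valid" and f: "test R f"
  obtains k' g where "strict_mono (k' :: nat \<Rightarrow> nat)" "test R g"
    "\<And>\<eta>. 0 < \<eta> \<Longrightarrow> \<exists>n0. \<forall>n\<ge>n0. \<forall>x\<in>pts X. \<bar>iter w f (k (k' n)) x - g x\<bar> < \<eta>"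
proof -
  obtain M where M: "\<And>x. f x \<le> M" using test_bounded[OF f] by blast
  have F: "test R (iter w f (k n))" for n using v f by (rule iter_test)
  have le: "iter w f (k n) x \<le> M" for n x using M by (rule iter_le)
  have equi: "\<exists>\<delta>>0. \<forall>n. gauge_modulus \<delta> \<eta> (iter w f (k n))" if \<eta>: "0 < \<eta>" for \<eta>
  proof -
    obtain \<delta> where \<delta>: "0 < \<delta>" "gauge_modulus \<delta> \<eta> f" using test_modulus[OF f \<eta>] by blast
    have "gauge_modulus \<delta> \<eta> (iter w f (k n))" for n using v \<delta>(2) by (rule iter_modulus)
    with \<delta>(1) show ?thesis by blast
  qed
  obtain g k' where "strict_mono (k' :: nat \<Rightarrow> nat)" "test R g"
    "\<And>\<eta>. 0 < \<eta> \<Longrightarrow> \<exists>n0. \<forall>n\<ge>n0. \<forall>x\<in>pts X. \<bar>iter w f (k (k' n)) x - g x\<bar> < \<eta>"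
    by (rule Arzela_test[of R "\<lambda>n. iter w f (k n)" M, OF F le equi]) (assumption, rule that)
  then show thesis by (rule that)
qed

text \<open>Along a further subsequence the iterates of \<open>h\<close> converge too. Polarizations
  contract, so the two limits are uniformly close, and monotonicity of the limit for
  \<open>h\<close> passes to the limit for \<open>f\<close> up to an arbitrarily small
  error.\<close>

lemma good_approx:
  assumes v: "\<And>i. w i \<in> valid" and f: "test R f"
    and approx: "\<And>\<epsilon>. 0 < \<epsilon> \<Longrightarrow> \<exists>h R. test R h \<and> good w h \<and> (\<forall>x\<in>pts X. \<bar>f x - h x\<bar> \<le> \<epsilon>)"
  shows "good w f"
  unfolding good_def
proof (intro allI impI)
  fix k :: "nat \<Rightarrow> nat" and g R'
  assume k: "strict_mono k" and g: "test R' g"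
    and conv: "\<forall>\<eta>>0. \<exists>n0. \<forall>n\<ge>n0. \<forall>x\<in>pts X. \<bar>iter w f (k n) x - g x\<bar> < \<eta>"
  show "radial_decreasing g"
    unfolding radial_decreasing_def
  proof (intro ballI impI)
    fix x y assume xy: "x \<in> pts X" "y \<in> pts X" "gauge y (orig X) \<le> gauge x (orig X)"
    show "g x \<le> g y"
    proof (rule field_le_epsilon)
      fix e :: real assume "0 < e"
      \<comment> \<open>The limits differ by at most \<open>3 * \<epsilon>\<close>, and this is
        spent once at \<open>x\<close> and once at \<open>y\<close>.\<close>
      define \<epsilon> where "\<epsilon> = e / 6"
      have \<epsilon>: "0 < \<epsilon>" using \<open>0 < e\<close> by (simp add: \<epsilon>_def)
      obtain h R1 where h: "test R1 h" "good w h" "\<And>x. x \<in> pts X \<Longrightarrow> \<bar>f x - h x\<bar> \<le> \<epsilon>" using approx[OF \<epsilon>] by blast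
      obtain k' g' where k': "strict_mono (k' :: nat \<Rightarrow> nat)" "test R1 g'"
        "\<And>\<eta>. 0 < \<eta> \<Longrightarrow> \<exists>n0. \<forall>n\<ge>n0. \<forall>x\<in>pts X. \<bar>iter w h (k (k' n)) x - g' x\<bar> < \<eta>"
        by (rule iter_subsequence[where k = k and w = w and f = h, OF v h(1)]) (rule that)
      have "strict_mono (\<lambda>n. k (k' n))" using strict_mono_o[OF k k'(1)] by (simp add: comp_def)
      with h(2) have "radial_decreasing g'" using k'(2,3) by (rule goodD)
      then have "g' x \<le> g' y" using xy by (auto simp: radial_decreasing_def)
      obtain n1 where n1: "\<And>n x. n \<ge> n1 \<Longrightarrow> x \<in> pts X \<Longrightarrow> \<bar>iter w f (k n) x - g x\<bar> < \<epsilon>"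
        using conv \<epsilon> by blast
      obtain n2 where n2: "\<And>n x. n \<ge> n2 \<Longrightarrow> x \<in> pts X \<Longrightarrow> \<bar>iter w h (k (k' n)) x - g' x\<bar> < \<epsilon>"
        using k'(3)[OF \<epsilon>] by blast
      define n where "n = max n1 n2"
      have close: "\<bar>g z - g' z\<bar> \<le> 3 * \<epsilon>" if z: "z \<in> pts X" for z
      proof -
        \<comment> \<open>The convergence of the iterates of \<open>f\<close> is indexed by the
          argument of \<open>k\<close>, here \<open>k' n\<close>, which is at least
          \<open>n\<close>.\<close>
        have "n1 \<le> k' n" using seq_suble[OF k'(1), of n] by (simp add: n_def)
        then have "\<bar>iter w f (k (k' n)) z - g z\<bar> < \<epsilon>" using n1 z by blast
        moreover have "\<bar>iter w h (k (k' n)) z - g' z\<bar> < \<epsilon>" using n2[of n z] z by (simp add: n_def)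
        moreover have "\<bar>iter w f (k (k' n)) z - iter w h (k (k' n)) z\<bar> \<le> \<epsilon>"
          using v h(3) z by (rule iter_contract)
        ultimately show ?thesis by linarith
      qed
      show "g x \<le> g y + e" using close[OF xy(1)] close[OF xy(2)] \<open>g' x \<le> g' y\<close> \<epsilon>_def by linarith
    qed
  qed
qed

text \<open>A subsequence staying away from the rearrangement would itself have a uniformly
  convergent subsequence, whose limit is forced to be the rearrangement.\<close>

lemma uniform_convergence:
  assumes v: "\<And>i. w i \<in> valid" and f: "test R f" and good: "good w f" and \<epsilon>: "0 < \<epsilon>"
  shows "\<exists>n0. \<forall>n\<ge>n0. \<forall>x\<in>pts X. \<bar>iter w f n x - sym_decr_rearr X f x\<bar> < \<epsilon>"
proof (rule ccontr)
  let ?P = "\<lambda>n. \<exists>x\<in>pts X. \<epsilon> \<le> \<bar>iter w f n x - sym_decr_rearr X f x\<bar>"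
  assume "\<not> ?thesis"
  then have "\<exists>n\<ge>n0. ?P n" for n0 by (meson not_less)
  then have "infinite {n. ?P n}" by (simp add: infinite_nat_iff_unbounded_le)
  from infinite_enumerate[OF this] obtain k :: "nat \<Rightarrow> nat"
    where k: "strict_mono k" "\<And>n. ?P (k n)" by auto
  obtain k' g where k': "strict_mono (k' :: nat \<Rightarrow> nat)" "test R g"
    "\<And>\<eta>. 0 < \<eta> \<Longrightarrow> \<exists>n0. \<forall>n\<ge>n0. \<forall>x\<in>pts X. \<bar>iter w f (k (k' n)) x - g x\<bar> < \<eta>"
    by (rule iter_subsequence[where k = k and w = w and f = f, OF v f]) (rule that)
  have "strict_mono (\<lambda>n. k (k' n))" using strict_mono_o[OF k(1) k'(1)] by (simp add: comp_def)
  with good have rd: "radial_decreasing g" using k'(2,3) by (rule goodD)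
  have it: "test R (iter w f n)" for n using v f by (rule iter_test)
  have sl: "emeasure m {x \<in> pts X. t < iter w f n x} = emeasure m {x \<in> pts X. t < f x}" for t n
    using v f by (rule iter_superlevel)
  have eq: "emeasure m {x \<in> pts X. t < f x} = emeasure m {x \<in> pts X. t < g x}" for t
  proof (rule emeasure_superlevel_limit)
    fix \<eta> :: real assume "0 < \<eta>"
    from k'(3)[OF this] obtain n where "\<forall>x\<in>pts X. \<bar>iter w f (k (k' n)) x - g x\<bar> < \<eta>" by blast
    then show "\<exists>h. (\<forall>t. emeasure m {x \<in> pts X. t < h x} = emeasure m {x \<in> pts X. t < f x})
        \<and> h \<in> borel_measurable borel \<and> (\<forall>x\<in>pts X. \<bar>h x - g x\<bar> < \<eta>)"
      using sl[of _ "k (k' n)"] testD(1)[OF it, of "k (k' n)"]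
      by (intro exI[of _ "iter w f (k (k' n))"]) simp
  qed (rule testD(1)[OF f], rule testD(1)[OF k'(2)])
  have fin: "emeasure m {x \<in> pts X. t < f x} < \<infinity>" if "0 < t" for t
  proof -
    have "{x \<in> pts X. t < f x} \<subseteq> gball R" using testD(4)[OF f] that by force
    then have "emeasure m {x \<in> pts X. t < f x} \<le> emeasure m (gball R)"
      by (rule emeasure_mono) (simp add: sets_m)
    then show ?thesis using emeasure_gball by (rule le_less_trans)
  qed
  have fg: "sym_decr_rearr X f x = g x" if "x \<in> pts X" for x
    using testD(2)[OF f] testD(2)[OF k'(2)] testD(3)[OF k'(2)] rd eq fin that by (rule sym_decr_rearr_eq)
  obtain n where n: "\<And>x. x \<in> pts X \<Longrightarrow> \<bar>iter w f (k (k' n)) x - g x\<bar> < \<epsilon>" using k'(3)[OF \<epsilon>] by blast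
  obtain x where "x \<in> pts X" "\<epsilon> \<le> \<bar>iter w f (k (k' n)) x - sym_decr_rearr X f x\<bar>" using k(2) by blast
  with n[of x] fg[of x] show False by simp
qed

text \<open>On \<open>pts X\<close> a polarization reads only values on \<open>pts X\<close>, so
  \<open>f\<close> may be replaced by its extension by zero.\<close>

lemma polarizations_eq_iter:
  assumes v: "\<And>i. w i \<in> valid" and fh: "\<And>x. x \<in> pts X \<Longrightarrow> f x = h x" and x: "x \<in> pts X"
  shows "polarizations X (map w [0..<n]) f x = iter w h n x"
  using x
proof (induction n arbitrary: x)
  case (Suc n)
  have "polarizations X (map w [0..<Suc n]) f x = polarization X (w n) (polarizations X (map w [0..<n]) f) x"
    by (simp add: polarizations_def)
  also have "\<dots> = two_point (w n) (polarizations X (map w [0..<n]) f) x"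
    using v Suc.prems by (rule polarization_eq)
  also have "\<dots> = two_point (w n) (iter w h n) x"
    using valid_Omega[OF v] Suc.IH Suc.prems by (rule two_point_cong)
  finally show ?case by simp
qed (simp add: polarizations_def fh)

lemma sup_norm_tendsto_0:
  assumes "\<And>\<epsilon>. 0 < \<epsilon> \<Longrightarrow> \<exists>n0. \<forall>n\<ge>n0. \<forall>x\<in>pts X. \<bar>F n x\<bar> < \<epsilon>"
  shows "(\<lambda>n. sup_norm X (F n)) \<longlonglongrightarrow> 0"
proof (rule order_tendstoI)
  fix a :: ennreal assume "0 < a"
  then obtain z where z: "0 < z" "z < a" using dense_order_class.dense by blast
  then obtain r where r: "z = ennreal r" "0 < r" by (cases z) (auto simp: less_top[symmetric])
  obtain n0 where n0: "\<And>n x. n \<ge> n0 \<Longrightarrow> x \<in> pts X \<Longrightarrow> \<bar>F n x\<bar> < r" using assms[OF r(2)] by blast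
  have "sup_norm X (F n) \<le> z" if "n \<ge> n0" for n
    unfolding sup_norm_def r(1)
    by (intro SUP_least ennreal_leI less_imp_le n0 that)
  then show "\<forall>\<^sub>F n in sequentially. sup_norm X (F n) < a"
    using z(2) unfolding eventually_sequentially by (meson le_less_trans)
qed simp

theorem AE_polarizations_converge:
  "AE w in Seq. \<forall>f\<in>Cc_plus X.
     (\<lambda>n. sup_norm X (\<lambda>x. polarizations X (map w [0..<n]) f x - sym_decr_rearr X f x)) \<longlonglongrightarrow> 0"
proof -
  obtain \<D> :: "('p \<Rightarrow> real) set" where \<D>: "countable \<D>" "\<And>h. h \<in> \<D> \<Longrightarrow> \<exists>R. test R h"
    "\<And>R f \<epsilon>. test R f \<Longrightarrow> 0 < \<epsilon> \<Longrightarrow> \<exists>h\<in>\<D>. \<forall>x\<in>pts X. \<bar>f x - h x\<bar> \<le> \<epsilon>"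
    by (rule countable_dense_tests) blast
  \<comment> \<open>The only null sets discarded are those of the countable family and of the
    invalid parameters; the rest is deterministic for a fixed \<open>w\<close>.\<close>
  have "AE w in Seq. \<forall>h\<in>\<D>. good w h"
    using \<D>(2) AE_good by (subst AE_ball_countable[OF \<D>(1)]) blast
  with AE_all_valid show ?thesis
  proof eventually_elim
    case (elim w)
    then have v: "\<And>i. w i \<in> valid" by blast
    show ?case
    proof
      fix f assume "f \<in> Cc_plus X"
      then obtain K where K: "continuous_on (pts X) f" "\<And>x. x \<in> pts X \<Longrightarrow> 0 \<le> f x"
        "compact K" "\<And>x. x \<in> pts X \<Longrightarrow> x \<notin> K \<Longrightarrow> f x = 0"
        by (auto simp: Cc_plus_def)
      \<comment> \<open>Elements of \<open>Cc_plus\<close> are arbitrary off \<open>pts X\<close>.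
        The extension by zero is a test function with the same superlevel sets in
        \<open>pts X\<close>.\<close>
      define h where "h x = indicator (pts X) x * f x" for x
      obtain R where h: "test R h"
        using test_of_bounded_support[OF K(1,2) compact_imp_bounded[OF K(3)] K(4)] unfolding h_def by blast
      have good: "good w h"
      proof (rule good_approx[OF v h])
        fix \<epsilon> :: real assume "0 < \<epsilon>"
        then obtain h' where "h' \<in> \<D>" "\<forall>x\<in>pts X. \<bar>h x - h' x\<bar> \<le> \<epsilon>" using \<D>(3)[OF h] by blast
        then show "\<exists>h' R. test R h' \<and> good w h' \<and> (\<forall>x\<in>pts X. \<bar>h x - h' x\<bar> \<le> \<epsilon>)"
          using \<D>(2)[of h'] elim(2) by blast
      qed
      have set: "{y \<in> pts X. t < f y} = {y \<in> pts X. t < h y}" for t by (auto simp: h_def)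
      have rearr: "sym_decr_rearr X f x = sym_decr_rearr X h x" for x
        unfolding sym_decr_rearr_def set ..
      have pol: "polarizations X (map w [0..<n]) f x = iter w h n x" if "x \<in> pts X" for x n
        using v _ that by (rule polarizations_eq_iter) (simp add: h_def)
      show "(\<lambda>n. sup_norm X (\<lambda>x. polarizations X (map w [0..<n]) f x - sym_decr_rearr X f x)) \<longlonglongrightarrow> 0"
      proof (rule sup_norm_tendsto_0)
        fix \<epsilon> :: real assume "0 < \<epsilon>"
        with v h good have "\<exists>n0. \<forall>n\<ge>n0. \<forall>x\<in>pts X. \<bar>iter w h n x - sym_decr_rearr X h x\<bar> < \<epsilon>"
          by (rule uniform_convergence)
        then show "\<exists>n0. \<forall>n\<ge>n0. \<forall>x\<in>pts X.
            \<bar>polarizations X (map w [0..<n]) f x - sym_decr_rearr X f x\<bar> < \<epsilon>"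
          by (simp only: pol rearr cong: ball_cong)
      qed
    qed
  qed
qed

end

section \<open>Measures given by cones\<close>

lemma closure_curve:
  fixes \<gamma> :: "real \<Rightarrow> 'a::t2_space"
  assumes "continuous_on UNIV \<gamma>" "\<And>t. 0 < t \<Longrightarrow> t < 1 \<Longrightarrow> \<gamma> t \<in> S"
  shows "\<gamma> 0 \<in> closure S"
proof -
  have "\<gamma> ` closure {0<..<1} \<subseteq> closure S"
    using assms by (intro image_closure_subset) (auto intro: continuous_on_subset closure_subset[THEN subsetD])
  then show ?thesis by auto
qed

lemma emeasure_lborel_open:
  assumes "open W" "W \<noteq> {}"
  shows "emeasure lborel W \<noteq> 0"
proof
  assume "emeasure lborel W = 0"
  then have "W \<in> null_sets lborel" using assms(1) by (simp add: null_sets_def)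
  then have "negligible W" by (simp add: negligible_iff_null_sets null_sets_completionI)
  then show False using open_not_negligible[OF assms] by simp
qed

text \<open>Covers both curved spaces: the inner product with \<open>P\<close> the whole space, and
  the negative Minkowski form with \<open>P\<close> the open upper half-space, which selects one
  sheet.\<close>

locale quadratic_cone =
  fixes q :: "'b::euclidean_space \<Rightarrow> real" and P :: "'b set"
  assumes q_scale: "q (t *\<^sub>R x) = t\<^sup>2 * q x"
    and q_cont: "continuous_on UNIV q"
    and P_open: "open P"
    and P_scale: "0 < t \<Longrightarrow> x \<in> P \<Longrightarrow> t *\<^sub>R x \<in> P"
begin

definition level :: "'b set" where "level = {x \<in> P. q x = 1}"
definition cone :: "'b set" where "cone = {y \<in> P. 0 < q y \<and> q y \<le> 1}"
definition proj :: "'b \<Rightarrow> 'b" where "proj y = (1 / sqrt (q y)) *\<^sub>R y"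

text \<open>Radial projection of Lebesgue measure from the solid cone to the level surface. It is a
  Borel measure on the ambient space and agrees with \<open>cone_vol\<close> on Borel subsets of the
  surface.\<close>

definition cone_measure :: "ennreal \<Rightarrow> 'b measure" where
  "cone_measure k = distr (density lborel (\<lambda>y. k * indicator cone y)) borel proj"

lemma q_borel[measurable]: "q \<in> borel_measurable borel"
  using q_cont by (rule borel_measurable_continuous_onI)

lemma P_borel[measurable]: "P \<in> sets borel"
  using P_open by (rule borel_open)

lemma cone_borel[measurable]: "cone \<in> sets borel"
  unfolding cone_def by measurable

lemma proj_borel[measurable]: "proj \<in> borel_measurable borel"
  unfolding proj_def[abs_def] by measurable

lemma sets_cone_measure: "sets (cone_measure k) = sets borel"
  by (simp add: cone_measure_def)

lemma emeasure_cone_measure: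
  assumes [measurable]: "A \<in> sets borel"
  shows "emeasure (cone_measure k) A = k * emeasure lborel (cone \<inter> proj -` A)"
proof -
  have A': "proj -` A \<in> sets borel" using measurable_sets[OF proj_borel assms] by simp
  then have "emeasure (cone_measure k) A = (\<integral>\<^sup>+y. k * indicator cone y * indicator (proj -` A) y \<partial>lborel)"
    by (simp add: cone_measure_def emeasure_distr emeasure_density)
  also have "\<dots> = (\<integral>\<^sup>+y. k * indicator (cone \<inter> proj -` A) y \<partial>lborel)"
    by (intro nn_integral_cong) (simp split: split_indicator)
  also have "\<dots> = k * emeasure lborel (cone \<inter> proj -` A)"
    using A' by (intro nn_integral_cmult_indicator) auto
  finally show ?thesis .
qed

lemma proj_scale: "0 < t \<Longrightarrow> x \<in> level \<Longrightarrow> proj (t *\<^sub>R x) = x"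
  by (simp add: proj_def q_scale level_def)

lemma proj_level: "y \<in> cone \<Longrightarrow> proj y \<in> level"
  by (auto simp: proj_def level_def cone_def q_scale power_divide intro!: P_scale)

text \<open>Turns the set in the definition of \<open>cone_vol\<close> into a preimage, which makes
  it measurable.\<close>

lemma cone_over:
  assumes "A \<subseteq> level"
  shows "{t *\<^sub>R x | t x. 0 < t \<and> t \<le> 1 \<and> x \<in> A} = cone \<inter> proj -` A"
proof (intro set_eqI iffI)
  fix y assume "y \<in> {t *\<^sub>R x | t x. 0 < t \<and> t \<le> 1 \<and> x \<in> A}"
  then obtain t x where y: "y = t *\<^sub>R x" "0 < t" "t \<le> 1" "x \<in> A" by blast
  then have "x \<in> level" using assms by auto
  moreover have "t\<^sup>2 \<le> 1" using y by (simp add: abs_square_le_1)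
  ultimately show "y \<in> cone \<inter> proj -` A"
    using y proj_scale[of t x] P_scale[of t x] by (simp add: cone_def q_scale level_def)
next
  fix y assume y: "y \<in> cone \<inter> proj -` A"
  then have "0 < sqrt (q y)" "sqrt (q y) \<le> 1" by (auto simp: cone_def)
  moreover from this have "y = sqrt (q y) *\<^sub>R proj y" by (simp add: proj_def)
  ultimately show "y \<in> {t *\<^sub>R x | t x. 0 < t \<and> t \<le> 1 \<and> x \<in> A}" using y by blast
qed

lemma cone_measure_compl: "emeasure (cone_measure k) (- level) = 0"
proof -
  have "level \<in> sets borel" unfolding level_def by measurable
  moreover have "cone \<inter> proj -` (- level) = {}" using proj_level by auto
  ultimately show ?thesis by (simp only: emeasure_cone_measure sets.compl_sets borel_comp) simp
qed

lemma cone_measure_pos: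
  assumes U: "open U" "U \<inter> level \<noteq> {}" and k: "k \<noteq> 0"
  shows "emeasure (cone_measure k) U \<noteq> 0"
proof -
  obtain x where x: "x \<in> U" "x \<in> level" using U(2) by blast
  let ?V = "{y \<in> P. 0 < q y \<and> q y < 1}"
  have V: "open ?V"
    using P_open open_Collect_less[OF continuous_on_const q_cont, of 0] open_Collect_less[OF q_cont continuous_on_const, of 1]
    by (simp add: Collect_conj_eq open_Int)
  have "continuous_on ?V proj"
    unfolding proj_def[abs_def]
    by (intro continuous_intros continuous_on_subset[OF q_cont]) auto
  then have W: "open (?V \<inter> proj -` U)" using V U(1) by (simp add: continuous_open_preimage)
  \<comment> \<open>The level surface bounds the cone, so \<open>x\<close> is halved to reach the
    interior.\<close>
  have "(1 / 2) *\<^sub>R x \<in> ?V"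
    using x(2) P_scale[of "1 / 2" x] by (simp add: level_def q_scale power_divide)
  moreover have "proj ((1 / 2) *\<^sub>R x) = x" using x(2) by (intro proj_scale) auto
  ultimately have ne: "?V \<inter> proj -` U \<noteq> {}" using x(1) by auto
  have "0 < emeasure lborel (?V \<inter> proj -` U)"
    using emeasure_lborel_open[OF W ne] by (simp add: zero_less_iff_neq_zero)
  also have "\<dots> \<le> emeasure lborel (cone \<inter> proj -` U)"
    using U(1) measurable_sets[OF proj_borel, of U] by (intro emeasure_mono) (auto simp: cone_def)
  finally show ?thesis using k U(1) by (simp add: emeasure_cone_measure)
qed

lemma cone_measure_finite:
  assumes "A \<in> sets borel" "A \<subseteq> level" "bounded A" "k < \<infinity>"
  shows "emeasure (cone_measure k) A < \<infinity>"
proof -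
  obtain B where B: "\<And>x. x \<in> A \<Longrightarrow> norm x \<le> B" using assms(3) bounded_iff by blast
  have "bounded (cone \<inter> proj -` A)"
    unfolding cone_over[OF assms(2), symmetric] bounded_iff
  proof (intro exI[of _ B] ballI)
    fix y assume "y \<in> {t *\<^sub>R x | t x. 0 < t \<and> t \<le> 1 \<and> x \<in> A}"
    then obtain t x where y: "y = t *\<^sub>R x" "0 < t" "t \<le> 1" "x \<in> A" by blast
    then have "norm y \<le> norm x" by (simp add: mult_left_le_one_le)
    then show "norm y \<le> B" using B[OF y(4)] by simp
  qed
  then show ?thesis
    using emeasure_bounded_finite[of "cone \<inter> proj -` A"] assms(1,4)
    by (simp add: emeasure_cone_measure ennreal_mult_less_top)
qed

text \<open>A linear map that preserves \<open>q\<close> commutes with the projection and maps the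
  cone to itself. Invariance of \<open>P\<close> is asked only where \<open>q\<close> is positive,
  since a hyperbolic reflection may move other vectors out of the upper half-space.\<close>

lemma cone_measure_invariant:
  assumes lin: "linear f" and inv: "\<And>x. f (f x) = x"
    and q: "\<And>x. q (f x) = q x" and P: "\<And>x. x \<in> P \<Longrightarrow> 0 < q x \<Longrightarrow> f x \<in> P"
  shows "distr (cone_measure k) borel f = cone_measure k"
proof (rule measure_eqI)
  fix A assume "A \<in> sets (distr (cone_measure k) borel f)"
  then have A[measurable]: "A \<in> sets borel" by simp
  have f[measurable]: "f \<in> borel_measurable borel"
    using lin by (intro borel_measurable_continuous_onI) (simp add: linear_continuous_on linear_conv_bounded_linear)
  have fA: "f -` A \<in> sets borel" using measurable_sets[OF f A] by simp
  have A': "proj -` A \<in> sets borel" using measurable_sets[OF proj_borel A] by simp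
  have cone: "f x \<in> cone \<longleftrightarrow> x \<in> cone" for x
    using P[of x] P[of "f x"] by (auto simp: cone_def q inv)
  have proj: "proj (f x) = f (proj x)" for x
    using lin by (simp add: proj_def q linear_scale)
  have eq: "cone \<inter> proj -` (f -` A) = f -` (cone \<inter> proj -` A)"
    by (auto simp: cone proj)
  have "emeasure (distr (cone_measure k) borel f) A = emeasure (cone_measure k) (f -` A)"
    by (subst emeasure_distr)
      (auto simp: cone_measure_def)
  also have "\<dots> = k * emeasure lborel (f -` (cone \<inter> proj -` A))"
    by (simp add: emeasure_cone_measure[OF fA] eq)
  also have "emeasure lborel (f -` (cone \<inter> proj -` A)) = emeasure (distr lborel borel f) (cone \<inter> proj -` A)"
    using A' by (subst emeasure_distr) auto
  also have "\<dots> = emeasure lborel (cone \<inter> proj -` A)"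
    by (simp only: lborel_distr_linear_involution[OF lin inv])
  finally show "emeasure (distr (cone_measure k) borel f) A = emeasure (cone_measure k) A"
    by (simp add: emeasure_cone_measure)
qed (simp add: sets_cone_measure)

end

section \<open>Euclidean space\<close>

lemma euclidean_form_simps [simp]:
  "pts euclidean_form = UNIV" "dst euclidean_form = dist" "vol euclidean_form = emeasure lborel"
  "orig euclidean_form = 0" "polar euclidean_form = (\<lambda>r u. r *\<^sub>R u)"
  by (simp_all add: euclidean_form_def)

lemma inner_mirror_unit:
  fixes u :: "'a::real_inner"
  assumes "norm u = 1"
  shows "linear (\<lambda>x. x - (2 * (x \<bullet> u)) *\<^sub>R u)"
    and "(x - (2 * (x \<bullet> u)) *\<^sub>R u) - (2 * ((x - (2 * (x \<bullet> u)) *\<^sub>R u) \<bullet> u)) *\<^sub>R u = x"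
proof -
  have u: "u \<bullet> u = 1" using assms by (simp add: norm_eq_1)
  show "linear (\<lambda>x. x - (2 * (x \<bullet> u)) *\<^sub>R u)"
    by (rule linearI) (simp_all add: inner_add_left algebra_simps)
  show "(x - (2 * (x \<bullet> u)) *\<^sub>R u) - (2 * ((x - (2 * (x \<bullet> u)) *\<^sub>R u) \<bullet> u)) *\<^sub>R u = x"
    by (simp add: inner_diff_left u)
qed

text \<open>Moving \<open>p\<close> within the hyperplane by \<open>w\<close>, the part of
  \<open>y - x\<close> parallel to it, shows that \<open>w\<close> is orthogonal to
  \<open>y - x\<close>, so \<open>w = 0\<close>. Then \<open>x\<close> and \<open>y\<close> lie on
  one normal line, on the same side and equally far from the wall.\<close>

lemma euclidean_separation:
  fixes u x y :: "'a::real_inner"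
  assumes u: "norm u = 1" and hx: "x \<bullet> u < c" and hy: "y \<bullet> u < c"
    and eq: "\<And>p. p \<bullet> u = c \<Longrightarrow> (p - x) \<bullet> (p - x) = (p - y) \<bullet> (p - y)"
  shows "x = y"
proof -
  have uu: "u \<bullet> u = 1" using u by (simp add: norm_eq_1)
  define w where "w = (y - x) - ((y - x) \<bullet> u) *\<^sub>R u"
  define p where "p = x + (c - x \<bullet> u) *\<^sub>R u"
  have w: "w \<bullet> u = 0" by (simp add: w_def inner_diff_left uu)
  have p: "p \<bullet> u = c" by (simp add: p_def inner_add_left uu)
  have e1: "(p - x) \<bullet> (p - x) = (p - y) \<bullet> (p - y)" using p by (rule eq)
  have e2: "(p + w - x) \<bullet> (p + w - x) = (p + w - y) \<bullet> (p + w - y)"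
    using p w by (intro eq) (simp add: inner_add_left)
  have "2 * (w \<bullet> (y - x)) = 0"
    using e1 e2 by (simp add: inner_diff_left inner_diff_right inner_add_left inner_add_right inner_commute)
  then have "w \<bullet> (w + ((y - x) \<bullet> u) *\<^sub>R u) = 0" by (simp add: w_def)
  then have "w \<bullet> w = 0" by (simp add: inner_add_right w)
  then have "w = 0" by simp
  then have "y - x = ((y - x) \<bullet> u) *\<^sub>R u" by (simp add: w_def)
  then obtain k where k: "y = x + k *\<^sub>R u" by (metis add.commute diff_add_cancel)
  have "p - x = (c - x \<bullet> u) *\<^sub>R u" "p - y = (c - x \<bullet> u - k) *\<^sub>R u"
    by (simp_all add: p_def k algebra_simps)
  then have "(c - x \<bullet> u)\<^sup>2 = (c - x \<bullet> u - k)\<^sup>2" using e1 by (simp add: uu power2_eq_square)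
  moreover have "0 < c - x \<bullet> u - k" using hy by (simp add: k inner_add_left uu)
  ultimately have "k = 0" using hx by (auto simp: power2_eq_iff)
  then show ?thesis by (simp add: k)
qed

text \<open>The mirror between 0 and \<open>r u\<close> is the hyperplane at signed distance
  \<open>r / 2\<close> along \<open>u\<close>.\<close>

lemma euclidean_polar_model:
  "polar_model (euclidean_form :: ('a::euclidean_space, 'a) space_form) (\<bullet>) snd (\<lambda>\<omega>. fst \<omega> / 2) {0..} lborel"
proof (rule polar_model.intro)
  let ?X = "euclidean_form :: ('a, 'a) space_form"
  show "bounded_bilinear ((\<bullet>) :: 'a \<Rightarrow> 'a \<Rightarrow> real)" by (rule bounded_bilinear_inner)
  show "0 \<le> (x - y) \<bullet> (x - y)" for x y :: 'a by simp
  show "x = y" if "(x - y) \<bullet> (x - y) = 0" for x y :: 'a using that by simp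
  show "polar ?X t (- u) \<bullet> snd (r, u) \<le> fst (r, u) / 2 \<and>
      polar ?X t (- u) - (2 * (polar ?X t (- u) \<bullet> snd (r, u) - fst (r, u) / 2)) *\<^sub>R snd (r, u)
        = polar ?X (t + r) u" if "0 \<le> t" "0 < r" "u \<in> sphere 0 1" for t r and u :: 'a
    using that by (simp add: norm_eq_1 scaleR_left_distrib scaleR_left_diff_distrib)
      (simp add: scaleR_left_diff_distrib[symmetric])
  show "bounded {x \<in> pts ?X. (x - orig ?X) \<bullet> (x - orig ?X) \<le> R}" for R :: real
  proof -
    have "norm x \<le> sqrt R" if "x \<bullet> x \<le> R" for x :: 'a
      using that by (simp add: norm_eq_sqrt_inner)
    then show ?thesis by (auto simp: bounded_iff intro!: exI[of _ "sqrt R"])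
  qed
  then show "emeasure lborel {x \<in> pts ?X. (x - orig ?X) \<bullet> (x - orig ?X) \<le> R} < \<infinity>" for R :: real
    by (rule emeasure_bounded_finite)
  show "dst ?X x y \<le> dst ?X x' y' \<longleftrightarrow> (x - y) \<bullet> (x - y) \<le> (x' - y') \<bullet> (x' - y')" for x y x' y' :: 'a
    by (simp add: dist_norm norm_le)
  show "\<exists>R'. \<forall>x\<in>pts ?X. \<forall>y\<in>pts ?X.
      (x - orig ?X) \<bullet> (x - orig ?X) \<le> R \<longrightarrow> (x - y) \<bullet> (x - y) \<le> 1 \<longrightarrow>
      (y - orig ?X) \<bullet> (y - orig ?X) \<le> R'" for R :: real
  proof (intro exI[of _ "(sqrt R + 1)\<^sup>2"] ballI impI)
    fix x y :: 'a
    assume "(x - orig ?X) \<bullet> (x - orig ?X) \<le> R" "(x - y) \<bullet> (x - y) \<le> 1"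
    then have "norm x \<le> sqrt R" "norm (x - y) \<le> 1" by (simp_all add: norm_eq_sqrt_inner)
    moreover have "norm y \<le> norm x + norm (x - y)"
      using norm_triangle_ineq4[of x "x - y"] by simp
    ultimately have "norm y \<le> sqrt R + 1" by linarith
    then have "(norm y)\<^sup>2 \<le> (sqrt R + 1)\<^sup>2" by (rule power_mono) simp
    then show "(y - orig ?X) \<bullet> (y - orig ?X) \<le> (sqrt R + 1)\<^sup>2"
      by (simp add: power2_norm_eq_inner)
  qed
  show "x \<in> closure {y \<in> pts ?X. y \<bullet> snd \<omega> < fst \<omega> / 2}"
    if "\<omega> \<in> Omega" "x \<bullet> snd \<omega> = fst \<omega> / 2" for x :: 'a and \<omega>
  proof -
    have c: "continuous_on UNIV (\<lambda>t. x - t *\<^sub>R snd \<omega>)" by (intro continuous_intros)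
    have "(x - t *\<^sub>R snd \<omega>) \<bullet> snd \<omega> < fst \<omega> / 2" if "0 < t" for t
      using that \<open>\<omega> \<in> Omega\<close> \<open>x \<bullet> snd \<omega> = fst \<omega> / 2\<close>
      by (auto simp: inner_diff_left norm_eq_1 Omega_def)
    then show ?thesis
      using closure_curve[OF c, of "{y \<in> pts ?X. y \<bullet> snd \<omega> < fst \<omega> / 2}"] by simp
  qed
  show "x = y" if "\<omega> \<in> Omega" "x \<bullet> snd \<omega> < fst \<omega> / 2" "y \<bullet> snd \<omega> < fst \<omega> / 2"
    "\<And>p. p \<in> pts ?X \<Longrightarrow> p \<bullet> snd \<omega> = fst \<omega> / 2 \<Longrightarrow> (p - x) \<bullet> (p - x) = (p - y) \<bullet> (p - y)"
    for x y :: 'a and \<omega>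
    using that by (intro euclidean_separation[of "snd \<omega>" x "fst \<omega> / 2" y]) (auto simp: Omega_def)
  show "\<exists>r\<in>{0..}. \<exists>u\<in>sphere 0 1. x = polar ?X r u" for x :: 'a
  proof (cases "x = 0")
    case True
    obtain e :: 'a where "e \<in> Basis" using nonempty_Basis by blast
    with True show ?thesis by (intro bexI[of _ 0] bexI[of _ e]) auto
  next
    case False
    then show ?thesis by (intro bexI[of _ "norm x"] bexI[of _ "(1 / norm x) *\<^sub>R x"]) auto
  qed
  show "distr lborel borel (\<lambda>x. x - (2 * (x \<bullet> snd \<omega> - fst \<omega> / 2)) *\<^sub>R snd \<omega>) = lborel"
    if "\<omega> \<in> Omega" for \<omega> :: "real \<times> 'a"
  proof -
    have u: "norm (snd \<omega>) = 1" using that by (auto simp: Omega_def)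
    let ?f = "\<lambda>x. x - (2 * (x \<bullet> snd \<omega>)) *\<^sub>R snd \<omega>"
    \<comment> \<open>The affine reflection is the linear one followed by the translation by
      \<open>r u\<close>.\<close>
    have "(\<lambda>x. x - (2 * (x \<bullet> snd \<omega> - fst \<omega> / 2)) *\<^sub>R snd \<omega>) = (+) (fst \<omega> *\<^sub>R snd \<omega>) \<circ> ?f"
      by (auto simp: algebra_simps)
    moreover have "distr lborel borel ((+) (fst \<omega> *\<^sub>R snd \<omega>) \<circ> ?f) = distr (distr lborel borel ?f) borel ((+) (fst \<omega> *\<^sub>R snd \<omega>))"
      by (subst distr_distr) auto
    moreover have "distr lborel borel ?f = lborel"
      using inner_mirror_unit[OF u] by (intro lborel_distr_linear_involution)
    ultimately show ?thesis by (simp add: lborel_distr_plus)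
  qed
  show "emeasure lborel U \<noteq> 0" if "open U" "U \<inter> pts ?X \<noteq> {}" for U :: "'a set"
    using that by (intro emeasure_lborel_open) auto
  show "(\<exists>r\<in>{0..}. s < r \<and> r < t) \<or> emeasure lborel (orig_ball ?X s) = emeasure lborel (pts ?X)"
    if "0 \<le> s" "s < t" for s t :: real
    using dense[OF that(2)] that(1) by auto
qed (auto simp: inner_commute Omega_def norm_eq_1 dist_norm split_def algebra_simps
    intro!: continuous_intros)

section \<open>The sphere\<close>

lemma spherical_form_simps [simp]:
  "pts spherical_form = sphere 0 1" "dst spherical_form = (\<lambda>x y. arccos (x \<bullet> y))" "vol spherical_form = cone_vol"
  "orig spherical_form = (0, 1)" "polar spherical_form = (\<lambda>r u. (sin r *\<^sub>R u, cos r))"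
  by (simp_all add: spherical_form_def)

text \<open>The chord from the origin to its image is \<open>(sin r u, cos r - 1)\<close>, which is
  \<open>2 sin (r / 2)\<close> times this vector. Cancelling that factor makes the formula
  continuous at r = 0.\<close>

definition spherical_normal :: "real \<times> 'a::euclidean_space \<Rightarrow> 'a \<times> real" where
  "spherical_normal \<omega> = (cos (fst \<omega> / 2) *\<^sub>R snd \<omega>, - sin (fst \<omega> / 2))"

lemma quadratic_cone_spherical: "quadratic_cone (\<lambda>x. x \<bullet> x) (UNIV :: ('a::euclidean_space \<times> real) set)"
  by standard (auto simp: power2_eq_square intro!: continuous_intros)

interpretation spherical: quadratic_cone "\<lambda>x. x \<bullet> x" "UNIV :: ('a::euclidean_space \<times> real) set"
  by (rule quadratic_cone_spherical)

abbreviation spherical_measure :: "('a::euclidean_space \<times> real) measure" where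
  "spherical_measure \<equiv> spherical.cone_measure (ennreal (real (DIM('a) + 1)))"

lemma spherical_level: "spherical.level = sphere 0 1"
  by (auto simp: spherical.level_def norm_eq_1)

lemma norm_spherical_normal: "\<omega> \<in> Omega \<Longrightarrow> norm (spherical_normal \<omega>) = 1"
  by (auto simp: spherical_normal_def Omega_def norm_Pair power_mult_distrib)

lemma gauge_sphere:
  assumes "x \<in> sphere 0 1" "y \<in> sphere 0 1"
  shows "(x - y) \<bullet> (x - y) = 2 - 2 * (x \<bullet> y)" "\<bar>x \<bullet> y\<bar> \<le> 1"
proof -
  show "(x - y) \<bullet> (x - y) = 2 - 2 * (x \<bullet> y)"
    using assms by (simp add: inner_diff_left inner_diff_right inner_commute[of y x] norm_eq_1)
  show "\<bar>x \<bullet> y\<bar> \<le> 1" using assms Cauchy_Schwarz_ineq2[of x y] by simp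
qed

text \<open>The normalized part of \<open>y - x\<close> orthogonal to \<open>n\<close> would itself
  be a point of the wall, and \<open>eq\<close> makes it orthogonal to \<open>y - x\<close>. So
  \<open>y\<close> lies on the line through \<open>x\<close> along \<open>n\<close>, which meets the
  sphere only once on each side.\<close>

lemma spherical_separation:
  fixes n x y :: "'a::real_inner"
  assumes n: "norm n = 1" and x: "norm x = 1" "x \<bullet> n < 0" and y: "norm y = 1" "y \<bullet> n < 0"
    and eq: "\<And>p. norm p = 1 \<Longrightarrow> p \<bullet> n = 0 \<Longrightarrow> p \<bullet> x = p \<bullet> y"
  shows "x = y"
proof -
  have nn: "n \<bullet> n = 1" using n by (simp add: norm_eq_1)
  define w where "w = (y - x) - ((y - x) \<bullet> n) *\<^sub>R n"
  have wn: "w \<bullet> n = 0" by (simp add: w_def inner_diff_left nn)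
  have "w = 0"
  proof (rule ccontr)
    assume "w \<noteq> 0"
    define p where "p = (1 / norm w) *\<^sub>R w"
    have "norm p = 1" "p \<bullet> n = 0" using \<open>w \<noteq> 0\<close> wn by (simp_all add: p_def)
    then have "p \<bullet> (y - x) = 0" using eq by (simp add: inner_diff_right)
    then have "w \<bullet> (y - x) = 0" using \<open>w \<noteq> 0\<close> by (simp add: p_def)
    then have "w \<bullet> (w + ((y - x) \<bullet> n) *\<^sub>R n) = 0" by (simp add: w_def)
    then have "w \<bullet> w = 0" by (simp add: inner_add_right wn)
    then show False using \<open>w \<noteq> 0\<close> by simp
  qed
  then have "y - x = ((y - x) \<bullet> n) *\<^sub>R n" by (simp add: w_def)
  then obtain k where k: "y = x + k *\<^sub>R n" by (metis add.commute diff_add_cancel)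
  have "y \<bullet> y = x \<bullet> x + k * (2 * (x \<bullet> n) + k)"
    by (simp add: k inner_add_left inner_add_right nn inner_commute[of n x] algebra_simps)
  then have "k * (2 * (x \<bullet> n) + k) = 0" using x y by (simp add: norm_eq_1)
  moreover have "x \<bullet> n + k < 0" using y by (simp add: k inner_add_left nn)
  ultimately have "k = 0" using x(2) by auto
  then show ?thesis by (simp add: k)
qed

text \<open>The cone over the antipode of the origin lies in a hyperplane.\<close>

lemma spherical_ball_pi_null: "emeasure spherical_measure {(0::'a::euclidean_space, -1)} = 0"
proof -
  obtain e :: 'a where e: "e \<in> Basis" using nonempty_Basis by blast
  let ?N = "{y. (e, 0::real) \<bullet> y = 0}"
  have "negligible ?N" using e by (intro negligible_hyperplane) (auto simp: zero_prod_def)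
  moreover have N: "?N \<in> sets borel"
    by (intro borel_closed closed_hyperplane)
  ultimately have "emeasure lborel ?N = 0"
    by (simp add: negligible_iff_emeasure0)
  moreover have "spherical.cone \<inter> spherical.proj -` {(0::'a, -1)} \<subseteq> ?N"
    by (auto simp: spherical.proj_def spherical.cone_def zero_prod_def)
  then have "emeasure lborel (spherical.cone \<inter> spherical.proj -` {(0::'a, -1)}) \<le> emeasure lborel ?N"
    using N by (intro emeasure_mono) auto
  ultimately show ?thesis by (simp add: spherical.emeasure_cone_measure)
qed

lemma spherical_polar_surj:
  assumes "x \<in> sphere (0 :: 'a::euclidean_space \<times> real) 1"
  shows "\<exists>r\<in>{0..pi}. \<exists>u\<in>sphere 0 1. x = (sin r *\<^sub>R u, cos r)"
proof -
  obtain v s where x: "x = (v, s)" by (cases x)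
  have 1: "(norm v)\<^sup>2 + s\<^sup>2 = 1" using assms by (simp add: x norm_Pair)
  then have "s\<^sup>2 \<le> 1" using zero_le_power2[of "norm v"] by linarith
  then have s: "- 1 \<le> s" "s \<le> 1" by (auto simp: abs_square_le_1 abs_le_iff)
  have r: "arccos s \<in> {0..pi}" "cos (arccos s) = s" using s arccos_bounded by auto
  have "sin (arccos s) = sqrt (1 - s\<^sup>2)" using s by (intro sin_arccos_abs) auto
  also have "1 - s\<^sup>2 = (norm v)\<^sup>2" using 1 by simp
  finally have sin: "sin (arccos s) = norm v" by simp
  obtain e :: 'a where e: "e \<in> Basis" using nonempty_Basis by blast
  show ?thesis
  proof (cases "v = 0")
    case True
    then show ?thesis using r sin e by (intro bexI[of _ "arccos s"] bexI[of _ e]) (auto simp: x)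
  next
    case False
    then show ?thesis using r sin
      by (intro bexI[of _ "arccos s"] bexI[of _ "(1 / norm v) *\<^sub>R v"]) (auto simp: x)
  qed
qed

text \<open>On the great circle through the origin and \<open>u\<close> the mirror sits at angle
  \<open>r / 2\<close>, so angle \<open>-t\<close> goes to \<open>t + r\<close>. The addition
  theorems are expanded around \<open>t + r / 2\<close>, halfway between \<open>t\<close> and
  \<open>t + r\<close>.\<close>

lemma spherical_mirror_shift:
  fixes u :: "'a::euclidean_space" and t r :: real
  assumes u: "norm u = 1"
  defines "x \<equiv> (sin t *\<^sub>R (- u), cos t)" and "n \<equiv> spherical_normal (r, u)"
  shows "x \<bullet> n = - sin (t + r / 2)" "x - (2 * (x \<bullet> n)) *\<^sub>R n = (sin (t + r) *\<^sub>R u, cos (t + r))"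
proof -
  have uu: "u \<bullet> u = 1" using u by (simp add: norm_eq_1)
  show xn: "x \<bullet> n = - sin (t + r / 2)"
    by (simp add: x_def n_def spherical_normal_def uu sin_add)
  have A: "sin (t + r) = sin ((t + r / 2) + r / 2)" "cos (t + r) = cos ((t + r / 2) + r / 2)"
    "sin t = sin ((t + r / 2) - r / 2)" "cos t = cos ((t + r / 2) - r / 2)" by (simp_all add: add.commute)
  have s: "2 * sin (t + r / 2) * cos (r / 2) - sin t = sin (t + r)"
    unfolding A sin_add[of "t + r / 2" "r / 2"] sin_diff[of "t + r / 2" "r / 2"] by simp
  have c: "cos t - 2 * sin (t + r / 2) * sin (r / 2) = cos (t + r)"
    unfolding A cos_add[of "t + r / 2" "r / 2"] cos_diff[of "t + r / 2" "r / 2"] by simp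
  show "x - (2 * (x \<bullet> n)) *\<^sub>R n = (sin (t + r) *\<^sub>R u, cos (t + r))"
    unfolding xn unfolding x_def n_def spherical_normal_def
    by (simp add: s[symmetric] c[symmetric] scaleR_left_diff_distrib)
qed

text \<open>From radius pi on the ball can miss only the antipode of the origin, a null set.\<close>

lemma orig_ball_spherical_pi:
  assumes "pi \<le> s"
  shows "emeasure spherical_measure (orig_ball (spherical_form :: ('a::euclidean_space \<times> real, 'a) space_form) s)
    = emeasure spherical_measure (pts (spherical_form :: ('a \<times> real, 'a) space_form))"
proof (rule antisym)
  let ?X = "spherical_form :: ('a \<times> real, 'a) space_form"
  let ?A = "{(0::'a, - 1 :: real)}"
  have sub: "x \<in> orig_ball ?X s \<union> ?A" if x: "x \<in> sphere 0 1" for x :: "'a \<times> real"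
  proof -
    obtain r u where ru: "r \<in> {0..pi}" "norm u = 1" "x = (sin r *\<^sub>R u, cos r)"
      using spherical_polar_surj[OF x] by auto
    show ?thesis
    proof (cases "r = pi")
      case False
      then have "arccos (x \<bullet> (0, 1)) < s" using ru assms by (simp add: arccos_cos)
      then show ?thesis using x by (simp add: orig_ball_def)
    qed (simp add: ru)
  qed
  have open_ball: "orig_ball ?X s \<in> sets (borel :: ('a \<times> real) measure)"
  proof -
    \<comment> \<open>Clamping the last coordinate to the interval from -1 to 1 makes the arccosine
      continuous on the whole ambient space without changing it on the sphere.\<close>
    have "orig_ball ?X s = {x \<in> sphere (0 :: 'a \<times> real) 1. arccos (min 1 (max (- 1) (snd x))) < s}"
    proof -
      have "min 1 (max (- 1) (snd x)) = snd x" if "norm x = 1" for x :: "'a \<times> real"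
      proof -
        have "\<bar>snd x\<bar> \<le> 1" using norm_snd_le[where x = "fst x" and y = "snd x"] that by simp
        then show ?thesis by (simp add: abs_le_iff max_absorb2 min_absorb2)
      qed
      then show ?thesis by (force simp: orig_ball_def inner_prod_def)
    qed
    also have "\<dots> \<in> sets borel"
    proof -
      have "continuous_on UNIV (\<lambda>x :: 'a \<times> real. arccos (min 1 (max (- 1) (snd x))))"
        by (intro continuous_intros) auto
      then have [measurable]: "(\<lambda>x :: 'a \<times> real. arccos (min 1 (max (- 1) (snd x)))) \<in> borel_measurable borel"
        by (rule borel_measurable_continuous_onI)
      have "sphere (0 :: 'a \<times> real) 1 \<in> sets borel" by (rule borel_closed) simp
      then show ?thesis by measurable
    qed
    finally show ?thesis .
  qed
  have "emeasure spherical_measure (pts ?X)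
      \<le> emeasure spherical_measure (orig_ball ?X s \<union> ?A)"
  proof (rule emeasure_mono)
    show "pts ?X \<subseteq> orig_ball ?X s \<union> ?A"
      unfolding spherical_form_simps using sub by blast
    show "orig_ball ?X s \<union> ?A \<in> sets (spherical_measure :: ('a \<times> real) measure)"
      unfolding spherical.sets_cone_measure using open_ball by (intro sets.Un) auto
  qed
  also have "\<dots> \<le> emeasure spherical_measure (orig_ball ?X s) + emeasure spherical_measure ?A"
    using open_ball by (intro emeasure_subadditive) (auto simp: spherical.sets_cone_measure)
  finally show "emeasure spherical_measure (pts ?X)
      \<le> emeasure spherical_measure (orig_ball ?X s)" by (simp only: spherical_ball_pi_null add_0_right)
  show "emeasure spherical_measure (orig_ball ?X s)
      \<le> emeasure spherical_measure (pts ?X)"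
    by (rule emeasure_mono) (auto simp: orig_ball_def spherical.sets_cone_measure intro: borel_closed)
qed

lemma spherical_polar_model:
  "polar_model (spherical_form :: ('a::euclidean_space \<times> real, 'a) space_form) (\<bullet>) spherical_normal (\<lambda>_. 0)
    {0..pi} spherical_measure"
proof (rule polar_model.intro)
  let ?X = "spherical_form :: ('a \<times> real, 'a) space_form"
  let ?o = "(0, 1) :: 'a \<times> real"
  have po: "?o \<in> sphere 0 1" by (simp add: norm_Pair)
  have nn: "spherical_normal \<omega> \<bullet> spherical_normal \<omega> = 1" if "\<omega> \<in> Omega" for \<omega> :: "real \<times> 'a"
    using norm_spherical_normal[OF that] by (simp add: norm_eq_1)
  show "bounded_bilinear ((\<bullet>) :: 'a \<times> real \<Rightarrow> 'a \<times> real \<Rightarrow> real)" by (rule bounded_bilinear_inner)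
  show "x \<bullet> y = y \<bullet> x" for x y :: "'a \<times> real" by (rule inner_commute)
  show "closed (pts ?X)" by simp
  show "orig ?X \<in> pts ?X" using po by simp
  show "dst ?X x y \<le> dst ?X x' y' \<longleftrightarrow> (x - y) \<bullet> (x - y) \<le> (x' - y') \<bullet> (x' - y')"
    if "x \<in> pts ?X" "y \<in> pts ?X" "x' \<in> pts ?X" "y' \<in> pts ?X"
    for x y x' y' :: "'a \<times> real"
    using that gauge_sphere[of x y] gauge_sphere[of x' y'] by (simp add: arccos_le_mono)
  show "0 \<le> (x - y) \<bullet> (x - y)" for x y :: "'a \<times> real" by simp
  show "x = y" if "(x - y) \<bullet> (x - y) = 0" for x y :: "'a \<times> real" using that by simp
  have four: "(y - ?o) \<bullet> (y - ?o) \<le> 4" if "y \<in> sphere 0 1" for y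
    using gauge_sphere[OF that po] by linarith
  show "\<exists>R'. \<forall>x\<in>pts ?X. \<forall>y\<in>pts ?X.
      (x - orig ?X) \<bullet> (x - orig ?X) \<le> R \<longrightarrow> (x - y) \<bullet> (x - y) \<le> 1 \<longrightarrow>
      (y - orig ?X) \<bullet> (y - orig ?X) \<le> R'" for R :: real
    using four by (intro exI[of _ 4]) simp
  show bdd: "bounded {x \<in> pts ?X. (x - orig ?X) \<bullet> (x - orig ?X) \<le> R}"
    for R :: real by (rule bounded_subset[of "cball 0 1"]) auto
  show "continuous_on UNIV (spherical_normal :: real \<times> 'a \<Rightarrow> _)"
    unfolding spherical_normal_def[abs_def] by (intro continuous_intros) auto
  show "continuous_on UNIV (\<lambda>_ :: real \<times> 'a. 0 :: real)" by (rule continuous_on_const)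
  show "spherical_normal \<omega> \<bullet> spherical_normal \<omega> = 1" if "\<omega> \<in> Omega" for \<omega> :: "real \<times> 'a"
    using that by (rule nn)
  have iso: "(x - (2 * (x \<bullet> n)) *\<^sub>R n) \<bullet> (x - (2 * (x \<bullet> n)) *\<^sub>R n) = x \<bullet> x" if "n \<bullet> n = 1" for x n :: "'a \<times> real"
    using that by (simp add: inner_diff_left inner_diff_right inner_commute[of n x])
  show "x - (2 * (x \<bullet> spherical_normal \<omega> - 0)) *\<^sub>R spherical_normal \<omega> \<in> pts ?X"
    if "\<omega> \<in> Omega" "x \<in> pts ?X" for \<omega> :: "real \<times> 'a" and x
    using iso[OF nn[OF that(1)], of x] that(2) by (simp add: norm_eq_1)
  show "orig ?X \<bullet> spherical_normal \<omega> < 0"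
    if "0 < fst \<omega>" "fst \<omega> \<in> {0..pi}" for \<omega> :: "real \<times> 'a"
    using that sin_gt_zero[of "fst \<omega> / 2"] by (simp add: spherical_normal_def)
  have shift: "polar ?X t (- u) \<bullet> spherical_normal (r, u) = - sin (t + r / 2)"
    "polar ?X t (- u) - (2 * (polar ?X t (- u) \<bullet> spherical_normal (r, u) - 0)) *\<^sub>R spherical_normal (r, u)
      = polar ?X (t + r) u" if "u \<in> sphere 0 1" for t r and u :: 'a
    using that spherical_mirror_shift[of u t r] by simp_all
  show "orig ?X - (2 * (orig ?X \<bullet> spherical_normal \<omega> - 0)) *\<^sub>R spherical_normal \<omega>
      = polar ?X (fst \<omega>) (snd \<omega>)" if "\<omega> \<in> Omega" for \<omega> :: "real \<times> 'a"
    using that shift(2)[of "snd \<omega>" 0 "fst \<omega>"] by (auto simp: Omega_def)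
  show "polar ?X t (- u) \<bullet> spherical_normal (r, u) \<le> 0 \<and>
    polar ?X t (- u) - (2 * (polar ?X t (- u) \<bullet> spherical_normal (r, u) - 0)) *\<^sub>R spherical_normal (r, u)
      = polar ?X (t + r) u"
    if "0 \<le> t" "0 < r" "t + r \<in> {0..pi}" "u \<in> sphere 0 1" for t r and u :: 'a
    using shift[OF that(4)] that sin_ge_zero[of "t + r / 2"] by auto
  show "x \<in> closure {y \<in> pts ?X. y \<bullet> spherical_normal \<omega> < 0}"
    if \<omega>: "\<omega> \<in> Omega" and x: "x \<in> pts ?X" "x \<bullet> spherical_normal \<omega> = 0" for \<omega> :: "real \<times> 'a" and x
  proof -
    let ?n = "spherical_normal \<omega>"
    \<comment> \<open>The great circle that leaves \<open>x\<close> against the normal; its height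
      \<open>- sin t\<close> is negative for the parameters in question because 1 < pi.\<close>
    let ?g = "\<lambda>t. cos t *\<^sub>R x - sin t *\<^sub>R ?n"
    have c: "continuous_on UNIV ?g" by (intro continuous_intros)
    have "?g t \<bullet> ?g t = (cos t)\<^sup>2 + (sin t)\<^sup>2" for t
      using x nn[OF \<omega>] by (simp add: inner_diff_left inner_diff_right inner_commute[of ?n x] norm_eq_1 power2_eq_square)
    then have "norm (?g t) = 1" for t by (simp add: norm_eq_1)
    moreover have "?g t \<bullet> ?n < 0" if "0 < t" "t < 1" for t
      using x nn[OF \<omega>] that sin_gt_zero[of t] pi_gt3 by (simp add: inner_diff_left)
    ultimately show ?thesis using closure_curve[OF c, of "{y \<in> pts ?X. y \<bullet> ?n < 0}"] by simp
  qed
  show "x = y" if "\<omega> \<in> Omega" "x \<in> pts ?X" "y \<in> pts ?X"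
    "x \<bullet> spherical_normal \<omega> < 0" "y \<bullet> spherical_normal \<omega> < 0"
    "\<And>p. p \<in> pts ?X \<Longrightarrow> p \<bullet> spherical_normal \<omega> = 0 \<Longrightarrow> (p - x) \<bullet> (p - x) = (p - y) \<bullet> (p - y)"
    for x y and \<omega> :: "real \<times> 'a"
  proof (rule spherical_separation[OF norm_spherical_normal[OF that(1)]])
    fix p :: "'a \<times> real" assume p: "norm p = 1" "p \<bullet> spherical_normal \<omega> = 0"
    then have "(p - x) \<bullet> (p - x) = (p - y) \<bullet> (p - y)" by (intro that(6)) auto
    then show "p \<bullet> x = p \<bullet> y" using p that(2,3) by (simp add: gauge_sphere)
  qed (use that in auto)
  show "0 \<le> r" if "r \<in> {0..pi}" for r using that by simp
  show "r \<in> {0..pi}" if "0 \<le> r" "r \<le> s" "s \<in> {0..pi}" for r s using that by simp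
  show "polar ?X r u \<in> pts ?X" if "u \<in> sphere 0 1" for r and u :: 'a
    using that by (simp add: norm_Pair power_mult_distrib)
  show "\<exists>r\<in>{0..pi}. \<exists>u\<in>sphere 0 1. x = polar ?X r u" if "x \<in> pts ?X" for x :: "'a \<times> real"
    using spherical_polar_surj[of x] that by simp
  show "dst ?X (polar ?X r u) (orig ?X) = r" if "r \<in> {0..pi}" for r and u :: 'a
    using that by (simp add: arccos_cos)
  show "continuous_on UNIV (\<lambda>(r, u :: 'a). polar ?X r u)"
    unfolding split_def spherical_form_simps by (intro continuous_intros)
  show "0 \<le> polar ?X r v \<bullet> spherical_normal (0, u) \<and>
      polar ?X r v - (2 * (polar ?X r v \<bullet> spherical_normal (0, u) - 0)) *\<^sub>R spherical_normal (0, u)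
        = polar ?X r (v - (2 * (v \<bullet> u)) *\<^sub>R u)"
    if "r \<in> {0..pi}" "0 < v \<bullet> u" for r and u v :: 'a
    using that sin_ge_zero[of r] by (simp add: spherical_normal_def algebra_simps)
  show "sets (spherical_measure :: ('a \<times> real) measure) = sets borel" by (rule spherical.sets_cone_measure)
  show "emeasure spherical_measure (- pts ?X) = 0"
    by (simp only: spherical_form_simps spherical_level[symmetric] spherical.cone_measure_compl)
  show "vol ?X A = emeasure spherical_measure A" if "A \<in> sets borel" "A \<subseteq> pts ?X"
    for A :: "('a \<times> real) set"
    using that spherical.cone_over[of A] by (simp add: cone_vol_def spherical.emeasure_cone_measure spherical_level)
  show "distr spherical_measure borel (\<lambda>x. x - (2 * (x \<bullet> spherical_normal \<omega> - 0)) *\<^sub>R spherical_normal \<omega>) = spherical_measure"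
    if "\<omega> \<in> Omega" for \<omega> :: "real \<times> 'a"
    using inner_mirror_unit[OF norm_spherical_normal[OF that]] iso[OF nn[OF that]]
    unfolding diff_zero by (intro spherical.cone_measure_invariant) auto
  show "emeasure spherical_measure U \<noteq> 0" if "open U" "U \<inter> pts ?X \<noteq> {}" for U :: "('a \<times> real) set"
    using that by (intro spherical.cone_measure_pos) (auto simp: spherical_level ennreal_eq_0_iff)
  show "emeasure spherical_measure {x \<in> pts ?X. (x - orig ?X) \<bullet> (x - orig ?X) \<le> R} < \<infinity>"
    for R :: real
  proof (rule spherical.cone_measure_finite[OF _ _ bdd])
    have "closed (sphere (0 :: 'a \<times> real) 1 \<inter> {x. (x - (0, 1)) \<bullet> (x - (0, 1)) \<le> R})"
      by (intro closed_Int closed_Collect_le continuous_intros) auto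
    then show "{x \<in> pts ?X. (x - orig ?X) \<bullet> (x - orig ?X) \<le> R} \<in> sets borel"
      by (intro borel_closed) (simp add: Int_def)
  qed (auto simp: spherical_level)
  show "(\<exists>r\<in>{0..pi}. s < r \<and> r < t) \<or> emeasure spherical_measure (orig_ball ?X s)
      = emeasure spherical_measure (pts ?X)"
    if "0 \<le> s" "s < t" for s t
  proof (cases "s < pi")
    case True
    \<comment> \<open>The midpoint of \<open>s\<close> and \<open>t\<close>, cut off at pi to stay
      in the range of the radius.\<close>
    then have "s < min ((s + t) / 2) pi" "min ((s + t) / 2) pi < t" "min ((s + t) / 2) pi \<in> {0..pi}"
      using that by (auto simp: min_less_iff_disj)
    then show ?thesis by blast
  next
    case False
    then have "pi \<le> s" by simp
    then show ?thesis by (intro disjI2 orig_ball_spherical_pi)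
  qed
qed

section \<open>Hyperbolic space\<close>

lemma hyperbolic_form_simps [simp]:
  "pts hyperbolic_form = {(v, s). 0 < s \<and> s\<^sup>2 - v \<bullet> v = 1}"
  "dst hyperbolic_form = (\<lambda>x y. arcosh (snd x * snd y - fst x \<bullet> fst y))" "vol hyperbolic_form = cone_vol"
  "orig hyperbolic_form = (0, 1)" "polar hyperbolic_form = (\<lambda>r u. (sinh r *\<^sub>R u, cosh r))"
  by (simp_all add: hyperbolic_form_def)

text \<open>Signature with the minus sign on the last coordinate: positive on tangent vectors of the
  hyperboloid, and equal to \<open>- cosh d\<close> for two of its points.\<close>

definition minkowski :: "'a::euclidean_space \<times> real \<Rightarrow> 'a \<times> real \<Rightarrow> real" where
  "minkowski x y = fst x \<bullet> fst y - snd x * snd y"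

text \<open>The chord \<open>(sinh r u, cosh r - 1)\<close> divided by
  \<open>2 sinh (r / 2)\<close>, again continuous at r = 0.\<close>

definition hyperbolic_normal :: "real \<times> 'a::euclidean_space \<Rightarrow> 'a \<times> real" where
  "hyperbolic_normal \<omega> = (cosh (fst \<omega> / 2) *\<^sub>R snd \<omega>, sinh (fst \<omega> / 2))"

lemma minkowski_simps:
  "minkowski (x + y) z = minkowski x z + minkowski y z" "minkowski z (x + y) = minkowski z x + minkowski z y"
  "minkowski (x - y) z = minkowski x z - minkowski y z" "minkowski z (x - y) = minkowski z x - minkowski z y"
 "minkowski (- x) z = - minkowski x z" "minkowski z (- x) = - minkowski z x"
  "minkowski (t *\<^sub>R x) z = t * minkowski x z" "minkowski z (t *\<^sub>R x) = t * minkowski z x"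
  by (simp_all add: minkowski_def algebra_simps)

lemma minkowski_commute: "minkowski x y = minkowski y x"
  by (simp add: minkowski_def inner_commute)

lemma bounded_bilinear_minkowski: "bounded_bilinear (minkowski :: 'a::euclidean_space \<times> real \<Rightarrow> _)"
proof
  show "\<exists>K. \<forall>(x::'a \<times> real) y. norm (minkowski x y) \<le> norm x * norm y * K"
  proof (intro exI[of _ 2] allI)
    fix x y :: "'a \<times> real"
    have "\<bar>fst x \<bullet> fst y\<bar> \<le> norm (fst x) * norm (fst y)" by (rule Cauchy_Schwarz_ineq2)
    also have "\<dots> \<le> norm x * norm y" using norm_fst_le[where x = "fst x" and y = "snd x"] norm_fst_le[where x = "fst y" and y = "snd y"]
      by (intro mult_mono) simp_all
    finally have 1: "\<bar>fst x \<bullet> fst y\<bar> \<le> norm x * norm y" .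
    have 2: "\<bar>snd x * snd y\<bar> \<le> norm x * norm y"
      unfolding abs_mult
      using norm_snd_le[where x = "fst x" and y = "snd x"] norm_snd_le[where x = "fst y" and y = "snd y"]
      by (intro mult_mono) simp_all
    show "norm (minkowski x y) \<le> norm x * norm y * 2"
      using 1 2 unfolding minkowski_def real_norm_def by linarith
  qed
qed (simp_all add: minkowski_simps)

definition forward :: "('a::euclidean_space \<times> real) set" where
  "forward = {y. 0 < snd y}"

lemma quadratic_cone_hyperbolic:
  "quadratic_cone (\<lambda>x. - minkowski x x) (forward :: ('a::euclidean_space \<times> real) set)"
proof
  show "continuous_on UNIV (\<lambda>x. - minkowski x (x :: 'a \<times> real))"
    unfolding minkowski_def by (intro continuous_intros)
  show "open (forward :: ('a \<times> real) set)"
    unfolding forward_def by (intro open_Collect_less continuous_intros)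
qed (auto simp: minkowski_simps power2_eq_square forward_def)

interpretation hyperbolic: quadratic_cone "\<lambda>x. - minkowski x x" "forward :: ('a::euclidean_space \<times> real) set"
  by (rule quadratic_cone_hyperbolic)

abbreviation hyperbolic_measure :: "('a::euclidean_space \<times> real) measure" where
  "hyperbolic_measure \<equiv> hyperbolic.cone_measure (ennreal (real (DIM('a) + 1)))"

lemma hyperbolic_level: "hyperbolic.level = pts hyperbolic_form"
  unfolding hyperbolic.level_def by (auto simp: forward_def minkowski_def power2_eq_square)

lemma hyperboloid_iff: "x \<in> pts hyperbolic_form \<longleftrightarrow> 0 < snd x \<and> minkowski x x = - 1"
proof (cases x)
  case (Pair v s)
  have "s\<^sup>2 - v \<bullet> v = 1 \<longleftrightarrow> v \<bullet> v - s * s = - 1" unfolding power2_eq_square by linarith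
  then show ?thesis by (simp only: Pair hyperbolic_form_simps minkowski_def mem_Collect_eq prod.case fst_conv snd_conv)
qed

lemma hyperboloid_norm:
  assumes "x \<in> pts hyperbolic_form"
  shows "0 < snd x" "(snd x)\<^sup>2 = 1 + (norm (fst x))\<^sup>2" "norm (fst x) < snd x" "1 \<le> snd x"
proof -
  have x: "0 < snd x" "fst x \<bullet> fst x - snd x * snd x = - 1"
    using assms unfolding hyperboloid_iff minkowski_def by blast+
  show s: "0 < snd x" by (rule x(1))
  show e: "(snd x)\<^sup>2 = 1 + (norm (fst x))\<^sup>2"
    using x(2) unfolding power2_norm_eq_inner power2_eq_square[of "snd x"] by linarith
  have "(norm (fst x))\<^sup>2 < (snd x)\<^sup>2" using e by linarith
  then show "norm (fst x) < snd x" by (rule power2_less_imp_less[OF _ less_imp_le[OF s]])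
  have "1\<^sup>2 \<le> (snd x)\<^sup>2" using e zero_le_power2[of "norm (fst x)"] by (simp only: one_power2)
  then show "1 \<le> snd x" by (rule power2_le_imp_le[OF _ less_imp_le[OF s]])
qed

text \<open>Reversed Cauchy-Schwarz inequality, from \<open>(1 + a\<^sup>2) * (1 + b\<^sup>2) = (1 +
  a * b)\<^sup>2 + (a - b)\<^sup>2\<close>. In the equality case \<open>a = b\<close> and the
  ordinary Cauchy-Schwarz inequality is sharp as well.\<close>

lemma minkowski_le:
  assumes x: "x \<in> pts hyperbolic_form" and y: "y \<in> pts hyperbolic_form"
  shows "minkowski x y \<le> - 1" and "minkowski x y = - 1 \<Longrightarrow> x = y"
proof -
  define a b where "a = norm (fst x)" and "b = norm (fst y)"
  note X = hyperboloid_norm[OF x, folded a_def] and Y = hyperboloid_norm[OF y, folded b_def]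
  have "(snd x * snd y)\<^sup>2 = (1 + a\<^sup>2) * (1 + b\<^sup>2)" by (simp only: power_mult_distrib X(2) Y(2))
  also have "\<dots> = (1 + a * b)\<^sup>2 + (a - b)\<^sup>2" by (simp add: power2_eq_square algebra_simps)
  finally have sq: "(snd x * snd y)\<^sup>2 = (1 + a * b)\<^sup>2 + (a - b)\<^sup>2" .
  have "(1 + a * b)\<^sup>2 \<le> (snd x * snd y)\<^sup>2" unfolding sq by simp
  moreover have "0 \<le> snd x * snd y" using X(1) Y(1) by simp
  ultimately have ge: "1 + a * b \<le> snd x * snd y" by (rule power2_le_imp_le)
  have cs: "fst x \<bullet> fst y \<le> a * b" unfolding a_def b_def by (rule norm_cauchy_schwarz)
  show "minkowski x y \<le> - 1" using ge cs by (simp add: minkowski_def)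
  assume "minkowski x y = - 1"
  then have 1: "snd x * snd y = 1 + a * b" "fst x \<bullet> fst y = a * b" using ge cs by (auto simp: minkowski_def)
  then have "a = b" using sq[unfolded 1(1)] by simp
  then have "(snd x)\<^sup>2 = (snd y)\<^sup>2" using X(2) Y(2) by simp
  then have "snd x = snd y" using X(1) Y(1) by (simp add: power2_eq_iff)
  moreover have "(norm (fst x - fst y))\<^sup>2 = 0"
  proof -
    have "fst x \<bullet> fst x = b * b" "fst y \<bullet> fst y = b * b"
      using \<open>a = b\<close> power2_norm_eq_inner[of "fst x"] power2_norm_eq_inner[of "fst y"]
      by (simp_all add: a_def b_def power2_eq_square)
    then show ?thesis
      using 1(2) \<open>a = b\<close> unfolding power2_norm_eq_inner
      by (simp add: inner_diff_left inner_diff_right inner_commute[of "fst y" "fst x"])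
  qed
  ultimately show "x = y" by (simp add: prod_eq_iff)
qed

lemma minkowski_gauge:
  assumes "x \<in> pts hyperbolic_form" "y \<in> pts hyperbolic_form"
  shows "minkowski (x - y) (x - y) = - 2 - 2 * minkowski x y"
  using assms minkowski_commute[of y x] unfolding hyperboloid_iff by (simp add: minkowski_simps)

lemma minkowski_normal:
  assumes "\<omega> \<in> Omega"
  shows "minkowski (hyperbolic_normal \<omega>) (hyperbolic_normal \<omega>) = 1"
proof -
  have "snd \<omega> \<bullet> snd \<omega> = 1" using assms by (auto simp: Omega_def norm_eq_1)
  then have "minkowski (hyperbolic_normal \<omega>) (hyperbolic_normal \<omega>) = (cosh (fst \<omega> / 2))\<^sup>2 - (sinh (fst \<omega> / 2))\<^sup>2"
    by (simp add: minkowski_def hyperbolic_normal_def power2_eq_square)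
  then show ?thesis by (simp add: cosh_square_eq)
qed

lemma minkowski_mirror:
  assumes "minkowski n n = 1"
  shows "minkowski (x - (2 * minkowski x n) *\<^sub>R n) (x - (2 * minkowski x n) *\<^sub>R n) = minkowski x x"
    and "(x - (2 * minkowski x n) *\<^sub>R n) - (2 * minkowski (x - (2 * minkowski x n) *\<^sub>R n) n) *\<^sub>R n = x"
    and "linear (\<lambda>x. x - (2 * minkowski x n) *\<^sub>R n)"
proof -
  show "minkowski (x - (2 * minkowski x n) *\<^sub>R n) (x - (2 * minkowski x n) *\<^sub>R n) = minkowski x x"
    using assms minkowski_commute[of n x] by (simp add: minkowski_simps)
  show "(x - (2 * minkowski x n) *\<^sub>R n) - (2 * minkowski (x - (2 * minkowski x n) *\<^sub>R n) n) *\<^sub>R n = x"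
    using assms by (simp add: minkowski_simps)
  show "linear (\<lambda>x. x - (2 * minkowski x n) *\<^sub>R n)"
    by (rule linearI) (simp_all only: minkowski_simps scaleR_right_diff_distrib, simp_all add: algebra_simps)
qed

text \<open>By the half-angle formulas the last coordinate of the image is
  \<open>cosh r * s - sinh r * (v \<bullet> u)\<close>; it is positive because \<open>v\<close> is
  shorter than \<open>s\<close> and \<open>sinh r < cosh r\<close>.\<close>

lemma forward_mirror:
  assumes \<omega>: "\<omega> \<in> Omega" and x: "x \<in> forward" "0 < - minkowski x x"
  shows "x - (2 * minkowski x (hyperbolic_normal \<omega>)) *\<^sub>R hyperbolic_normal \<omega> \<in> forward"
proof -
  obtain r u where ru: "\<omega> = (r, u)" "0 \<le> r" "norm u = 1" using \<omega> by (auto simp: Omega_def)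
  obtain v s where vs: "x = (v, s)" by (cases x)
  have s: "0 < s" using x(1) by (simp add: vs forward_def)
  have "v \<bullet> v < s * s" using x(2) by (simp add: vs minkowski_def)
  then have "(norm v)\<^sup>2 < s\<^sup>2" by (simp add: power2_norm_eq_inner power2_eq_square[of s])
  then have vless: "norm v < s" using s by (intro power2_less_imp_less[of _ s]) auto
  have vu: "v \<bullet> u \<le> norm v" using norm_cauchy_schwarz[of v u] ru by simp
  have sh: "0 \<le> sinh r" using ru by simp
  have "sinh r * (v \<bullet> u) \<le> sinh r * s" using vu vless sh by (intro mult_left_mono) auto
  also have "\<dots> < cosh r * s" using s sinh_less_cosh_real[of r] by (intro mult_strict_right_mono)
  finally have "0 < cosh r * s - sinh r * (v \<bullet> u)" by simp
  also have "cosh r * s - sinh r * (v \<bullet> u)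
      = s - 2 * (v \<bullet> u * cosh (r / 2) - s * sinh (r / 2)) * sinh (r / 2)"
  proof -
    have "cosh r = 1 + 2 * (sinh (r / 2))\<^sup>2" using cosh_double[of "r / 2"] by (simp add: cosh_square_eq)
    moreover have "sinh r = 2 * sinh (r / 2) * cosh (r / 2)" using sinh_double[of "r / 2"] by simp
    ultimately show ?thesis by (simp add: algebra_simps power2_eq_square)
  qed
  finally show ?thesis by (simp add: forward_def vs ru minkowski_def hyperbolic_normal_def mult_ac)
qed

text \<open>As on the sphere, except that the part \<open>w\<close> of \<open>y - x\<close>
  orthogonal to \<open>n\<close> is space-like and cannot be scaled to the hyperboloid. It is
  combined with a wall point \<open>p0\<close> to give another wall point.\<close>

lemma hyperbolic_separation:
  fixes x y :: "'a::euclidean_space \<times> real"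
  assumes \<omega>: "\<omega> \<in> Omega" and x: "x \<in> pts hyperbolic_form" "minkowski x (hyperbolic_normal \<omega>) < 0"
    and y: "y \<in> pts hyperbolic_form" "minkowski y (hyperbolic_normal \<omega>) < 0"
    and eq: "\<And>p. p \<in> pts hyperbolic_form \<Longrightarrow> minkowski p (hyperbolic_normal \<omega>) = 0 \<Longrightarrow> minkowski p x = minkowski p y"
  shows "x = y"
proof -
  define n where "n = hyperbolic_normal \<omega>"
  have nn: "minkowski n n = 1" using \<omega> by (simp add: n_def minkowski_normal)
  obtain r u where ru: "\<omega> = (r, u)" "norm u = 1" using \<omega> by (auto simp: Omega_def)
  have uu: "u \<bullet> u = 1" using ru by (simp add: norm_eq_1)
  \<comment> \<open>The midpoint of the geodesic from the origin to its image, which lies on the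
    wall.\<close>
  define p0 where "p0 = (sinh (r / 2) *\<^sub>R u, cosh (r / 2))"
  have p0: "minkowski p0 p0 = - 1" "minkowski p0 n = 0" "0 < snd p0"
    by (auto simp: p0_def n_def minkowski_def hyperbolic_normal_def ru uu cosh_square_eq simp flip: power2_eq_square)
  define w where "w = (y - x) - minkowski (y - x) n *\<^sub>R n"
  have wn: "minkowski w n = 0" by (simp add: w_def minkowski_simps nn)
  have orth: "minkowski p w = 0" if "p \<in> pts hyperbolic_form" "minkowski p n = 0" for p
    using eq[of p] that by (simp add: w_def minkowski_simps n_def)
  have "w = 0"
  proof (rule ccontr)
    assume "w \<noteq> 0"
    have "minkowski p0 w = 0" using p0 by (intro orth) (simp_all only: hyperboloid_iff)
    then have e: "cosh (r / 2) * snd w = sinh (r / 2) * (u \<bullet> fst w)"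
      by (simp add: p0_def minkowski_def)
    \<comment> \<open>A nonzero vector orthogonal to the time-like \<open>p0\<close> is
      space-like.\<close>
    have pos: "0 < minkowski w w"
    proof (cases "fst w = 0")
      case True
      then have "snd w = 0" using e by simp
      then show ?thesis using True \<open>w \<noteq> 0\<close> by (simp add: prod_eq_iff)
    next
      case False
      have "\<bar>u \<bullet> fst w\<bar> \<le> norm (fst w)" using Cauchy_Schwarz_ineq2[of u "fst w"] ru by simp
      moreover have "\<bar>sinh (r / 2)\<bar> < cosh (r / 2)"
        using sinh_less_cosh_real[of "r / 2"] sinh_less_cosh_real[of "- (r / 2)"] by (simp add: abs_less_iff)
      moreover have "\<bar>sinh (r / 2)\<bar> * \<bar>u \<bullet> fst w\<bar> \<le> \<bar>sinh (r / 2)\<bar> * norm (fst w)"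
        using \<open>\<bar>u \<bullet> fst w\<bar> \<le> norm (fst w)\<close> by (intro mult_left_mono) auto
      ultimately have "\<bar>sinh (r / 2)\<bar> * \<bar>u \<bullet> fst w\<bar> < cosh (r / 2) * norm (fst w)"
        using False by (intro le_less_trans[OF \<open>\<bar>sinh (r / 2)\<bar> * \<bar>u \<bullet> fst w\<bar> \<le> \<bar>sinh (r / 2)\<bar> * norm (fst w)\<close>]
            mult_strict_right_mono) auto
      then have "cosh (r / 2) * \<bar>snd w\<bar> < cosh (r / 2) * norm (fst w)"
        using arg_cong[OF e, of abs] by (simp add: abs_mult)
      then have "\<bar>snd w\<bar> < norm (fst w)" by simp
      then have "\<bar>snd w\<bar>\<^sup>2 < (norm (fst w))\<^sup>2" by (intro power_strict_mono) auto
      then show ?thesis by (simp add: minkowski_def power2_norm_eq_inner power2_eq_square[of "snd w"])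
    qed
    \<comment> \<open>The sign makes the last coordinate nonnegative, so that \<open>p\<close> below
      lies on the upper sheet.\<close>
    define z where "z = (1 / sqrt (minkowski w w)) *\<^sub>R (if 0 \<le> snd w then w else - w)"
    have z: "0 \<le> snd z" "minkowski z z = 1" "minkowski z n = 0" "minkowski p0 z = 0" "minkowski z w \<noteq> 0"
      using pos wn \<open>minkowski p0 w = 0\<close>
      by (auto simp: z_def minkowski_simps)
    \<comment> \<open>With this coefficient the Minkowski square of \<open>p\<close> is -2 + 1 =
      -1.\<close>
    define p where "p = sqrt 2 *\<^sub>R p0 + z"
    have "minkowski z p0 = 0" using z(4) minkowski_commute[of z p0] by simp
    then have "minkowski p p = - 1" "minkowski p n = 0"
      using p0 z by (simp_all add: p_def minkowski_simps)
    moreover have "0 < snd p" using p0(3) z(1) by (simp add: p_def add_pos_nonneg)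
    ultimately have "p \<in> pts hyperbolic_form" "minkowski p n = 0"
      by (simp_all only: hyperboloid_iff)
    then have "minkowski p w = 0" by (rule orth)
    then show False using z(5) \<open>minkowski p0 w = 0\<close> by (simp add: p_def minkowski_simps)
  qed
  then have "y - x = minkowski (y - x) n *\<^sub>R n" by (simp add: w_def)
  then obtain k where k: "y = x + k *\<^sub>R n" by (metis add.commute diff_add_cancel)
  have "minkowski y y = minkowski x x + k * (2 * minkowski x n + k)"
    using minkowski_commute[of n x] by (simp add: k minkowski_simps nn algebra_simps)
  then have "k * (2 * minkowski x n + k) = 0" using x(1) y(1) unfolding hyperboloid_iff by simp
  moreover have "minkowski x n + k < 0" using y(2) nn by (simp add: k minkowski_simps flip: n_def)
  ultimately have "k = 0" using x(2) by (auto simp flip: n_def)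
  then show ?thesis by (simp add: k)
qed

lemma hyperbolic_mirror_shift:
  fixes u :: "'a::euclidean_space" and t r :: real
  assumes u: "norm u = 1"
  defines "x \<equiv> (sinh t *\<^sub>R (- u), cosh t)" and "n \<equiv> hyperbolic_normal (r, u)"
  shows "minkowski x n = - sinh (t + r / 2)"
    "x - (2 * minkowski x n) *\<^sub>R n = (sinh (t + r) *\<^sub>R u, cosh (t + r))"
proof -
  have uu: "u \<bullet> u = 1" using u by (simp add: norm_eq_1)
  show xn: "minkowski x n = - sinh (t + r / 2)"
    by (simp add: x_def n_def hyperbolic_normal_def minkowski_def uu sinh_add)
  have A: "sinh (t + r) = sinh ((t + r / 2) + r / 2)" "cosh (t + r) = cosh ((t + r / 2) + r / 2)"
    "sinh t = sinh ((t + r / 2) - r / 2)" "cosh t = cosh ((t + r / 2) - r / 2)" by (simp_all add: add.commute)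
  have s: "2 * sinh (t + r / 2) * cosh (r / 2) - sinh t = sinh (t + r)"
    unfolding A sinh_add[of "t + r / 2" "r / 2"] sinh_diff[of "t + r / 2" "r / 2"] by simp
  have c: "cosh t + 2 * sinh (t + r / 2) * sinh (r / 2) = cosh (t + r)"
    unfolding A cosh_add[of "t + r / 2" "r / 2"] cosh_diff[of "t + r / 2" "r / 2"] by simp
  show "x - (2 * minkowski x n) *\<^sub>R n = (sinh (t + r) *\<^sub>R u, cosh (t + r))"
    unfolding xn unfolding x_def n_def hyperbolic_normal_def
    by (simp add: s[symmetric] c[symmetric] scaleR_left_diff_distrib)
qed

lemma hyperbolic_polar_surj:
  assumes "x \<in> pts (hyperbolic_form :: ('a::euclidean_space \<times> real, 'a) space_form)"
  shows "\<exists>r\<in>{0..}. \<exists>u\<in>sphere 0 1. x = (sinh r *\<^sub>R u, cosh r)"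
proof -
  obtain v s where x: "x = (v, s)" by (cases x)
  have s: "1 \<le> s" "s\<^sup>2 - 1 = (norm v)\<^sup>2" using hyperboloid_norm[OF assms] by (simp_all add: x)
  then have r: "arcosh s \<in> {0..}" "cosh (arcosh s) = s" "sinh (arcosh s) = norm v"
    by (simp_all add: sinh_arcosh_real)
  obtain e :: 'a where e: "e \<in> Basis" using nonempty_Basis by blast
  show ?thesis
  proof (cases "v = 0")
    case True
    then show ?thesis using r e by (intro bexI[of _ "arcosh s"] bexI[of _ e]) (auto simp: x)
  next
    case False
    then show ?thesis using r
      by (intro bexI[of _ "arcosh s"] bexI[of _ "(1 / norm v) *\<^sub>R v"]) (auto simp: x)
  qed
qed

lemma hyperbolic_polar_model:
  "polar_model (hyperbolic_form :: ('a::euclidean_space \<times> real, 'a) space_form) minkowski hyperbolic_normal (\<lambda>_. 0)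
    {0..} hyperbolic_measure"
proof (rule polar_model.intro)
  let ?X = "hyperbolic_form :: ('a \<times> real, 'a) space_form"
  have po: "orig ?X \<in> pts ?X" by simp
  have og: "minkowski (x - orig ?X) (x - orig ?X) = 2 * snd x - 2" if "x \<in> pts ?X" for x
    using minkowski_gauge[OF that po] by (simp add: minkowski_def)
  show "bounded_bilinear (minkowski :: 'a \<times> real \<Rightarrow> 'a \<times> real \<Rightarrow> real)" by (rule bounded_bilinear_minkowski)
  show "minkowski x y = minkowski y x" for x y :: "'a \<times> real" by (rule minkowski_commute)
  \<comment> \<open>Positivity of the last coordinate is not a closed condition, but on the
    hyperboloid it amounts to being at least 1.\<close>
  have "pts ?X = {x. 1 \<le> snd x} \<inter> {x. minkowski x x = - 1}"
    using hyperboloid_norm(4) by (auto simp del: hyperbolic_form_simps simp: hyperboloid_iff) force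
  moreover have "closed ({x :: 'a \<times> real. 1 \<le> snd x} \<inter> {x. minkowski x x = - 1})"
    unfolding minkowski_def by (intro closed_Int closed_Collect_le closed_Collect_eq continuous_intros)
  ultimately show cl: "closed (pts ?X)" by simp
  show "orig ?X \<in> pts ?X" by (rule po)
  show "dst ?X x y \<le> dst ?X x' y' \<longleftrightarrow> minkowski (x - y) (x - y) \<le> minkowski (x' - y') (x' - y')"
    if "x \<in> pts ?X" "y \<in> pts ?X" "x' \<in> pts ?X" "y' \<in> pts ?X" for x y x' y'
  proof -
    have "1 \<le> snd x * snd y - fst x \<bullet> fst y" "1 \<le> snd x' * snd y' - fst x' \<bullet> fst y'"
      using minkowski_le(1)[OF that(1,2)] minkowski_le(1)[OF that(3,4)] by (simp_all add: minkowski_def)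
    then have "dst ?X x' y' < dst ?X x y \<longleftrightarrow> minkowski x y < minkowski x' y'"
      by (simp add: minkowski_def algebra_simps)
    then show ?thesis
      using minkowski_gauge[OF that(1,2)] minkowski_gauge[OF that(3,4)] by linarith
  qed
  show "0 \<le> minkowski (x - y) (x - y)" if "x \<in> pts ?X" "y \<in> pts ?X" for x y
    using minkowski_gauge[OF that] minkowski_le(1)[OF that] by linarith
  show "x = y" if "x \<in> pts ?X" "y \<in> pts ?X" "minkowski (x - y) (x - y) = 0" for x y
    using minkowski_gauge[OF that(1,2)] that(3) by (intro minkowski_le(2)[OF that(1,2)]) linarith
  \<comment> \<open>The gauge to the origin is twice the last coordinate minus 2. The last
    coordinate of \<open>x\<close> is at most \<open>1 + R / 2\<close>, and that of \<open>y\<close>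
    at most three times that of \<open>x\<close>.\<close>
  show "\<exists>R'. \<forall>x\<in>pts ?X. \<forall>y\<in>pts ?X. minkowski (x - orig ?X) (x - orig ?X) \<le> R \<longrightarrow>
      minkowski (x - y) (x - y) \<le> 1 \<longrightarrow> minkowski (y - orig ?X) (y - orig ?X) \<le> R'" for R
  proof (intro exI[of _ "6 * (1 + R / 2)"] ballI impI)
    fix x y assume x: "x \<in> pts ?X" and y: "y \<in> pts ?X" and
      R: "minkowski (x - orig ?X) (x - orig ?X) \<le> R" and 1: "minkowski (x - y) (x - y) \<le> 1"
    define a where "a = norm (fst x)"
    note X = hyperboloid_norm[OF x, folded a_def] and Y = hyperboloid_norm[OF y]
    have "- minkowski x y \<le> 3 / 2" using 1 minkowski_gauge[OF x y] by simp
    moreover have "fst x \<bullet> fst y \<le> a * snd y"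
    proof -
      have "fst x \<bullet> fst y \<le> a * norm (fst y)" unfolding a_def by (rule norm_cauchy_schwarz)
      also have "\<dots> \<le> a * snd y" using Y(3) by (intro mult_left_mono) (auto simp: a_def)
      finally show ?thesis .
    qed
    ultimately have "snd y * (snd x - a) \<le> 3 / 2" by (simp add: minkowski_def algebra_simps)
    \<comment> \<open>The factor \<open>2 * snd x\<close> dominates \<open>snd x + a\<close>, and
      \<open>(snd x - a) * (snd x + a) = 1\<close>.\<close>
    then have "snd y * (snd x - a) * (2 * snd x) \<le> 3 / 2 * (2 * snd x)"
      using X(1) by (intro mult_right_mono) auto
    moreover have "snd y * ((snd x - a) * (snd x + a)) \<le> snd y * ((snd x - a) * (2 * snd x))"
      using X Y(1) by (intro mult_left_mono) auto
    moreover have "(snd x - a) * (snd x + a) = 1" using X(2) by (simp add: power2_eq_square algebra_simps)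
    ultimately have "snd y \<le> 3 * snd x" by (simp add: mult.assoc)
    moreover have "2 * snd x - 2 \<le> R" using R unfolding og[OF x] .
    ultimately show "minkowski (y - orig ?X) (y - orig ?X) \<le> 6 * (1 + R / 2)"
      unfolding og[OF y] by (simp add: field_simps)
  qed
  show bdd: "bounded {x \<in> pts ?X. minkowski (x - orig ?X) (x - orig ?X) \<le> R}" for R
    unfolding bounded_iff
  proof (intro exI[of _ "2 * (1 + R / 2)"] ballI)
    fix x assume "x \<in> {x \<in> pts ?X. minkowski (x - orig ?X) (x - orig ?X) \<le> R}"
    then have x: "x \<in> pts ?X" "minkowski (x - orig ?X) (x - orig ?X) \<le> R"
      unfolding mem_Collect_eq by (rule conjunct1, rule conjunct2)
    have "norm x \<le> norm (fst x) + \<bar>snd x\<bar>" using norm_Pair_le[of "fst x" "snd x"] by simp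
    moreover have "2 * snd x - 2 \<le> R" using x(2) unfolding og[OF x(1)] .
    ultimately show "norm x \<le> 2 * (1 + R / 2)" using hyperboloid_norm(1,3)[OF x(1)] by simp
  qed
  show "continuous_on UNIV (hyperbolic_normal :: real \<times> 'a \<Rightarrow> _)"
    unfolding hyperbolic_normal_def[abs_def] by (intro continuous_intros) auto
  show "continuous_on UNIV (\<lambda>_ :: real \<times> 'a. 0 :: real)" by (rule continuous_on_const)
  show "minkowski (hyperbolic_normal \<omega>) (hyperbolic_normal \<omega>) = 1" if "\<omega> \<in> Omega" for \<omega> :: "real \<times> 'a"
    using that by (rule minkowski_normal)
  show "x - (2 * (minkowski x (hyperbolic_normal \<omega>) - 0)) *\<^sub>R hyperbolic_normal \<omega> \<in> pts ?X"
    if "\<omega> \<in> Omega" "x \<in> pts ?X" for \<omega> x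
    using forward_mirror[OF that(1), of x] minkowski_mirror(1)[OF minkowski_normal[OF that(1)], of x] that(2)
    unfolding hyperboloid_iff diff_zero by (simp add: forward_def)
  show "minkowski (orig ?X) (hyperbolic_normal \<omega>) < 0" if "0 < fst \<omega>" for \<omega> :: "real \<times> 'a"
    using that by (simp add: minkowski_def hyperbolic_normal_def)
  have shift: "minkowski (polar ?X t (- u)) (hyperbolic_normal (r, u)) = - sinh (t + r / 2)"
    "polar ?X t (- u) - (2 * (minkowski (polar ?X t (- u)) (hyperbolic_normal (r, u)) - 0)) *\<^sub>R hyperbolic_normal (r, u)
      = polar ?X (t + r) u" if "u \<in> sphere 0 1" for t r u
    using that hyperbolic_mirror_shift[of u t r] by simp_all
  show "orig ?X - (2 * (minkowski (orig ?X) (hyperbolic_normal \<omega>) - 0)) *\<^sub>R hyperbolic_normal \<omega>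
      = polar ?X (fst \<omega>) (snd \<omega>)" if "\<omega> \<in> Omega" for \<omega>
    using that shift(2)[of "snd \<omega>" 0 "fst \<omega>"] by (auto simp: Omega_def)
  show "minkowski (polar ?X t (- u)) (hyperbolic_normal (r, u)) \<le> 0 \<and>
    polar ?X t (- u) - (2 * (minkowski (polar ?X t (- u)) (hyperbolic_normal (r, u)) - 0)) *\<^sub>R hyperbolic_normal (r, u)
      = polar ?X (t + r) u"
    if "0 \<le> t" "0 < r" "t + r \<in> {0..}" "u \<in> sphere 0 1" for t r u
    using shift[OF that(4)] that by auto
  show "x \<in> closure {y \<in> pts ?X. minkowski y (hyperbolic_normal \<omega>) < 0}"
    if \<omega>: "\<omega> \<in> Omega" and x: "x \<in> pts ?X" "minkowski x (hyperbolic_normal \<omega>) = 0" for \<omega> x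
  proof -
    obtain r u where ru: "\<omega> = (r, u)" "0 \<le> r" "norm u = 1" using \<omega> by (auto simp: Omega_def)
    define n where "n = hyperbolic_normal \<omega>"
    have nn: "minkowski n n = 1" using \<omega> by (simp add: n_def minkowski_normal)
    have xn: "minkowski x n = 0" "minkowski n x = 0" "minkowski x x = - 1" "0 < snd x"
      using x minkowski_commute[of n x] unfolding hyperboloid_iff by (simp_all add: n_def)
    let ?g = "\<lambda>t. cosh t *\<^sub>R x - sinh t *\<^sub>R n"
    have c: "continuous_on UNIV ?g" by (intro continuous_intros)
    have "minkowski (?g t) (?g t) = (sinh t)\<^sup>2 - (cosh t)\<^sup>2" for t
      using xn nn by (simp add: minkowski_simps power2_eq_square)
    then have gg: "minkowski (?g t) (?g t) = - 1" for t by (simp add: cosh_square_eq)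
    \<comment> \<open>No wall point is closer to the origin than \<open>r / 2\<close>. This height
      keeps the geodesic \<open>?g\<close>, which descends along \<open>n\<close>, on the upper
      sheet.\<close>
    have snd_x: "cosh (r / 2) \<le> snd x"
    proof -
      define k where "k = cosh (r / 2)"
      have k: "0 < k" "(sinh (r / 2))\<^sup>2 = k\<^sup>2 - 1" by (simp_all add: k_def cosh_square_eq)
      have "k * (fst x \<bullet> u) = snd x * sinh (r / 2)"
        using xn(1) by (simp add: n_def ru minkowski_def hyperbolic_normal_def k_def)
      then have "(k * (fst x \<bullet> u))\<^sup>2 = (snd x)\<^sup>2 * (k\<^sup>2 - 1)" by (simp add: power_mult_distrib k(2))
      moreover have "(fst x \<bullet> u)\<^sup>2 \<le> (norm (fst x))\<^sup>2"
        using Cauchy_Schwarz_ineq2[of "fst x" u] ru by (simp add: abs_le_square_iff[symmetric])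
      then have "k\<^sup>2 * (fst x \<bullet> u)\<^sup>2 \<le> k\<^sup>2 * (norm (fst x))\<^sup>2" by (intro mult_left_mono) auto
      moreover have "(norm (fst x))\<^sup>2 = (snd x)\<^sup>2 - 1" using hyperboloid_norm(2)[OF x(1)] by simp
      ultimately have "k\<^sup>2 \<le> (snd x)\<^sup>2" by (simp add: power_mult_distrib algebra_simps)
      then have "k \<le> snd x" by (rule power2_le_imp_le[OF _ less_imp_le[OF xn(4)]])
      then show ?thesis by (simp only: k_def)
    qed
    have pos: "0 < snd (?g t)" if "0 < t" for t
    proof -
      have "sinh t * sinh (r / 2) \<le> sinh t * cosh (r / 2)"
        using that sinh_less_cosh_real[of "r / 2"] by (intro mult_left_mono) auto
      also have "\<dots> < cosh t * cosh (r / 2)"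
        by (intro mult_strict_right_mono sinh_less_cosh_real) simp
      also have "\<dots> \<le> cosh t * snd x" using snd_x by (intro mult_left_mono) auto
      finally show ?thesis by (simp add: n_def hyperbolic_normal_def ru)
    qed
    have "?g t \<in> {y \<in> pts ?X. minkowski y n < 0}" if "0 < t" for t
      using pos[OF that] gg[of t] xn nn that unfolding mem_Collect_eq hyperboloid_iff by (simp add: minkowski_simps)
    then show ?thesis using closure_curve[OF c, of "{y \<in> pts ?X. minkowski y n < 0}"] by (simp add: n_def)
  qed
  show "x = y" if "\<omega> \<in> Omega" "x \<in> pts ?X" "y \<in> pts ?X"
    "minkowski x (hyperbolic_normal \<omega>) < 0" "minkowski y (hyperbolic_normal \<omega>) < 0"
    "\<And>p. p \<in> pts ?X \<Longrightarrow> minkowski p (hyperbolic_normal \<omega>) = 0 \<Longrightarrow> minkowski (p - x) (p - x) = minkowski (p - y) (p - y)"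
    for x y \<omega>
  proof (rule hyperbolic_separation[OF that(1,2,4,3,5)])
    fix p assume p: "p \<in> pts ?X" "minkowski p (hyperbolic_normal \<omega>) = 0"
    then have "minkowski (p - x) (p - x) = minkowski (p - y) (p - y)" by (rule that(6))
    then show "minkowski p x = minkowski p y"
      unfolding minkowski_gauge[OF p(1) that(2)] minkowski_gauge[OF p(1) that(3)] by simp
  qed
  show "0 \<le> r" if "r \<in> {0..}" for r :: real using that by simp
  show "r \<in> {0..}" if "0 \<le> r" for r :: real using that by simp
  show "polar ?X r u \<in> pts ?X" if "u \<in> sphere 0 1" for r u
    using that by (simp add: norm_eq_1 cosh_square_eq flip: power2_eq_square)
  show "\<exists>r\<in>{0..}. \<exists>u\<in>sphere 0 1. x = polar ?X r u" if "x \<in> pts ?X" for x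
    using hyperbolic_polar_surj[OF that] by simp
  show "dst ?X (polar ?X r u) (orig ?X) = r" if "r \<in> {0..}" for r u
    using that by (simp add: arcosh_cosh_real)
  show "continuous_on UNIV (\<lambda>(r, u). polar ?X r u)"
    unfolding split_def hyperbolic_form_simps by (intro continuous_intros)
  show "0 \<le> minkowski (polar ?X r v) (hyperbolic_normal (0, u)) \<and>
      polar ?X r v - (2 * (minkowski (polar ?X r v) (hyperbolic_normal (0, u)) - 0)) *\<^sub>R hyperbolic_normal (0, u)
        = polar ?X r (v - (2 * (v \<bullet> u)) *\<^sub>R u)"
    if "r \<in> {0..}" "0 < v \<bullet> u" for r u v
    using that by (simp add: hyperbolic_normal_def minkowski_def algebra_simps)
  show "sets (hyperbolic_measure :: ('a \<times> real) measure) = sets borel" by (rule hyperbolic.sets_cone_measure)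
  show "emeasure hyperbolic_measure (- pts ?X) = 0"
    by (simp only: hyperbolic_level[symmetric] hyperbolic.cone_measure_compl)
  show "vol ?X A = emeasure hyperbolic_measure A" if "A \<in> sets borel" "A \<subseteq> pts ?X" for A
    using hyperbolic.cone_over[of A] that unfolding hyperbolic_level
    by (simp add: cone_vol_def hyperbolic.emeasure_cone_measure)
  show "distr hyperbolic_measure borel
      (\<lambda>x. x - (2 * (minkowski x (hyperbolic_normal \<omega>) - 0)) *\<^sub>R hyperbolic_normal \<omega>) = hyperbolic_measure"
    if "\<omega> \<in> Omega" for \<omega> :: "real \<times> 'a"
    unfolding diff_zero
    by (rule hyperbolic.cone_measure_invariant)
      (simp_all only: minkowski_mirror[OF minkowski_normal[OF that]] forward_mirror[OF that])
  show "emeasure hyperbolic_measure U \<noteq> 0" if "open U" "U \<inter> pts ?X \<noteq> {}" for U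
    using that unfolding hyperbolic_level[symmetric]
    by (intro hyperbolic.cone_measure_pos) (auto simp: ennreal_eq_0_iff)
  show "emeasure hyperbolic_measure {x \<in> pts ?X. minkowski (x - orig ?X) (x - orig ?X) \<le> R} < \<infinity>" for R
  proof (rule hyperbolic.cone_measure_finite[OF _ _ bdd])
    have "closed (pts ?X \<inter> {x. minkowski (x - orig ?X) (x - orig ?X) \<le> R})"
      unfolding minkowski_def by (intro closed_Int closed_Collect_le continuous_intros cl)
    moreover have "pts ?X \<inter> {x. minkowski (x - orig ?X) (x - orig ?X) \<le> R}
        = {x \<in> pts ?X. minkowski (x - orig ?X) (x - orig ?X) \<le> R}" by blast
    ultimately have "closed {x \<in> pts ?X. minkowski (x - orig ?X) (x - orig ?X) \<le> R}" by (simp only:)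
    then show "{x \<in> pts ?X. minkowski (x - orig ?X) (x - orig ?X) \<le> R} \<in> sets borel"
      by (rule borel_closed)
    show "{x \<in> pts ?X. minkowski (x - orig ?X) (x - orig ?X) \<le> R} \<subseteq> hyperbolic.level"
      unfolding hyperbolic_level by blast
  qed simp
  show "(\<exists>r\<in>{0..}. s < r \<and> r < t) \<or> emeasure hyperbolic_measure (orig_ball ?X s) = emeasure hyperbolic_measure (pts ?X)"
    if "0 \<le> s" "s < t" for s t :: real
    using dense[OF that(2)] that(1) by auto
qed

section \<open>The three spaces together\<close>

theorem theorem2p2:
  fixes \<mu> :: "(real \<times> 'a::euclidean_space) measure"
    and G :: "'a set"
  assumes "prob_space \<mu>"
    and "sets \<mu> = sets (restrict_space borel (Omega :: (real \<times> 'a) set))"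
    and "emeasure \<mu> {\<omega> \<in> Omega. fst \<omega> = 0} = 0"
    and "G = {u \<in> sphere 0 1. (0, u) \<in> measure_support \<mu>}"
    and "\<And>x. x \<in> sphere 0 1 \<Longrightarrow> sphere 0 1 \<subseteq> closure (folding_orbit G x)"
  shows "(AE w in (\<Pi>\<^sub>M i\<in>(UNIV::nat set). \<mu>). \<forall>f\<in>Cc_plus (euclidean_form :: ('a, 'a) space_form).
           (\<lambda>n. sup_norm euclidean_form (\<lambda>x. polarizations euclidean_form (map w [0..<n]) f x
                  - sym_decr_rearr euclidean_form f x)) \<longlonglongrightarrow> 0)
       \<and> (AE w in (\<Pi>\<^sub>M i\<in>(UNIV::nat set). \<mu>). \<forall>f\<in>Cc_plus (hyperbolic_form :: ('a \<times> real, 'a) space_form).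
           (\<lambda>n. sup_norm hyperbolic_form (\<lambda>x. polarizations hyperbolic_form (map w [0..<n]) f x
                  - sym_decr_rearr hyperbolic_form f x)) \<longlonglongrightarrow> 0)
       \<and> (emeasure \<mu> {\<omega> \<in> Omega. fst \<omega> > pi} = 0 \<longrightarrow>
          (AE w in (\<Pi>\<^sub>M i\<in>(UNIV::nat set). \<mu>). \<forall>f\<in>Cc_plus (spherical_form :: ('a \<times> real, 'a) space_form).
           (\<lambda>n. sup_norm spherical_form (\<lambda>x. polarizations spherical_form (map w [0..<n]) f x
                  - sym_decr_rearr spherical_form f x)) \<longlonglongrightarrow> 0))"
proof -
  have space: "space \<mu> = Omega"
    using sets_eq_imp_space_eq[OF assms(2)] by (simp add: space_restrict_space)
  have rel_sets: "{\<omega> \<in> Omega. fst \<omega> \<in> S} \<in> sets \<mu>" if "S \<in> sets borel" for S :: "real set"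
  proof -
    have "fst -` S \<in> sets (borel :: (real \<times> 'a) measure)"
      using measurable_sets[OF borel_measurable_continuous_onI[OF continuous_on_fst[OF continuous_on_id]] that]
      by simp
    then show ?thesis
      unfolding assms(2) sets_restrict_space by (intro image_eqI[of _ _ "fst -` S"]) auto
  qed
  have "AE \<omega> in \<mu>. \<omega> \<notin> {\<omega> \<in> Omega. fst \<omega> \<in> {0}}"
    using assms(3) rel_sets[of "{0}"] by (intro AE_not_in null_setsI) auto
  then have pos: "AE \<omega> in \<mu>. \<omega> \<in> Omega \<and> 0 < fst \<omega>"
    using AE_space by eventually_elim (auto simp: space Omega_def less_le)
  interpret E: polar_model "euclidean_form :: ('a, 'a) space_form" "(\<bullet>)" snd "\<lambda>\<omega>. fst \<omega> / 2" "{0..}" lborel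
    by (rule euclidean_polar_model)
  interpret H: polar_model "hyperbolic_form :: ('a \<times> real, 'a) space_form" minkowski hyperbolic_normal "\<lambda>_. 0"
    "{0..}" hyperbolic_measure
    by (rule hyperbolic_polar_model)
  interpret S: polar_model "spherical_form :: ('a \<times> real, 'a) space_form" "(\<bullet>)" spherical_normal "\<lambda>_. 0"
    "{0..pi}" spherical_measure
    by (rule spherical_polar_model)
  have "AE \<omega> in \<mu>. \<omega> \<in> E.valid" using pos by eventually_elim (auto simp: E.valid_def)
  then have "random_polarizations (euclidean_form :: ('a, 'a) space_form) (\<bullet>) snd (\<lambda>\<omega>. fst \<omega> / 2) {0..} lborel \<mu> G"
    by (intro random_polarizations.intro random_polarizations_axioms.intro euclidean_polar_model assms)
  note E = random_polarizations.AE_polarizations_converge[OF this]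
  have "AE \<omega> in \<mu>. \<omega> \<in> H.valid" using pos by eventually_elim (auto simp: H.valid_def)
  then have "random_polarizations (hyperbolic_form :: ('a \<times> real, 'a) space_form) minkowski hyperbolic_normal (\<lambda>_. 0)
      {0..} hyperbolic_measure \<mu> G"
    by (intro random_polarizations.intro random_polarizations_axioms.intro hyperbolic_polar_model assms)
  note H = random_polarizations.AE_polarizations_converge[OF this]
  have S: "AE w in (\<Pi>\<^sub>M i\<in>(UNIV::nat set). \<mu>). \<forall>f\<in>Cc_plus (spherical_form :: ('a \<times> real, 'a) space_form).
       (\<lambda>n. sup_norm spherical_form (\<lambda>x. polarizations spherical_form (map w [0..<n]) f x
              - sym_decr_rearr spherical_form f x)) \<longlonglongrightarrow> 0"
    if "emeasure \<mu> {\<omega> \<in> Omega. fst \<omega> > pi} = 0"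
  proof -
    have "AE \<omega> in \<mu>. \<omega> \<notin> {\<omega> \<in> Omega. fst \<omega> \<in> {pi<..}}"
      using that rel_sets[of "{pi<..}"] by (intro AE_not_in null_setsI) auto
    with pos have "AE \<omega> in \<mu>. \<omega> \<in> S.valid" by eventually_elim (auto simp: S.valid_def)
    then have "random_polarizations (spherical_form :: ('a \<times> real, 'a) space_form) (\<bullet>) spherical_normal (\<lambda>_. 0)
        {0..pi} spherical_measure \<mu> G"
      by (intro random_polarizations.intro random_polarizations_axioms.intro spherical_polar_model assms)
    then show ?thesis by (rule random_polarizations.AE_polarizations_converge)
  qed
  from E H S show ?thesis by (intro conjI impI)
qed

end
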